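(* Let $i:\Sigma\hookrightarrow Y_0$ be a codimension-two stratum of a threefold $Y_0$ with transverse Coble singularity $\frac14(1,1)$. Assume that the Betti realization functor $\operatorname{Real}_B:D^{\mathbb Z}_{\mathrm{mot}}(Y_0)\to D^b_c(Y_0,\mathbb Z)$ commutes with cones, multiplication by integers, shifts, and $i_*$. Then $$\operatorname{Real}_B\left(\mathcal T^{\mathrm{mot}}_{2,\Sigma}\right)\cong i_*(\mathbb Z/2)_\Sigma[2],$$ and the morphism $$\mathcal T^{\mathrm{mot}}_{2,\Sigma}\longrightarrow\mathcal T^{\mathrm{mot}}_{4,\Sigma}$$ realizes the inclusion $$i_*(\mathbb Z/2)_\Sigma[2]\longrightarrow i_*(\mathbb Z/4)_\Sigma[2]$$ with image $i_*(2E_\Sigma)[2]$.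
   Context: The setting is any integral motivic sheaf formalism $D^{\mathbb Z}_{\mathrm{mot}}(-)$ with a unit object, cones, shifts, proper pushforward, and a Betti realization $\operatorname{Real}_B$ (under which the unit $\mathbf 1_\Sigma$ on $\Sigma$ goes to the constant sheaf $\mathbb Z_\Sigma$). For $n=2,4$ put $\mathbf 1_\Sigma/n:=\operatorname{Cone}(\mathbf 1_\Sigma\xrightarrow{n}\mathbf 1_\Sigma)$ and $\mathcal T^{\mathrm{mot}}_{n,\Sigma}:=i_*(\mathbf 1_\Sigma/n)[2]$. The object $\mathcal T^{\mathrm{mot}}_{4,\Sigma}$ is the motivic lift of the full Coble package, and $\mathcal T^{\mathrm{mot}}_{2,\Sigma}$ is called its motivic order-two (Benoist–Ottem) shadow. By definition the shadow comes with a natural morphism $\mathcal T^{\mathrm{mot}}_{2,\Sigma}\to\mathcal T^{\mathrm{mot}}_{4,\Sigma}$, obtained by applying $i_*(-)[2]$ to a map $\mathbf 1_\Sigma/2\to\mathbf 1_\Sigma/4$ which is the motivic representative of the inclusion $\mathbb Z/2\hookrightarrow\mathbb Z/4$, $1\mapsto2$. No explicit construction of this map is specified; it is taken as part of the data. The singularity $\frac14(1,1)$ is $\mathbb C^2/\mu_4$ with $\mu_4$ acting by scalars; its link is the lens space $L(4,1)=S^3/\mu_4$. The transverse type is locally trivial along $\Sigma$, and $E_\Sigma\cong(\mathbb Z/4)_\Sigma$ is the local system on $\Sigma$ with fiber $H^2(L(4,1),\mathbb Z)_{\mathrm{tors}}\cong\mathbb Z/4$; $2E_\Sigma\subset E_\Sigma$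 is the order-two sublocal system. *)

theory Defs
  imports "HOL-Analysis.Analysis" "HOL-Homology.Homology"
begin

section \<open>Categories, triangulated categories, localization\<close>

record ('o, 'm) cat =
  ob :: "'o set"
  arr :: "'m set"
  src :: "'m \<Rightarrow> 'o"
  tgt :: "'m \<Rightarrow> 'o"
  cmp :: "'m \<Rightarrow> 'm \<Rightarrow> 'm"
  idt :: "'o \<Rightarrow> 'm"

definition Hom :: "('o, 'm, 'z) cat_scheme \<Rightarrow> 'o \<Rightarrow> 'o \<Rightarrow> 'm set" where
  "Hom C A B = {f \<in> arr C. src C f = A \<and> tgt C f = B}"

definition category :: "('o, 'm, 'z) cat_scheme \<Rightarrow> bool" where
  "category C \<longleftrightarrow>
     (\<forall>f\<in>arr C. src C f \<in> ob C \<and> tgt C f \<in> ob C) \<and>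
     (\<forall>A\<in>ob C. idt C A \<in> Hom C A A) \<and>
     (\<forall>f\<in>arr C. cmp C f (idt C (src C f)) = f \<and> cmp C (idt C (tgt C f)) f = f) \<and>
     (\<forall>f\<in>arr C. \<forall>g\<in>arr C. src C g = tgt C f \<longrightarrow> cmp C g f \<in> Hom C (src C f) (tgt C g)) \<and>
     (\<forall>f\<in>arr C. \<forall>g\<in>arr C. \<forall>h\<in>arr C. src C g = tgt C f \<longrightarrow> src C h = tgt C g \<longrightarrow>
        cmp C h (cmp C g f) = cmp C (cmp C h g) f)"

definition iso_arr :: "('o, 'm, 'z) cat_scheme \<Rightarrow> 'o \<Rightarrow> 'o \<Rightarrow> 'm \<Rightarrow> bool" where
  "iso_arr C A B f \<longleftrightarrow> A \<in> ob C \<and> B \<in> ob C \<and> f \<in> Hom C A B \<and>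
     (\<exists>g\<in>Hom C B A. cmp C g f = idt C A \<and> cmp C f g = idt C B)"

definition isomorphic_in :: "('o, 'm, 'z) cat_scheme \<Rightarrow> 'o \<Rightarrow> 'o \<Rightarrow> bool" where
  "isomorphic_in C A B \<longleftrightarrow> (\<exists>f. iso_arr C A B f)"

type_synonym ('o, 'm, 'o2, 'm2) func = "('o \<Rightarrow> 'o2) \<times> ('m \<Rightarrow> 'm2)"

definition is_functor ::
  "('o, 'm, 'y) cat_scheme \<Rightarrow> ('o2, 'm2, 'z) cat_scheme \<Rightarrow> ('o, 'm, 'o2, 'm2) func \<Rightarrow> bool" where
  "is_functor C D F \<longleftrightarrow>
     (\<forall>A\<in>ob C. fst F A \<in> ob D \<and> snd F (idt C A) = idt D (fst F A)) \<and>
     (\<forall>f\<in>arr C. snd F f \<in> Hom D (fst F (src C f)) (fst F (tgt C f))) \<and>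
     (\<forall>f\<in>arr C. \<forall>g\<in>arr C. src C g = tgt C f \<longrightarrow>
        snd F (cmp C g f) = cmp D (snd F g) (snd F f))"

definition full_sub :: "('o, 'm, 'z) cat_scheme \<Rightarrow> 'o set \<Rightarrow> ('o, 'm, 'z) cat_scheme" where
  "full_sub C P = C\<lparr>ob := ob C \<inter> P, arr := {f \<in> arr C. src C f \<in> P \<and> tgt C f \<in> P}\<rparr>"

record ('o, 'm) tricat = "('o, 'm) cat" +
  addm :: "'m \<Rightarrow> 'm \<Rightarrow> 'm"
  zerom :: "'o \<Rightarrow> 'o \<Rightarrow> 'm"
  shiftf :: "('o, 'm, 'o, 'm) func"
  triangles :: "('m \<times> 'm \<times> 'm) set"

definition hom_group :: "('o, 'm, 'z) tricat_scheme \<Rightarrow> 'o \<Rightarrow> 'o \<Rightarrow> 'm monoid" where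
  "hom_group C A B = \<lparr>carrier = Hom C A B, monoid.mult = addm C, one = zerom C A B\<rparr>"

definition int_mult :: "('o, 'm, 'z) tricat_scheme \<Rightarrow> int \<Rightarrow> 'm \<Rightarrow> 'm" where
  "int_mult C n f = f [^]\<^bsub>hom_group C (src C f) (tgt C f)\<^esub> n"

abbreviation shift_ob :: "('o, 'm, 'z) tricat_scheme \<Rightarrow> 'o \<Rightarrow> 'o" where
  "shift_ob C \<equiv> fst (shiftf C)"

abbreviation shift_arr :: "('o, 'm, 'z) tricat_scheme \<Rightarrow> 'm \<Rightarrow> 'm" where
  "shift_arr C \<equiv> snd (shiftf C)"

definition additive_category :: "('o, 'm, 'z) tricat_scheme \<Rightarrow> bool" where
  "additive_category C \<longleftrightarrow> category C \<and>
     (\<forall>A\<in>ob C. \<forall>B\<in>ob C. comm_group (hom_group C A B)) \<and>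
     (\<forall>A\<in>ob C. \<forall>B\<in>ob C. \<forall>D\<in>ob C. \<forall>f\<in>Hom C A B. \<forall>f'\<in>Hom C A B. \<forall>g\<in>Hom C B D. \<forall>g'\<in>Hom C B D.
        cmp C g (addm C f f') = addm C (cmp C g f) (cmp C g f') \<and>
        cmp C (addm C g g') f = addm C (cmp C g f) (cmp C g' f)) \<and>
     (\<exists>Z\<in>ob C. idt C Z = zerom C Z Z) \<and>
     (\<forall>A\<in>ob C. \<forall>B\<in>ob C. \<exists>P\<in>ob C. \<exists>i\<in>Hom C A P. \<exists>j\<in>Hom C B P. \<exists>p\<in>Hom C P A. \<exists>q\<in>Hom C P B.
        cmp C p i = idt C A \<and> cmp C q j = idt C B \<and>
        addm C (cmp C i p) (cmp C j q) = idt C P)"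

definition candidate_triangle ::
  "('o, 'm, 'z) tricat_scheme \<Rightarrow> 'o \<Rightarrow> 'o \<Rightarrow> 'o \<Rightarrow> 'm \<Rightarrow> 'm \<Rightarrow> 'm \<Rightarrow> bool" where
  "candidate_triangle C X Y Z f g h \<longleftrightarrow> X \<in> ob C \<and> Y \<in> ob C \<and> Z \<in> ob C \<and>
     f \<in> Hom C X Y \<and> g \<in> Hom C Y Z \<and> h \<in> Hom C Z (shift_ob C X)"

definition dist_triangle ::
  "('o, 'm, 'z) tricat_scheme \<Rightarrow> 'o \<Rightarrow> 'o \<Rightarrow> 'o \<Rightarrow> 'm \<Rightarrow> 'm \<Rightarrow> 'm \<Rightarrow> bool" where
  "dist_triangle C X Y Z f g h \<longleftrightarrow> candidate_triangle C X Y Z f g h \<and> (f, g, h) \<in> triangles C"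

definition triangulated_category :: "('o, 'm, 'z) tricat_scheme \<Rightarrow> bool" where
  "triangulated_category C \<longleftrightarrow> additive_category C \<and>
     \<comment> \<open>the shift is an additive autoequivalence\<close>
     is_functor C C (shiftf C) \<and>
     (\<forall>A\<in>ob C. \<forall>B\<in>ob C.
        shift_arr C \<in> hom (hom_group C A B) (hom_group C (shift_ob C A) (shift_ob C B)) \<and>
        bij_betw (shift_arr C) (Hom C A B) (Hom C (shift_ob C A) (shift_ob C B))) \<and>
     (\<forall>B\<in>ob C. \<exists>A\<in>ob C. isomorphic_in C (shift_ob C A) B) \<and>
     \<comment> \<open>TR1\<close>
     (\<forall>X Y Z f g h X' Y' Z' f' g' h' a b c.
        dist_triangle C X Y Z f g h \<longrightarrow> candidate_triangle C X' Y' Z' f' g' h' \<longrightarrow>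
        iso_arr C X X' a \<longrightarrow> iso_arr C Y Y' b \<longrightarrow> iso_arr C Z Z' c \<longrightarrow>
        cmp C b f = cmp C f' a \<longrightarrow> cmp C c g = cmp C g' b \<longrightarrow>
        cmp C (shift_arr C a) h = cmp C h' c \<longrightarrow>
        dist_triangle C X' Y' Z' f' g' h') \<and>
     (\<forall>X\<in>ob C. \<forall>Z\<in>ob C. idt C Z = zerom C Z Z \<longrightarrow>
        dist_triangle C X X Z (idt C X) (zerom C X Z) (zerom C Z (shift_ob C X))) \<and>
     (\<forall>X\<in>ob C. \<forall>Y\<in>ob C. \<forall>f\<in>Hom C X Y. \<exists>Z g h. dist_triangle C X Y Z f g h) \<and>
     \<comment> \<open>TR2\<close>
     (\<forall>X Y Z f g h. candidate_triangle C X Y Z f g h \<longrightarrow>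
        (dist_triangle C X Y Z f g h \<longleftrightarrow>
         dist_triangle C Y Z (shift_ob C X) g h (int_mult C (-1) (shift_arr C f)))) \<and>
     \<comment> \<open>TR3\<close>
     (\<forall>X Y Z f g h X' Y' Z' f' g' h' a b.
        dist_triangle C X Y Z f g h \<longrightarrow> dist_triangle C X' Y' Z' f' g' h' \<longrightarrow>
        a \<in> Hom C X X' \<longrightarrow> b \<in> Hom C Y Y' \<longrightarrow> cmp C b f = cmp C f' a \<longrightarrow>
        (\<exists>c\<in>Hom C Z Z'. cmp C c g = cmp C g' b \<and> cmp C (shift_arr C a) h = cmp C h' c)) \<and>
     \<comment> \<open>TR4\<close>
     (\<forall>X Y Z P Q R f g i j k l m n.
        dist_triangle C X Y P f i j \<longrightarrow> dist_triangle C Y Z Q g k l \<longrightarrow>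
        dist_triangle C X Z R (cmp C g f) m n \<longrightarrow>
        (\<exists>u v. dist_triangle C P R Q u v (cmp C (shift_arr C i) l) \<and>
           cmp C u i = cmp C m g \<and> cmp C n u = j \<and>
           cmp C v m = k \<and> cmp C l v = cmp C (shift_arr C f) n))"

text \<open>The localization of a category at a class \<open>W\<close> of arrows, in the Gabriel--Zisman
  construction: arrows are classes of zigzags, read from left to right; \<open>Bwd s\<close> stands for
  the formal inverse of \<open>s\<close>.\<close>

datatype 'm step = Fwd 'm | Bwd 'm

fun zigzag :: "('o, 'm, 'z) cat_scheme \<Rightarrow> 'm set \<Rightarrow> 'o \<Rightarrow> 'm step list \<Rightarrow> 'o \<Rightarrow> bool" where
  "zigzag C W A [] B \<longleftrightarrow> A \<in> ob C \<and> A = B"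
| "zigzag C W A (Fwd f # p) B \<longleftrightarrow> f \<in> arr C \<and> src C f = A \<and> zigzag C W (tgt C f) p B"
| "zigzag C W A (Bwd s # p) B \<longleftrightarrow> s \<in> arr C \<inter> W \<and> tgt C s = A \<and> zigzag C W (src C s) p B"

inductive zz_red :: "('o, 'm, 'z) cat_scheme \<Rightarrow> 'm set \<Rightarrow> 'm step list \<Rightarrow> 'm step list \<Rightarrow> bool"
  for C W where
  "zz_red C W (p @ Fwd (idt C A) # q) (p @ q)"
| "tgt C f = src C g \<Longrightarrow> zz_red C W (p @ Fwd f # Fwd g # q) (p @ Fwd (cmp C g f) # q)"
| "zz_red C W (p @ Fwd s # Bwd s # q) (p @ q)"
| "zz_red C W (p @ Bwd s # Fwd s # q) (p @ q)"

inductive zz_eq ::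
  "('o, 'm, 'z) cat_scheme \<Rightarrow> 'm set \<Rightarrow> 'o \<Rightarrow> 'o \<Rightarrow> 'm step list \<Rightarrow> 'm step list \<Rightarrow> bool"
  for C W A B where
  "zigzag C W A p B \<Longrightarrow> zz_eq C W A B p p"
| "zigzag C W A p B \<Longrightarrow> zigzag C W A q B \<Longrightarrow> zz_red C W p q \<Longrightarrow> zz_eq C W A B p q"
| "zz_eq C W A B p q \<Longrightarrow> zz_eq C W A B q p"
| "zz_eq C W A B p q \<Longrightarrow> zz_eq C W A B q r \<Longrightarrow> zz_eq C W A B p r"

definition zz_class ::
  "('o, 'm, 'z) cat_scheme \<Rightarrow> 'm set \<Rightarrow> 'o \<Rightarrow> 'o \<Rightarrow> 'm step list \<Rightarrow> 'm step list set" where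
  "zz_class C W A B p = {q. zz_eq C W A B p q}"

type_synonym ('o, 'm) larr = "'o \<times> 'm step list set \<times> 'o"

definition localization ::
  "('o, 'm, 'z) cat_scheme \<Rightarrow> 'm set \<Rightarrow> ('o, ('o, 'm) larr) cat" where
  "localization C W =
     \<lparr>ob = ob C,
      arr = {(A, zz_class C W A B p, B) | A B p. zigzag C W A p B},
      src = fst,
      tgt = (\<lambda>f. snd (snd f)),
      cmp = (\<lambda>g f. (fst f,
               \<Union>p\<in>fst (snd f). \<Union>q\<in>fst (snd g). zz_class C W (fst f) (snd (snd g)) (p @ q),
               snd (snd g))),
      idt = (\<lambda>A. (A, zz_class C W A A [], A))\<rparr>"

definition loc_arr :: "('o, 'm, 'z) cat_scheme \<Rightarrow> 'm set \<Rightarrow> 'm \<Rightarrow> ('o, 'm) larr" where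
  "loc_arr C W f = (src C f, zz_class C W (src C f) (tgt C f) [Fwd f], tgt C f)"

text \<open>The functor into \<open>localization D V\<close> induced by a functor into \<open>D\<close> that sends the
  inverted arrows into \<open>V\<close>.\<close>

definition loc_map ::
  "('o2, 'm2, 'z) cat_scheme \<Rightarrow> 'm2 set \<Rightarrow> ('o, 'm, 'o2, 'm2) func
     \<Rightarrow> ('o, 'm) larr \<Rightarrow> ('o2, 'm2) larr" where
  "loc_map D V F f = (fst F (fst f),
     \<Union>p\<in>fst (snd f). zz_class D V (fst F (fst f)) (fst F (snd (snd f))) (map (map_step (snd F)) p),
     fst F (snd (snd f)))"

section \<open>Sheaves of abelian groups\<close>

text \<open>Abelian groups are written multiplicatively, as in HOL-Algebra. Only the values on
  open sets matter. Morphisms are made extensional so that they can be compared with \<open>=\<close>.\<close>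

record ('p, 'u) psh =
  sec :: "'p set \<Rightarrow> 'u monoid"
  rst :: "'p set \<Rightarrow> 'p set \<Rightarrow> 'u \<Rightarrow> 'u"

type_synonym ('p, 'u, 'v) pmor = "'p set \<Rightarrow> 'u \<Rightarrow> 'v"

definition presheaf :: "'p topology \<Rightarrow> ('p, 'u) psh \<Rightarrow> bool" where
  "presheaf T F \<longleftrightarrow>
     (\<forall>U. openin T U \<longrightarrow> comm_group (sec F U) \<and> (\<forall>s\<in>carrier (sec F U). rst F U U s = s)) \<and>
     (\<forall>U V. openin T U \<longrightarrow> openin T V \<longrightarrow> V \<subseteq> U \<longrightarrow> rst F U V \<in> hom (sec F U) (sec F V)) \<and>
     (\<forall>U V W. openin T U \<longrightarrow> openin T V \<longrightarrow> openin T W \<longrightarrow> V \<subseteq> U \<longrightarrow> W \<subseteq> V \<longrightarrow>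
        (\<forall>s\<in>carrier (sec F U). rst F V W (rst F U V s) = rst F U W s))"

definition sheaf :: "'p topology \<Rightarrow> ('p, 'u) psh \<Rightarrow> bool" where
  "sheaf T F \<longleftrightarrow> presheaf T F \<and>
     (\<forall>\<U> s. (\<forall>U\<in>\<U>. openin T U \<and> s U \<in> carrier (sec F U)) \<longrightarrow>
        (\<forall>U\<in>\<U>. \<forall>V\<in>\<U>. rst F U (U \<inter> V) (s U) = rst F V (U \<inter> V) (s V)) \<longrightarrow>
        (\<exists>!t. t \<in> carrier (sec F (\<Union>\<U>)) \<and> (\<forall>U\<in>\<U>. rst F (\<Union>\<U>) U t = s U)))"

definition on_opens :: "'p topology \<Rightarrow> ('p, 'u) psh \<Rightarrow> ('p, 'u, 'v) pmor \<Rightarrow> ('p, 'u, 'v) pmor" where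
  "on_opens T F \<phi> = (\<lambda>U. if openin T U then restrict (\<phi> U) (carrier (sec F U)) else (\<lambda>_. undefined))"

definition psh_mor ::
  "'p topology \<Rightarrow> ('p, 'u) psh \<Rightarrow> ('p, 'v) psh \<Rightarrow> ('p, 'u, 'v) pmor \<Rightarrow> bool" where
  "psh_mor T F G \<phi> \<longleftrightarrow> \<phi> = on_opens T F \<phi> \<and>
     (\<forall>U. openin T U \<longrightarrow> \<phi> U \<in> hom (sec F U) (sec G U)) \<and>
     (\<forall>U V. openin T U \<longrightarrow> openin T V \<longrightarrow> V \<subseteq> U \<longrightarrow>
        (\<forall>s\<in>carrier (sec F U). \<phi> V (rst F U V s) = rst G U V (\<phi> U s)))"

definition psh_iso ::
  "'p topology \<Rightarrow> ('p, 'u) psh \<Rightarrow> ('p, 'v) psh \<Rightarrow> ('p, 'u, 'v) pmor \<Rightarrow> bool" where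
  "psh_iso T F G \<phi> \<longleftrightarrow> psh_mor T F G \<phi> \<and>
     (\<forall>U. openin T U \<longrightarrow> bij_betw (\<phi> U) (carrier (sec F U)) (carrier (sec G U)))"

definition psh_id :: "'p topology \<Rightarrow> ('p, 'u) psh \<Rightarrow> ('p, 'u, 'u) pmor" where
  "psh_id T F = on_opens T F (\<lambda>U s. s)"

definition psh_comp ::
  "'p topology \<Rightarrow> ('p, 'u) psh \<Rightarrow> ('p, 'v, 'w) pmor \<Rightarrow> ('p, 'u, 'v) pmor \<Rightarrow> ('p, 'u, 'w) pmor" where
  "psh_comp T F \<psi> \<phi> = on_opens T F (\<lambda>U s. \<psi> U (\<phi> U s))"

definition germ :: "'p topology \<Rightarrow> ('p, 'u) psh \<Rightarrow> 'p \<Rightarrow> 'p set \<Rightarrow> 'u \<Rightarrow> ('p set \<times> 'u) set" where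
  "germ T F x U s = {(V, t). openin T V \<and> x \<in> V \<and> t \<in> carrier (sec F V) \<and>
     (\<exists>W. openin T W \<and> x \<in> W \<and> W \<subseteq> U \<inter> V \<and> rst F U W s = rst F V W t)}"

definition stalk :: "'p topology \<Rightarrow> ('p, 'u) psh \<Rightarrow> 'p \<Rightarrow> ('p set \<times> 'u) set monoid" where
  "stalk T F x =
     \<lparr>carrier = {germ T F x U s | U s. openin T U \<and> x \<in> U \<and> s \<in> carrier (sec F U)},
      monoid.mult = (\<lambda>a b. \<Union>{germ T F x U (s \<otimes>\<^bsub>sec F U\<^esub> t) | U s t. (U, s) \<in> a \<and> (U, t) \<in> b}),
      one = germ T F x (topspace T) \<one>\<^bsub>sec F (topspace T)\<^esub>\<rparr>"

definition stalk_map ::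
  "'p topology \<Rightarrow> ('p, 'v) psh \<Rightarrow> ('p, 'u, 'v) pmor \<Rightarrow> 'p \<Rightarrow> ('p set \<times> 'u) set \<Rightarrow> ('p set \<times> 'v) set" where
  "stalk_map T G \<phi> x a = (\<Union>(U, s)\<in>a. germ T G x U (\<phi> U s))"

text \<open>For a presheaf \<open>F\<close> on \<open>T\<close> and an arbitrary subset \<open>S\<close>, this is the inverse image to \<open>S\<close>
  of the sheaf associated with \<open>F\<close>; it is a sheaf for \<open>subtopology T S\<close>.\<close>

definition germ_sheaf ::
  "'p topology \<Rightarrow> ('p, 'u) psh \<Rightarrow> 'p set \<Rightarrow> ('p, 'p \<Rightarrow> ('p set \<times> 'u) set) psh" where
  "germ_sheaf T F S =
     \<lparr>sec = (\<lambda>W. \<lparr>carrier = {s \<in> extensional W. \<forall>x\<in>W. \<exists>U c. openin T U \<and> x \<in> U \<and>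
                    c \<in> carrier (sec F U) \<and> (\<forall>y\<in>W \<inter> U. s y = germ T F y U c)},
                  monoid.mult = (\<lambda>s t. \<lambda>x\<in>W. s x \<otimes>\<^bsub>stalk T F x\<^esub> t x),
                  one = (\<lambda>x\<in>W. \<one>\<^bsub>stalk T F x\<^esub>)\<rparr>),
      rst = (\<lambda>U V s. restrict s V)\<rparr>"

definition const_sheaf :: "'p topology \<Rightarrow> 'g monoid \<Rightarrow> ('p, 'p \<Rightarrow> 'g) psh" where
  "const_sheaf T G =
     \<lparr>sec = (\<lambda>U. \<lparr>carrier = {s \<in> U \<rightarrow>\<^sub>E carrier G. \<forall>x\<in>U. \<exists>V. openin T V \<and> x \<in> V \<and>
                    (\<forall>y\<in>U \<inter> V. s y = s x)},
                  monoid.mult = (\<lambda>s t. \<lambda>x\<in>U. s x \<otimes>\<^bsub>G\<^esub> t x),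
                  one = (\<lambda>x\<in>U. \<one>\<^bsub>G\<^esub>)\<rparr>),
      rst = (\<lambda>U V s. restrict s V)\<rparr>"

definition locally_constant_fg :: "'p topology \<Rightarrow> ('p, 'u) psh \<Rightarrow> 'p set \<Rightarrow> bool" where
  "locally_constant_fg T F S \<longleftrightarrow>
     (\<forall>x\<in>S. (\<exists>A. finite A \<and> A \<subseteq> carrier (stalk T F x) \<and>
               generate (stalk T F x) A = carrier (stalk T F x)) \<and>
        (\<exists>V \<phi>. openin (subtopology T S) V \<and> x \<in> V \<and>
           psh_iso (subtopology T V) (germ_sheaf T F V)
             (const_sheaf (subtopology T V) (stalk T F x)) \<phi>))"

section \<open>Complexes of sheaves and derived categories\<close>

text \<open>Sections of the sheaves that enter the derived category are elements of \<open>'p sec\<close>. If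
  \<open>'p\<close> carries a complex variety with infinitely many points, this type has at least
  $2^{\mathfrak c}$ elements while the analytic topology has at most $\mathfrak c$ open sets, so
  that all constructible sheaves, and all constructions of sheaves made from them (in
  particular associated sheaves and mapping cones), are available up to isomorphism.\<close>

datatype 'p sec = Fn (fn: "'p \<Rightarrow> int") | Pr (pr1: "'p sec") (pr2: "'p sec")

type_synonym 'p sh = "('p, 'p sec) psh"
type_synonym 'p smor = "('p, 'p sec, 'p sec) pmor"

definition fn_sheaf :: "('p, 'p \<Rightarrow> int) psh \<Rightarrow> 'p sh" where
  "fn_sheaf F =
     \<lparr>sec = (\<lambda>U. \<lparr>carrier = Fn ` carrier (sec F U),
                  monoid.mult = (\<lambda>s t. Fn (fn s \<otimes>\<^bsub>sec F U\<^esub> fn t)),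
                  one = Fn \<one>\<^bsub>sec F U\<^esub>\<rparr>),
      rst = (\<lambda>U V s. Fn (rst F U V (fn s)))\<rparr>"

definition coded_const :: "'p topology \<Rightarrow> int monoid \<Rightarrow> 'p sh" where
  "coded_const T G = fn_sheaf (const_sheaf T G)"

abbreviation const_Z :: "'p topology \<Rightarrow> 'p sh" where
  "const_Z T \<equiv> coded_const T integer_group"

abbreviation const_Zmod :: "'p topology \<Rightarrow> nat \<Rightarrow> 'p sh" where
  "const_Zmod T n \<equiv> coded_const T (integer_mod_group n)"

definition constant_map :: "'p topology \<Rightarrow> int monoid \<Rightarrow> (int \<Rightarrow> int) \<Rightarrow> 'p smor" where
  "constant_map T G h = on_opens T (coded_const T G) (\<lambda>U s. Fn (\<lambda>x\<in>U. h (fn s x)))"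

definition zero_sheaf :: "'p sh" where
  "zero_sheaf = \<lparr>sec = (\<lambda>U. singleton_group (Fn (\<lambda>_. 0))), rst = (\<lambda>U V s. s)\<rparr>"

definition dsum_sheaf :: "'p sh \<Rightarrow> 'p sh \<Rightarrow> 'p sh" where
  "dsum_sheaf F G =
     \<lparr>sec = (\<lambda>U. \<lparr>carrier = {Pr a b | a b. a \<in> carrier (sec F U) \<and> b \<in> carrier (sec G U)},
                  monoid.mult = (\<lambda>s t. Pr (pr1 s \<otimes>\<^bsub>sec F U\<^esub> pr1 t) (pr2 s \<otimes>\<^bsub>sec G U\<^esub> pr2 t)),
                  one = Pr \<one>\<^bsub>sec F U\<^esub> \<one>\<^bsub>sec G U\<^esub>\<rparr>),
      rst = (\<lambda>U V s. Pr (rst F U V (pr1 s)) (rst G U V (pr2 s)))\<rparr>"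

record 'p cplx =
  trm :: "int \<Rightarrow> 'p sh"
  dif :: "int \<Rightarrow> 'p smor"

type_synonym 'p cmap = "'p cplx \<times> (int \<Rightarrow> 'p smor) \<times> 'p cplx"

definition complex_of_sheaves :: "'p topology \<Rightarrow> 'p cplx \<Rightarrow> bool" where
  "complex_of_sheaves T K \<longleftrightarrow>
     (\<forall>n. sheaf T (trm K n) \<and> psh_mor T (trm K n) (trm K (n + 1)) (dif K n) \<and>
       (\<forall>U. openin T U \<longrightarrow> (\<forall>s\<in>carrier (sec (trm K n) U).
          dif K (n + 1) U (dif K n U s) = \<one>\<^bsub>sec (trm K (n + 2)) U\<^esub>)))"

definition Ch :: "'p topology \<Rightarrow> ('p cplx, 'p cmap) cat" where
  "Ch T =
     \<lparr>ob = {K. complex_of_sheaves T K},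
      arr = {(K, \<phi>, L) | K \<phi> L. complex_of_sheaves T K \<and> complex_of_sheaves T L \<and>
               (\<forall>n. psh_mor T (trm K n) (trm L n) (\<phi> n) \<and>
                 (\<forall>U. openin T U \<longrightarrow> (\<forall>s\<in>carrier (sec (trm K n) U).
                    \<phi> (n + 1) U (dif K n U s) = dif L n U (\<phi> n U s))))},
      src = fst,
      tgt = (\<lambda>f. snd (snd f)),
      cmp = (\<lambda>g f. (fst f,
               \<lambda>n. psh_comp T (trm (fst f) n) (fst (snd g) n) (fst (snd f) n), snd (snd g))),
      idt = (\<lambda>K. (K, \<lambda>n. psh_id T (trm K n), K))\<rparr>"

definition coboundaries_of :: "'p cplx \<Rightarrow> int \<Rightarrow> 'p set \<Rightarrow> 'p sec set" where
  "coboundaries_of K n U = dif K (n - 1) U ` carrier (sec (trm K (n - 1)) U)"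

definition cohomology_psh :: "'p cplx \<Rightarrow> int \<Rightarrow> ('p, 'p sec set) psh" where
  "cohomology_psh K n =
     \<lparr>sec = (\<lambda>U. (sec (trm K n) U)\<lparr>carrier :=
                   kernel (sec (trm K n) U) (sec (trm K (n + 1)) U) (dif K n U)\<rparr>
                 Mod coboundaries_of K n U),
      rst = (\<lambda>U V a. \<Union>s\<in>a. coboundaries_of K n V #>\<^bsub>sec (trm K n) V\<^esub> rst (trm K n) U V s)\<rparr>"

definition cohomology_mor :: "'p cmap \<Rightarrow> int \<Rightarrow> ('p, 'p sec set, 'p sec set) pmor" where
  "cohomology_mor f n = (\<lambda>U a. \<Union>s\<in>a.
     coboundaries_of (snd (snd f)) n U #>\<^bsub>sec (trm (snd (snd f)) n) U\<^esub> fst (snd f) n U s)"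

definition quasi_isos :: "'p topology \<Rightarrow> 'p cmap set" where
  "quasi_isos T = {f \<in> arr (Ch T). \<forall>n. \<forall>x\<in>topspace T.
     bij_betw (stalk_map T (cohomology_psh (snd (snd f)) n) (cohomology_mor f n) x)
       (carrier (stalk T (cohomology_psh (fst f) n) x))
       (carrier (stalk T (cohomology_psh (snd (snd f)) n) x))}"

type_synonym 'p darr = "('p cplx, 'p cmap) larr"

definition Der :: "'p topology \<Rightarrow> ('p cplx, 'p darr) cat" where
  "Der T = localization (Ch T) (quasi_isos T)"

definition der_arr :: "'p topology \<Rightarrow> 'p cmap \<Rightarrow> 'p darr" where
  "der_arr T f = loc_arr (Ch T) (quasi_isos T) f"

definition sheaf_cplx :: "'p topology \<Rightarrow> 'p sh \<Rightarrow> 'p cplx" where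
  "sheaf_cplx T F = (let t = (\<lambda>n::int. if n = 0 then F else zero_sheaf) in
     \<lparr>trm = t, dif = (\<lambda>n. on_opens T (t n) (\<lambda>U s. \<one>\<^bsub>sec (t (n + 1)) U\<^esub>))\<rparr>)"

definition sheaf_cmap :: "'p topology \<Rightarrow> 'p sh \<Rightarrow> 'p sh \<Rightarrow> 'p smor \<Rightarrow> 'p cmap" where
  "sheaf_cmap T F G \<phi> =
     (sheaf_cplx T F, \<lambda>n. if n = 0 then \<phi> else psh_id T zero_sheaf, sheaf_cplx T G)"

definition cshift :: "'p topology \<Rightarrow> ('p cplx, 'p cmap, 'p cplx, 'p cmap) func" where
  "cshift T = (let sh = (\<lambda>K.
        \<lparr>trm = (\<lambda>n. trm K (n + 1)),
         dif = (\<lambda>n. on_opens T (trm K (n + 1))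
                      (\<lambda>U s. inv\<^bsub>sec (trm K (n + 2)) U\<^esub> (dif K (n + 1) U s)))\<rparr>)
      in (sh, \<lambda>f. (sh (fst f), \<lambda>n. fst (snd f) (n + 1), sh (snd (snd f)))))"

definition dshift :: "'p topology \<Rightarrow> 'p darr \<Rightarrow> 'p darr" where
  "dshift T = loc_map (Ch T) (quasi_isos T) (cshift T)"

text \<open>Mapping cone of \<open>f : K \<rightarrow> L\<close>: in degree \<open>n\<close> it is $K^{n+1} \oplus L^n$ with differential
  $(a, b) \mapsto (-da, f(a) + db)$.\<close>

definition ccone :: "'p topology \<Rightarrow> 'p cmap \<Rightarrow> 'p cplx" where
  "ccone T f = (let K = fst f; \<phi> = fst (snd f); L = snd (snd f);
       t = (\<lambda>n. dsum_sheaf (trm K (n + 1)) (trm L n)) in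
     \<lparr>trm = t,
      dif = (\<lambda>n. on_opens T (t n) (\<lambda>U s.
               Pr (inv\<^bsub>sec (trm K (n + 2)) U\<^esub> (dif K (n + 1) U (pr1 s)))
                  (\<phi> (n + 1) U (pr1 s) \<otimes>\<^bsub>sec (trm L (n + 1)) U\<^esub> dif L n U (pr2 s))))\<rparr>)"

definition ccone_in :: "'p topology \<Rightarrow> 'p cmap \<Rightarrow> 'p cmap" where
  "ccone_in T f = (let K = fst f; L = snd (snd f) in
     (L, \<lambda>n. on_opens T (trm L n) (\<lambda>U s. Pr \<one>\<^bsub>sec (trm K (n + 1)) U\<^esub> s), ccone T f))"

definition ccone_out :: "'p topology \<Rightarrow> 'p cmap \<Rightarrow> 'p cmap" where
  "ccone_out T f = (ccone T f, \<lambda>n. on_opens T (trm (ccone T f) n) (\<lambda>U s. pr1 s),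
     fst (cshift T) (fst f))"

definition cmult :: "'p topology \<Rightarrow> int \<Rightarrow> 'p cplx \<Rightarrow> 'p cmap" where
  "cmult T n K = (K, \<lambda>m. on_opens T (trm K m) (\<lambda>U s. s [^]\<^bsub>sec (trm K m) U\<^esub> n), K)"

text \<open>Direct image along the inclusion of a closed subspace \<open>S\<close> of \<open>T\<close>. It is exact, so on
  derived categories it is computed termwise.\<close>

definition sheaf_image :: "'p set \<Rightarrow> ('p, 'u) psh \<Rightarrow> ('p, 'u) psh" where
  "sheaf_image S F = \<lparr>sec = (\<lambda>U. sec F (U \<inter> S)), rst = (\<lambda>U V. rst F (U \<inter> S) (V \<inter> S))\<rparr>"

definition mor_image :: "'p topology \<Rightarrow> 'p set \<Rightarrow> ('p, 'u, 'v) pmor \<Rightarrow> ('p, 'u, 'v) pmor" where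
  "mor_image T S \<phi> = (\<lambda>U. if openin T U then \<phi> (U \<inter> S) else (\<lambda>_. undefined))"

definition cimage :: "'p topology \<Rightarrow> 'p set \<Rightarrow> ('p cplx, 'p cmap, 'p cplx, 'p cmap) func" where
  "cimage T S = (let im = (\<lambda>K. \<lparr>trm = (\<lambda>n. sheaf_image S (trm K n)),
                               dif = (\<lambda>n. mor_image T S (dif K n))\<rparr>)
      in (im, \<lambda>f. (im (fst f), \<lambda>n. mor_image T S (fst (snd f) n), im (snd (snd f)))))"

definition dimage :: "'p topology \<Rightarrow> 'p set \<Rightarrow> 'p darr \<Rightarrow> 'p darr" where
  "dimage T S = loc_map (Ch T) (quasi_isos T) (cimage T S)"

text \<open>\<open>M\<close> is the subcomplex of the target of \<open>f\<close> whose terms are the image sheaves.\<close>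

definition is_image_complex :: "'p topology \<Rightarrow> 'p cmap \<Rightarrow> 'p cplx \<Rightarrow> bool" where
  "is_image_complex T f M \<longleftrightarrow> complex_of_sheaves T M \<and>
     (let K = fst f; \<phi> = fst (snd f); L = snd (snd f) in
      \<forall>n U. openin T U \<longrightarrow>
        sec (trm M n) U = (sec (trm L n) U)\<lparr>carrier := {t \<in> carrier (sec (trm L n) U).
           \<forall>x\<in>U. \<exists>V. openin T V \<and> x \<in> V \<and> V \<subseteq> U \<and>
             rst (trm L n) U V t \<in> \<phi> n V ` carrier (sec (trm K n) V)}\<rparr> \<and>
        (\<forall>s\<in>carrier (sec (trm M n) U). dif M n U s = dif L n U s \<and>
           (\<forall>V. openin T V \<longrightarrow> V \<subseteq> U \<longrightarrow> rst (trm M n) U V s = rst (trm L n) U V s)))"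

text \<open>The subsheaf \<open>2F\<close>, i.e.\ the image sheaf of multiplication by 2 on \<open>F\<close>.\<close>

definition twice_sheaf :: "'p topology \<Rightarrow> ('p, 'u) psh \<Rightarrow> ('p, 'u) psh" where
  "twice_sheaf T F = F\<lparr>sec := (\<lambda>U. (sec F U)\<lparr>carrier := {t \<in> carrier (sec F U).
     \<forall>x\<in>U. \<exists>V s. openin T V \<and> x \<in> V \<and> V \<subseteq> U \<and> s \<in> carrier (sec F V) \<and>
       rst F U V t = s \<otimes>\<^bsub>sec F V\<^esub> s}\<rparr>)\<rparr>"

section \<open>Complex algebraic varieties\<close>

text \<open>Affine \<open>n\<close>-space consists of the sequences vanishing from index \<open>n\<close> on; the topology
  induced from the product topology on \<open>nat \<Rightarrow> complex\<close> is the Euclidean one.\<close>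

definition Cn :: "nat \<Rightarrow> (nat \<Rightarrow> complex) set" where
  "Cn n = {z. \<forall>i\<ge>n. z i = 0}"

inductive_set poly_funs :: "nat \<Rightarrow> ((nat \<Rightarrow> complex) \<Rightarrow> complex) set" for n where
  "(\<lambda>z. c) \<in> poly_funs n"
| "i < n \<Longrightarrow> (\<lambda>z. z i) \<in> poly_funs n"
| "f \<in> poly_funs n \<Longrightarrow> g \<in> poly_funs n \<Longrightarrow> (\<lambda>z. f z + g z) \<in> poly_funs n"
| "f \<in> poly_funs n \<Longrightarrow> g \<in> poly_funs n \<Longrightarrow> (\<lambda>z. f z * g z) \<in> poly_funs n"

definition zero_locus :: "nat \<Rightarrow> ((nat \<Rightarrow> complex) \<Rightarrow> complex) set \<Rightarrow> (nat \<Rightarrow> complex) set" where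
  "zero_locus n P = {z \<in> Cn n. \<forall>f\<in>P. f z = 0}"

definition affine_open :: "nat \<Rightarrow> (nat \<Rightarrow> complex) set \<Rightarrow> (nat \<Rightarrow> complex) set \<Rightarrow> bool" where
  "affine_open n Z W \<longleftrightarrow> (\<exists>P\<subseteq>poly_funs n. W = Z - zero_locus n P)"

definition affine_regular ::
  "nat \<Rightarrow> (nat \<Rightarrow> complex) set \<Rightarrow> (nat \<Rightarrow> complex) set \<Rightarrow> ((nat \<Rightarrow> complex) \<Rightarrow> complex) \<Rightarrow> bool" where
  "affine_regular n Z W f \<longleftrightarrow>
     (\<forall>z\<in>W. \<exists>V. affine_open n Z V \<and> z \<in> V \<and> V \<subseteq> W \<and>
        (\<exists>p\<in>poly_funs n. \<exists>q\<in>poly_funs n. \<forall>w\<in>V. q w \<noteq> 0 \<and> f w = p w / q w))"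

record 'p variety =
  zar :: "'p topology"
  reg :: "'p set \<Rightarrow> ('p \<Rightarrow> complex) set"

definition affine_chart :: "'p variety \<Rightarrow> 'p set \<Rightarrow> bool" where
  "affine_chart X U \<longleftrightarrow> openin (zar X) U \<and>
     (\<exists>n P \<phi>. P \<subseteq> poly_funs n \<and> bij_betw \<phi> U (zero_locus n P) \<and>
        (\<forall>W\<subseteq>U. openin (zar X) W \<longleftrightarrow> affine_open n (zero_locus n P) (\<phi> ` W)) \<and>
        (\<forall>W f. openin (zar X) W \<longrightarrow> W \<subseteq> U \<longrightarrow> f \<in> extensional W \<longrightarrow>
           (f \<in> reg X W \<longleftrightarrow>
            affine_regular n (zero_locus n P) (\<phi> ` W) (f \<circ> inv_into U \<phi>))))"

text \<open>The analytic topology is the coarsest one for which all regular functions on Zariski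
  open sets are continuous; on an affine chart it is the Euclidean topology.\<close>

definition an :: "'p variety \<Rightarrow> 'p topology" where
  "an X = topology_generated_by
     {{x \<in> U. f x \<in> W} | U f W. openin (zar X) U \<and> f \<in> reg X U \<and> open W}"

text \<open>Varieties in the sense of Serre: reduced and separated of finite type over the complex
  numbers, not necessarily irreducible. A prevariety is separated iff its analytic topology is
  Hausdorff.\<close>

definition variety :: "'p variety \<Rightarrow> bool" where
  "variety X \<longleftrightarrow>
     (\<forall>U. openin (zar X) U \<longrightarrow> reg X U \<subseteq> extensional U) \<and>
     (\<forall>\<U> f. (\<forall>U\<in>\<U>. openin (zar X) U) \<longrightarrow> f \<in> extensional (\<Union>\<U>) \<longrightarrow>
        (f \<in> reg X (\<Union>\<U>) \<longleftrightarrow> (\<forall>U\<in>\<U>. restrict f U \<in> reg X U))) \<and>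
     (\<exists>\<U>. finite \<U> \<and> (\<forall>U\<in>\<U>. affine_chart X U) \<and> \<Union>\<U> = topspace (zar X)) \<and>
     Hausdorff_space (an X)"

definition subvariety :: "'p variety \<Rightarrow> 'p set \<Rightarrow> 'p variety" where
  "subvariety X S =
     \<lparr>zar = subtopology (zar X) S,
      reg = (\<lambda>W. {f \<in> extensional W. \<forall>x\<in>W. \<exists>U g. openin (zar X) U \<and> x \<in> U \<and> g \<in> reg X U \<and>
                 (\<forall>y\<in>W \<inter> U. f y = g y)})\<rparr>"

definition irreducible_closed :: "'p topology \<Rightarrow> 'p set \<Rightarrow> bool" where
  "irreducible_closed T A \<longleftrightarrow> closedin T A \<and> A \<noteq> {} \<and>
     (\<forall>B B'. closedin T B \<longrightarrow> closedin T B' \<longrightarrow> A = B \<union> B' \<longrightarrow> A = B \<or> A = B')"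

definition irreducible_chain :: "'p topology \<Rightarrow> nat \<Rightarrow> bool" where
  "irreducible_chain T d \<longleftrightarrow>
     (\<exists>A. (\<forall>i\<le>d. irreducible_closed T (A i)) \<and> (\<forall>i<d. A i \<subset> A (Suc i)))"

definition has_dim :: "'p variety \<Rightarrow> nat \<Rightarrow> bool" where
  "has_dim X d \<longleftrightarrow> irreducible_chain (zar X) d \<and> \<not> irreducible_chain (zar X) (Suc d)"

definition threefold :: "'p variety \<Rightarrow> bool" where
  "threefold Y \<longleftrightarrow> variety Y \<and> has_dim Y 3"

text \<open>Strata are closed, so that the inclusion is proper.\<close>

definition codim_two_stratum :: "'p variety \<Rightarrow> 'p set \<Rightarrow> bool" where
  "codim_two_stratum Y S \<longleftrightarrow> closedin (zar Y) S \<and> variety (subvariety Y S) \<and>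
     (\<exists>d. has_dim Y (d + 2) \<and> has_dim (subvariety Y S) d)"

definition regular_map :: "'p variety \<Rightarrow> 'p variety \<Rightarrow> ('p \<Rightarrow> 'p) \<Rightarrow> bool" where
  "regular_map X Y f \<longleftrightarrow> continuous_map (zar X) (zar Y) f \<and>
     (\<forall>U. openin (zar Y) U \<longrightarrow> (\<forall>g\<in>reg Y U.
        restrict (g \<circ> f) {x \<in> topspace (zar X). f x \<in> U} \<in> reg X {x \<in> topspace (zar X). f x \<in> U}))"

text \<open>A morphism of complex varieties is proper iff it is proper in the analytic topology.\<close>

definition proper_morphism :: "'p variety \<Rightarrow> 'p variety \<Rightarrow> ('p \<Rightarrow> 'p) \<Rightarrow> bool" where
  "proper_morphism X Y f \<longleftrightarrow> regular_map X Y f \<and> proper_map (an X) (an Y) f"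

section \<open>The transverse singularity \<open>1/4(1,1)\<close>\<close>

text \<open>Holomorphy in several variables: continuous and holomorphic in each variable.\<close>

definition holo_Cn :: "nat \<Rightarrow> (nat \<Rightarrow> complex) set \<Rightarrow> ((nat \<Rightarrow> complex) \<Rightarrow> complex) \<Rightarrow> bool" where
  "holo_Cn n D F \<longleftrightarrow> openin (top_of_set (Cn n)) D \<and> continuous_on D F \<and>
     (\<forall>z\<in>D. \<forall>i<n. (\<lambda>w. F (z(i := w))) field_differentiable at (z i))"

text \<open>Holomorphic functions on an analytically open subset of a variety: locally, holomorphic
  functions of finitely many regular functions.\<close>

definition holo_on :: "'p variety \<Rightarrow> 'p set \<Rightarrow> ('p \<Rightarrow> complex) \<Rightarrow> bool" where
  "holo_on X W f \<longleftrightarrow> openin (an X) W \<and>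
     (\<forall>x\<in>W. \<exists>V n g D F N. openin (zar X) V \<and> (\<forall>i<n. g i \<in> reg X V) \<and> holo_Cn n D F \<and>
        openin (an X) N \<and> x \<in> N \<and> N \<subseteq> W \<inter> V \<and>
        (\<forall>y\<in>N. (\<lambda>i. if i < n then g i y else 0) \<in> D \<and>
               f y = F (\<lambda>i. if i < n then g i y else 0)))"

definition coble_act :: "complex \<Rightarrow> (nat \<Rightarrow> complex) \<Rightarrow> (nat \<Rightarrow> complex)" where
  "coble_act \<zeta> z = (\<lambda>i. if i = 1 \<or> i = 2 then \<zeta> * z i else z i)"

text \<open>Near each point of \<open>S\<close> the pair \<open>(Y, S)\<close> is, as an analytic space, a neighbourhood of the
  origin in $(\mathbb C \times \mathbb C^2/\mu_4,\ \mathbb C \times 0)$: here \<open>\<phi>\<close> is the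
  quotient map from a stable open neighbourhood of the origin of $\mathbb C \times \mathbb C^2$,
  and the holomorphic functions on the quotient are the invariant ones.\<close>

definition transverse_coble :: "'p variety \<Rightarrow> 'p set \<Rightarrow> bool" where
  "transverse_coble Y S \<longleftrightarrow>
     (\<forall>p\<in>S. \<exists>D \<phi>. openin (top_of_set (Cn 3)) D \<and> (\<lambda>i. 0) \<in> D \<and> \<phi> (\<lambda>i. 0) = p \<and>
        (\<forall>z\<in>D. \<forall>\<zeta>. \<zeta> ^ 4 = 1 \<longrightarrow> coble_act \<zeta> z \<in> D) \<and>
        openin (an Y) (\<phi> ` D) \<and>
        quotient_map (top_of_set D) (subtopology (an Y) (\<phi> ` D)) \<phi> \<and>
        (\<forall>z\<in>D. \<forall>w\<in>D. \<phi> z = \<phi> w \<longleftrightarrow> (\<exists>\<zeta>. \<zeta> ^ 4 = 1 \<and> w = coble_act \<zeta> z)) \<and>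
        (\<forall>z\<in>D. \<phi> z \<in> S \<longleftrightarrow> z 1 = 0 \<and> z 2 = 0) \<and>
        (\<forall>W f. openin (an Y) W \<longrightarrow> W \<subseteq> \<phi> ` D \<longrightarrow>
           (holo_on Y W f \<longleftrightarrow> holo_Cn 3 {z \<in> D. \<phi> z \<in> W} (f \<circ> \<phi>))))"

section \<open>The local system of torsion classes of the links\<close>

definition cochain_group :: "nat \<Rightarrow> 'p topology \<Rightarrow> ('p chain \<Rightarrow> int) monoid" where
  "cochain_group n X =
     \<lparr>carrier = hom (chain_group n X) integer_group \<inter> extensional (carrier (chain_group n X)),
      monoid.mult = (\<lambda>\<phi> \<psi>. \<lambda>c\<in>carrier (chain_group n X). \<phi> c + \<psi> c),
      one = (\<lambda>c\<in>carrier (chain_group n X). 0)\<rparr>"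

definition cochain_diff :: "nat \<Rightarrow> 'p topology \<Rightarrow> ('p chain \<Rightarrow> int) \<Rightarrow> 'p chain \<Rightarrow> int" where
  "cochain_diff n X \<phi> = (\<lambda>c\<in>carrier (chain_group (Suc n) X). \<phi> (chain_boundary (Suc n) c))"

definition singular_coboundaries :: "nat \<Rightarrow> 'p topology \<Rightarrow> ('p chain \<Rightarrow> int) set" where
  "singular_coboundaries n X = (case n of
      0 \<Rightarrow> {\<one>\<^bsub>cochain_group 0 X\<^esub>}
    | Suc m \<Rightarrow> cochain_diff m X ` carrier (cochain_group m X))"

definition singular_cohomology :: "nat \<Rightarrow> 'p topology \<Rightarrow> ('p chain \<Rightarrow> int) set monoid" where
  "singular_cohomology n X =
     (cochain_group n X)\<lparr>carrier :=
        kernel (cochain_group n X) (cochain_group (Suc n) X) (cochain_diff n X)\<rparr>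
     Mod singular_coboundaries n X"

text \<open>Restriction of a cohomology class to a subspace \<open>X\<close> of the original space.\<close>

definition cohomology_restrict ::
  "nat \<Rightarrow> 'p topology \<Rightarrow> ('p chain \<Rightarrow> int) set \<Rightarrow> ('p chain \<Rightarrow> int) set" where
  "cohomology_restrict n X a = (\<Union>\<phi>\<in>a.
     singular_coboundaries n X #>\<^bsub>cochain_group n X\<^esub> restrict \<phi> (carrier (chain_group n X)))"

definition torsion_group :: "'g monoid \<Rightarrow> 'g monoid" where
  "torsion_group G = G\<lparr>carrier := {x \<in> carrier G. \<exists>m::nat. m > 0 \<and> x [^]\<^bsub>G\<^esub> m = \<one>\<^bsub>G\<^esub>}\<rparr>"

definition link_torsion_psh :: "'p variety \<Rightarrow> 'p set \<Rightarrow> ('p, ('p chain \<Rightarrow> int) set) psh" where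
  "link_torsion_psh Y S =
     \<lparr>sec = (\<lambda>U. torsion_group (singular_cohomology 2 (subtopology (an Y) (U - S)))),
      rst = (\<lambda>U V. cohomology_restrict 2 (subtopology (an Y) (V - S)))\<rparr>"

text \<open>The sheaf on \<open>S\<close> whose stalk at \<open>p\<close> is the colimit, over the neighbourhoods \<open>U\<close> of \<open>p\<close>, of
  the torsion of $H^2(U \setminus S, \mathbb Z)$. If \<open>Y\<close> is locally
  $\mathbb C \times \mathbb C^2/\mu_4$ along \<open>S\<close>, then for small \<open>U\<close> the complement
  $U \setminus S$ is homotopy equivalent to the link $L(4,1)$, and the sheaf is a local
  system with fibre $H^2(L(4,1), \mathbb Z)_{tors}$.\<close>

definition link_torsion ::
  "'p variety \<Rightarrow> 'p set \<Rightarrow> ('p, 'p \<Rightarrow> ('p set \<times> ('p chain \<Rightarrow> int) set) set) psh" where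
  "link_torsion Y S = germ_sheaf (an Y) (link_torsion_psh Y S) S"

section \<open>Constructible derived category, motivic sheaves and Betti realization\<close>

definition locally_closed :: "'p topology \<Rightarrow> 'p set \<Rightarrow> bool" where
  "locally_closed T A \<longleftrightarrow> (\<exists>U B. openin T U \<and> closedin T B \<and> A = U \<inter> B)"

definition bounded_constructible :: "'p variety \<Rightarrow> 'p cplx \<Rightarrow> bool" where
  "bounded_constructible X K \<longleftrightarrow>
     (\<exists>N. \<forall>n. \<bar>n\<bar> > N \<longrightarrow> (\<forall>x\<in>topspace (an X).
        carrier (stalk (an X) (cohomology_psh K n) x) =
          {\<one>\<^bsub>stalk (an X) (cohomology_psh K n) x\<^esub>})) \<and>
     (\<forall>n. \<exists>\<S>. finite \<S> \<and> \<Union>\<S> = topspace (zar X) \<and> disjoint \<S> \<and>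
        (\<forall>A\<in>\<S>. locally_closed (zar X) A \<and> locally_constant_fg (an X) (cohomology_psh K n) A))"

definition Dbc :: "'p variety \<Rightarrow> ('p cplx, 'p darr) cat" where
  "Dbc X = full_sub (Der (an X)) {K. bounded_constructible X K}"

record ('p, 'o, 'm) motivic =
  DM :: "'p variety \<Rightarrow> ('o, 'm) tricat"
  unit_ob :: "'p variety \<Rightarrow> 'o"
  pushforward :: "'p variety \<Rightarrow> 'p variety \<Rightarrow> ('p \<Rightarrow> 'p) \<Rightarrow> ('o, 'm, 'o, 'm) func"
  Real_B :: "'p variety \<Rightarrow> ('o, 'm, 'p cplx, 'p darr) func"
  real_unit :: "'p variety \<Rightarrow> 'p darr"

definition motivic_formalism :: "('p, 'o, 'm) motivic \<Rightarrow> bool" where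
  "motivic_formalism M \<longleftrightarrow>
     (\<forall>X. variety X \<longrightarrow> triangulated_category (DM M X) \<and> unit_ob M X \<in> ob (DM M X) \<and>
        is_functor (DM M X) (Dbc X) (Real_B M X) \<and>
        iso_arr (Dbc X) (fst (Real_B M X) (unit_ob M X)) (sheaf_cplx (an X) (const_Z (an X)))
          (real_unit M X)) \<and>
     (\<forall>X Y f. variety X \<longrightarrow> variety Y \<longrightarrow> proper_morphism X Y f \<longrightarrow>
        is_functor (DM M X) (DM M Y) (pushforward M X Y f))"

text \<open>The natural isomorphisms \<open>Real (A[1]) \<cong> Real (A)[1]\<close> (and, below,
  \<open>Real (i\<^sub>* A) \<cong> i\<^sub>* (Real A)\<close>) are part of the data.\<close>

definition commutes_with_shifts ::
  "('p, 'o, 'm) motivic \<Rightarrow> 'p variety \<Rightarrow> ('o \<Rightarrow> 'p darr) \<Rightarrow> bool" where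
  "commutes_with_shifts M X \<sigma> \<longleftrightarrow>
     (\<forall>A\<in>ob (DM M X). iso_arr (Dbc X) (fst (Real_B M X) (shift_ob (DM M X) A))
        (fst (cshift (an X)) (fst (Real_B M X) A)) (\<sigma> A)) \<and>
     (\<forall>f\<in>arr (DM M X).
        cmp (Dbc X) (\<sigma> (tgt (DM M X) f)) (snd (Real_B M X) (shift_arr (DM M X) f)) =
        cmp (Dbc X) (dshift (an X) (snd (Real_B M X) f)) (\<sigma> (src (DM M X) f)))"

text \<open>\<open>Real (Cone f) \<cong> Cone (Real f)\<close>, compatibly with the triangles. The cone of an arrow of the
  derived category is the mapping cone of any chain map \<open>c\<close> that represents this arrow up to
  isomorphisms \<open>a\<close>, \<open>b\<close> of its source and target.\<close>

definition commutes_with_cones ::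
  "('p, 'o, 'm) motivic \<Rightarrow> 'p variety \<Rightarrow> ('o \<Rightarrow> 'p darr) \<Rightarrow> bool" where
  "commutes_with_cones M X \<sigma> \<longleftrightarrow>
     (\<forall>A B C f g h. dist_triangle (DM M X) A B C f g h \<longrightarrow>
        (\<forall>K L c a b. c \<in> Hom (Ch (an X)) K L \<longrightarrow>
           iso_arr (Dbc X) (fst (Real_B M X) A) K a \<longrightarrow>
           iso_arr (Dbc X) (fst (Real_B M X) B) L b \<longrightarrow>
           cmp (Dbc X) b (snd (Real_B M X) f) = cmp (Dbc X) (der_arr (an X) c) a \<longrightarrow>
           (\<exists>e. iso_arr (Dbc X) (fst (Real_B M X) C) (ccone (an X) c) e \<and>
              cmp (Dbc X) e (snd (Real_B M X) g) =
                cmp (Dbc X) (der_arr (an X) (ccone_in (an X) c)) b \<and>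
              cmp (Dbc X) (der_arr (an X) (ccone_out (an X) c)) e =
                cmp (Dbc X) (dshift (an X) a) (cmp (Dbc X) (\<sigma> A) (snd (Real_B M X) h)))))"

definition commutes_with_integers :: "('p, 'o, 'm) motivic \<Rightarrow> 'p variety \<Rightarrow> bool" where
  "commutes_with_integers M X \<longleftrightarrow>
     (\<forall>f\<in>arr (DM M X). \<forall>n. snd (Real_B M X) (int_mult (DM M X) n f) =
        cmp (Dbc X) (der_arr (an X) (cmult (an X) n (fst (Real_B M X) (tgt (DM M X) f))))
          (snd (Real_B M X) f))"

definition commutes_with_pushforward ::
  "('p, 'o, 'm) motivic \<Rightarrow> 'p variety \<Rightarrow> 'p set \<Rightarrow> ('o \<Rightarrow> 'p darr) \<Rightarrow> bool" where
  "commutes_with_pushforward M Y S \<beta> \<longleftrightarrow> (let X = subvariety Y S; P = pushforward M X Y id in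
     (\<forall>A\<in>ob (DM M X). iso_arr (Dbc Y) (fst (Real_B M Y) (fst P A))
        (fst (cimage (an Y) S) (fst (Real_B M X) A)) (\<beta> A)) \<and>
     (\<forall>f\<in>arr (DM M X).
        cmp (Dbc Y) (\<beta> (tgt (DM M X) f)) (snd (Real_B M Y) (snd P f)) =
        cmp (Dbc Y) (dimage (an Y) S (snd (Real_B M X) f)) (\<beta> (src (DM M X) f))))"

text \<open>\<open>C\<close> is the cone \<open>1/n\<close> of multiplication by \<open>n\<close> on the unit, with structure maps
  \<open>q : 1 \<rightarrow> 1/n\<close> and \<open>\<delta> : 1/n \<rightarrow> 1[1]\<close>.\<close>

definition unit_mod ::
  "('p, 'o, 'm) motivic \<Rightarrow> 'p variety \<Rightarrow> nat \<Rightarrow> 'o \<Rightarrow> 'm \<Rightarrow> 'm \<Rightarrow> bool" where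
  "unit_mod M X n C q \<delta> \<longleftrightarrow> dist_triangle (DM M X) (unit_ob M X) (unit_ob M X) C
     (int_mult (DM M X) (int n) (idt (DM M X) (unit_ob M X))) q \<delta>"

definition push_shift2_ob :: "('p, 'o, 'm) motivic \<Rightarrow> 'p variety \<Rightarrow> 'p set \<Rightarrow> 'o \<Rightarrow> 'o" where
  "push_shift2_ob M Y S A =
     shift_ob (DM M Y) (shift_ob (DM M Y) (fst (pushforward M (subvariety Y S) Y id) A))"

definition push_shift2_arr :: "('p, 'o, 'm) motivic \<Rightarrow> 'p variety \<Rightarrow> 'p set \<Rightarrow> 'm \<Rightarrow> 'm" where
  "push_shift2_arr M Y S f =
     shift_arr (DM M Y) (shift_arr (DM M Y) (snd (pushforward M (subvariety Y S) Y id) f))"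

text \<open>An identification of the realization of \<open>1/n\<close> with the constant sheaf \<open>\<int>/n\<close> under which
  \<open>q : 1 \<rightarrow> 1/n\<close> becomes the reduction \<open>\<int> \<rightarrow> \<int>/n\<close>. There is exactly one.\<close>

definition canonical_ident ::
  "('p, 'o, 'm) motivic \<Rightarrow> 'p variety \<Rightarrow> nat \<Rightarrow> 'o \<Rightarrow> 'm \<Rightarrow> 'p darr \<Rightarrow> bool" where
  "canonical_ident M X n C q \<theta> \<longleftrightarrow>
     iso_arr (Dbc X) (fst (Real_B M X) C) (sheaf_cplx (an X) (const_Zmod (an X) n)) \<theta> \<and>
     cmp (Dbc X) \<theta> (snd (Real_B M X) q) =
       cmp (Dbc X)
         (der_arr (an X) (sheaf_cmap (an X) (const_Z (an X)) (const_Zmod (an X) n)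
            (constant_map (an X) integer_group (\<lambda>k. k mod int n))))
         (real_unit M X)"

definition incl24 :: "'p topology \<Rightarrow> 'p smor" where
  "incl24 T = constant_map T (integer_mod_group 2) (\<lambda>k. 2 * k)"

text \<open>\<open>u : 1/2 \<rightarrow> 1/4\<close> is a motivic representative of the inclusion \<open>\<int>/2 \<rightarrow> \<int>/4\<close>, \<open>1 \<mapsto> 2\<close>.\<close>

definition represents_incl24 ::
  "('p, 'o, 'm) motivic \<Rightarrow> 'p variety \<Rightarrow> 'o \<Rightarrow> 'm \<Rightarrow> 'o \<Rightarrow> 'm \<Rightarrow> 'm \<Rightarrow> bool" where
  "represents_incl24 M X C2 q2 C4 q4 u \<longleftrightarrow> u \<in> Hom (DM M X) C2 C4 \<and>
     (\<forall>\<theta>2 \<theta>4. canonical_ident M X 2 C2 q2 \<theta>2 \<longrightarrow> canonical_ident M X 4 C4 q4 \<theta>4 \<longrightarrow>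
        cmp (Dbc X) \<theta>4 (snd (Real_B M X) u) =
        cmp (Dbc X)
          (der_arr (an X) (sheaf_cmap (an X) (const_Zmod (an X) 2) (const_Zmod (an X) 4)
             (incl24 (an X)))) \<theta>2)"

definition image_shift2_ob :: "'p variety \<Rightarrow> 'p set \<Rightarrow> 'p cplx \<Rightarrow> 'p cplx" where
  "image_shift2_ob Y S K = fst (cshift (an Y)) (fst (cshift (an Y)) (fst (cimage (an Y) S) K))"

definition image_shift2_arr :: "'p variety \<Rightarrow> 'p set \<Rightarrow> 'p cmap \<Rightarrow> 'p cmap" where
  "image_shift2_arr Y S f = snd (cshift (an Y)) (snd (cshift (an Y)) (snd (cimage (an Y) S) f))"

end

theory Submission
  imports Defs
begin

text \<open>Since the realization commutes with cones and integers, \<open>1/n\<close> on the stratum realizes to the cone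
  of multiplication by \<open>n\<close> on the constant sheaf \<open>\<int>\<close>; reduction modulo \<open>n\<close> is a
  quasi-isomorphism from this cone to \<open>\<int>/n\<close>, because a locally constant function with values
  divisible by \<open>n\<close> is \<open>n\<close> times a locally constant function. This identification is compatible with
  the reduction \<open>\<int> \<rightarrow> \<int>/n\<close>, so the motivic map \<open>1/2 \<rightarrow> 1/4\<close> realizes to
  \<open>1 \<mapsto> 2\<close>. Direct image and shift preserve quasi-isomorphisms, hence act on the localizations,
  and naturality carries the square to the threefold. The derived categories are full
  subcategories on constructible complexes, so only the end points of the composite isomorphisms have
  to be shown constructible. Finally, doubling in \<open>\<int>/4\<close> has the same image as
  \<open>\<int>/2 \<rightarrow> \<int>/4\<close>, locally and after transport to the local system.\<close>

section \<open>Categories and localization\<close>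

text \<open>The derived category is presented by zigzags, without a calculus of fractions, so its
  arrows have no normal form. Statements about them are obtained either from chain maps, through the
  localization functor, or by induction on zigzags. The induction is what moves multiplication by n
  past the identification of the realized unit with \<int>: that identification is an arbitrary
  arrow of the derived category, and the square must commute before the cone hypothesis applies.
  That a map represents the inclusion of \<int>/2 in \<int>/4 is a statement about all canonical
  identifications, so it can be used only after one has been constructed for n = 2 and n = 4. This
  is why the cone of multiplication by n is computed on the level of chain maps. Quasi-isomorphisms
  are defined by germs of cosets. They are checked through a reformulation with sections, in which a
  shift of degrees or a trace on the stratum is almost literal. Closedness of the stratum enters at
  the points off it: they have neighbourhoods with empty trace, over which a sheaf has only the
  neutral section.\<close>

lemma category_Hom_ob: "category C \<Longrightarrow> f \<in> Hom C A B \<Longrightarrow> A \<in> ob C \<and> B \<in> ob C"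
  by (auto simp: category_def Hom_def)

lemma category_id: "category C \<Longrightarrow> A \<in> ob C \<Longrightarrow> idt C A \<in> Hom C A A"
  by (simp add: category_def)

lemma category_cmp: "category C \<Longrightarrow> g \<in> Hom C B D \<Longrightarrow> f \<in> Hom C A B \<Longrightarrow> cmp C g f \<in> Hom C A D"
  by (auto simp: category_def Hom_def)

lemma category_assoc:
  "category C \<Longrightarrow> f \<in> Hom C A B \<Longrightarrow> g \<in> Hom C B D \<Longrightarrow> h \<in> Hom C D E \<Longrightarrow>
    cmp C h (cmp C g f) = cmp C (cmp C h g) f"
  by (auto simp: category_def Hom_def)

lemma category_id_left: "category C \<Longrightarrow> f \<in> Hom C A B \<Longrightarrow> cmp C (idt C B) f = f"
  and category_id_right: "category C \<Longrightarrow> f \<in> Hom C A B \<Longrightarrow> cmp C f (idt C A) = f"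
  by (auto simp: category_def Hom_def)

lemma functor_Hom: "is_functor C D F \<Longrightarrow> f \<in> Hom C A B \<Longrightarrow> snd F f \<in> Hom D (fst F A) (fst F B)"
  by (auto simp: is_functor_def Hom_def)

lemma functor_cmp:
  "is_functor C D F \<Longrightarrow> f \<in> Hom C A B \<Longrightarrow> g \<in> Hom C B E \<Longrightarrow>
    snd F (cmp C g f) = cmp D (snd F g) (snd F f)"
  by (auto simp: is_functor_def Hom_def)

lemma functor_ob: "is_functor C D F \<Longrightarrow> A \<in> ob C \<Longrightarrow> fst F A \<in> ob D"
  and functor_id: "is_functor C D F \<Longrightarrow> A \<in> ob C \<Longrightarrow> snd F (idt C A) = idt D (fst F A)"
  by (auto simp: is_functor_def)

lemma iso_arr_Hom: "iso_arr C A B f \<Longrightarrow> f \<in> Hom C A B"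
  by (simp add: iso_arr_def)

lemma iso_arr_functor:
  assumes F: "is_functor C D F" and f: "iso_arr C A B f"
  shows "iso_arr D (fst F A) (fst F B) (snd F f)"
proof -
  obtain g where *: "A \<in> ob C" "B \<in> ob C" "f \<in> Hom C A B" "g \<in> Hom C B A"
    "cmp C g f = idt C A" "cmp C f g = idt C B"
    using f by (auto simp: iso_arr_def)
  have "cmp D (snd F g) (snd F f) = idt D (fst F A)" "cmp D (snd F f) (snd F g) = idt D (fst F B)"
    using functor_cmp[OF F *(3,4)] functor_cmp[OF F *(4,3)] * F by (auto simp: functor_id)
  then show ?thesis
    using * F by (auto simp: iso_arr_def intro: functor_ob functor_Hom)
qed

lemma iso_arr_cmp:
  assumes C: "category C" and f: "iso_arr C A B f" and g: "iso_arr C B D g"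
  shows "iso_arr C A D (cmp C g f)"
proof -
  obtain f' where f': "A \<in> ob C" "f \<in> Hom C A B" "f' \<in> Hom C B A"
    "cmp C f' f = idt C A" "cmp C f f' = idt C B"
    using f by (auto simp: iso_arr_def)
  obtain g' where g': "D \<in> ob C" "g \<in> Hom C B D" "g' \<in> Hom C D B"
    "cmp C g' g = idt C B" "cmp C g g' = idt C D"
    using g by (auto simp: iso_arr_def)
  note H = category_cmp[OF C] category_assoc[OF C] category_id_left[OF C]
  have gf: "cmp C g f \<in> Hom C A D" and fg': "cmp C f' g' \<in> Hom C D A"
    using f' g' by (auto intro: H(1))
  have "cmp C (cmp C f' g') (cmp C g f) = cmp C f' (cmp C g' (cmp C g f))"
    using H(2)[OF gf g'(3) f'(3)] by simp
  also have "cmp C g' (cmp C g f) = f"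
    using H(2)[OF f'(2) g'(2) g'(3)] H(3)[OF f'(2)] g' by simp
  finally have 1: "cmp C (cmp C f' g') (cmp C g f) = idt C A"
    using f' by simp
  have "cmp C (cmp C g f) (cmp C f' g') = cmp C g (cmp C f (cmp C f' g'))"
    using H(2)[OF fg' f'(2) g'(2)] by simp
  also have "cmp C f (cmp C f' g') = g'"
    using H(2)[OF g'(3) f'(3) f'(2)] H(3)[OF g'(3)] f' by simp
  finally have 2: "cmp C (cmp C g f) (cmp C f' g') = idt C D"
    using g' by simp
  show ?thesis
    using 1 2 f' g' gf fg' unfolding iso_arr_def by blast
qed

lemma full_sub_simps [simp]:
  "ob (full_sub C P) = ob C \<inter> P" "cmp (full_sub C P) = cmp C" "idt (full_sub C P) = idt C"
  "src (full_sub C P) = src C" "tgt (full_sub C P) = tgt C"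
  "f \<in> Hom (full_sub C P) A B \<longleftrightarrow> f \<in> Hom C A B \<and> A \<in> P \<and> B \<in> P"
  by (auto simp: full_sub_def Hom_def)

text \<open>Fullness makes the inverse arrow available for free, so membership in \<open>P\<close>
  concerns the two end points only. A composite isomorphism may therefore pass through objects
  outside \<open>P\<close>.\<close>

lemma iso_arr_full_sub:
  "iso_arr (full_sub C P) A B f \<longleftrightarrow> iso_arr C A B f \<and> A \<in> P \<and> B \<in> P"
  by (auto simp: iso_arr_def)

section \<open>Zigzags and the localized category\<close>

lemma zigzag_ob: "category C \<Longrightarrow> zigzag C W A p B \<Longrightarrow> A \<in> ob C \<and> B \<in> ob C"
  by (induction C W A p B rule: zigzag.induct) (auto simp: category_def)

lemma zigzag_append:
  assumes "category C"
  shows "zigzag C W A (p @ q) B \<longleftrightarrow> (\<exists>M. zigzag C W A p M \<and> zigzag C W M q B)"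
  using assms
  by (induction C W A p B rule: zigzag.induct) (auto dest: zigzag_ob)

lemma zz_red_append: "zz_red C W p q \<Longrightarrow> zz_red C W (r @ p @ t) (r @ q @ t)"
proof (induction rule: zz_red.induct)
  case (1 p A q)
  show ?case using zz_red.intros(1)[of C W "r @ p" A "q @ t"] by simp
next
  case (2 f g p q)
  then show ?case using zz_red.intros(2)[of C f g W "r @ p" "q @ t"] by simp
next
  case (3 p s q)
  show ?case using zz_red.intros(3)[of C W "r @ p" s "q @ t"] by simp
next
  case (4 p s q)
  show ?case using zz_red.intros(4)[of C W "r @ p" s "q @ t"] by simp
qed

lemma zz_eq_zigzag: "zz_eq C W A B p q \<Longrightarrow> zigzag C W A p B \<and> zigzag C W A q B"
  by (induction rule: zz_eq.induct) auto

text \<open>Every link of a \<open>zz_eq\<close> chain must be a legal zigzag between fixed end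
  points, so the context \<open>r\<close>, \<open>t\<close> has to be composable with the words,
  although the reduction rules by themselves allow any context.\<close>

lemma zz_eq_append:
  assumes C: "category C" and "zz_eq C W A B p q" and r: "zigzag C W Z r A" and t: "zigzag C W B t D"
  shows "zz_eq C W Z D (r @ p @ t) (r @ q @ t)"
  using assms(2)
proof (induction rule: zz_eq.induct)
  case (1 p)
  then show ?case using r t C by (intro zz_eq.intros(1)) (auto simp: zigzag_append)
next
  case (2 p q)
  then show ?case using r t C
    by (intro zz_eq.intros(2) zz_red_append) (auto simp: zigzag_append)
qed (blast intro: zz_eq.intros)+

lemma zz_class_eq_iff:
  assumes "zigzag C W A p B"
  shows "zz_class C W A B p = zz_class C W A B q \<longleftrightarrow> zz_eq C W A B p q"
  using assms unfolding zz_class_def by (blast intro: zz_eq.intros)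

text \<open>Composition in \<open>localization\<close> is a union over all pairs of representatives.
  Independence of the representatives collapses this union to one class.\<close>

lemma zz_class_append:
  assumes C: "category C" and p: "zigzag C W A p B" and q: "zigzag C W B q D"
    and "p' \<in> zz_class C W A B p" "q' \<in> zz_class C W B D q"
  shows "zz_class C W A D (p' @ q') = zz_class C W A D (p @ q)"
proof -
  have pp: "zz_eq C W A B p p'" and qq: "zz_eq C W B D q q'"
    using assms by (auto simp: zz_class_def)
  have "zz_eq C W A D (p @ q) (p' @ q)"
    using zz_eq_append[OF C pp, of A "[]" q D] q zigzag_ob[OF C p] by auto
  moreover have "zz_eq C W A D (p' @ q) (p' @ q')"
    using zz_eq_append[OF C qq, of A p' "[]" D] zz_eq_zigzag[OF pp] zigzag_ob[OF C q] by auto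
  ultimately have "zz_eq C W A D (p @ q) (p' @ q')"
    by (rule zz_eq.intros(4))
  then show ?thesis using zz_class_eq_iff zz_eq_zigzag by metis
qed

lemma localization_simps [simp]:
  "ob (localization C W) = ob C" "idt (localization C W) A = (A, zz_class C W A A [], A)"
  "src (localization C W) = fst" "tgt (localization C W) f = snd (snd f)"
  by (auto simp: localization_def)

lemma Hom_localization:
  "f \<in> Hom (localization C W) A B \<longleftrightarrow> (\<exists>p. f = (A, zz_class C W A B p, B) \<and> zigzag C W A p B)"
  by (auto simp: Hom_def localization_def)

lemma cmp_localization:
  assumes "category C" "zigzag C W A p B" "zigzag C W B q D"
  shows "cmp (localization C W) (B, zz_class C W B D q, D) (A, zz_class C W A B p, B)
    = (A, zz_class C W A D (p @ q), D)"
proof -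
  have "p \<in> zz_class C W A B p" "q \<in> zz_class C W B D q"
    using assms by (auto simp: zz_class_def intro: zz_eq.intros)
  then have "(\<Union>p'\<in>zz_class C W A B p. \<Union>q'\<in>zz_class C W B D q. zz_class C W A D (p' @ q'))
      = zz_class C W A D (p @ q)"
    using zz_class_append[OF assms] by blast
  then show ?thesis by (simp add: localization_def)
qed

lemma category_localization:
  assumes C: "category C"
  shows "category (localization C W)"
proof -
  let ?L = "localization C W"
  have arr: "f \<in> arr ?L \<longleftrightarrow> (\<exists>A B p. f = (A, zz_class C W A B p, B) \<and> zigzag C W A p B)" for f
    by (auto simp: localization_def)
  show ?thesis
    unfolding category_def
  proof (intro conjI ballI impI; (elim arr[THEN iffD1, elim_format] exE conjE)?)
    fix A assume "A \<in> ob ?L"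
    then show "idt ?L A \<in> Hom ?L A A"
      by (auto simp: Hom_localization intro!: exI[of _ "[]"])
  next
    fix f A B p assume f: "f = (A, zz_class C W A B p, B)" "zigzag C W A p B"
    show "src ?L f \<in> ob ?L" "tgt ?L f \<in> ob ?L"
      using f zigzag_ob[OF C] by auto
    show "cmp ?L f (idt ?L (src ?L f)) = f"
      using f cmp_localization[OF C, of W A "[]" A p B] zigzag_ob[OF C f(2)] by simp
    show "cmp ?L (idt ?L (tgt ?L f)) f = f"
      using f cmp_localization[OF C, of W A p B "[]" B] zigzag_ob[OF C f(2)] by simp
    fix g A' B' q assume g: "g = (A', zz_class C W A' B' q, B')" "zigzag C W A' q B'"
      and fg: "src ?L g = tgt ?L f"
    then have A': "A' = B" using f by simp
    have gf: "cmp ?L g f = (A, zz_class C W A B' (p @ q), B')"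
      using f g A' cmp_localization[OF C] by blast
    have pq: "zigzag C W A (p @ q) B'"
      using f g A' C by (auto simp: zigzag_append)
    show "cmp ?L g f \<in> Hom ?L (src ?L f) (tgt ?L g)"
      using gf f g pq by (auto simp: Hom_localization)
    fix h A'' B'' r assume h: "h = (A'', zz_class C W A'' B'' r, B'')" "zigzag C W A'' r B''"
      and gh: "src ?L h = tgt ?L g"
    then have A'': "A'' = B'" using g by simp
    have hg: "cmp ?L h g = (A', zz_class C W A' B'' (q @ r), B'')"
      using h g A'' cmp_localization[OF C] by blast
    have qr: "zigzag C W A' (q @ r) B''"
      using h g A'' C by (auto simp: zigzag_append)
    show "cmp ?L h (cmp ?L g f) = cmp ?L (cmp ?L h g) f"
      using gf hg pq qr cmp_localization[OF C pq, of r B'']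
        cmp_localization[OF C f(2), of "q @ r" B''] h f A' A'' by simp
  qed
qed

lemma zigzag_Fwd: "category C \<Longrightarrow> f \<in> Hom C A B \<Longrightarrow> zigzag C W A [Fwd f] B"
  by (auto simp: Hom_def category_def)

lemma loc_arr_eq: "f \<in> Hom C A B \<Longrightarrow> loc_arr C W f = (A, zz_class C W A B [Fwd f], B)"
  by (auto simp: loc_arr_def Hom_def)

lemma loc_arr_Hom: "category C \<Longrightarrow> f \<in> Hom C A B \<Longrightarrow> loc_arr C W f \<in> Hom (localization C W) A B"
  using zigzag_Fwd by (fastforce simp: Hom_localization loc_arr_eq)

lemma zz_class_red:
  assumes "zz_red C W p q" "zigzag C W A p B" "zigzag C W A q B"
  shows "zz_class C W A B p = zz_class C W A B q"
  using assms by (subst zz_class_eq_iff) (auto intro: zz_eq.intros)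

lemma loc_arr_cmp:
  assumes C: "category C" and f: "f \<in> Hom C A B" and g: "g \<in> Hom C B D"
  shows "loc_arr C W (cmp C g f) = cmp (localization C W) (loc_arr C W g) (loc_arr C W f)"
proof -
  have gf: "cmp C g f \<in> Hom C A D" using category_cmp[OF C g f] .
  have "zz_red C W [Fwd f, Fwd g] [Fwd (cmp C g f)]"
    using zz_red.intros(2)[of C f g W "[]" "[]"] f g by (simp add: Hom_def)
  moreover have "zigzag C W A [Fwd f, Fwd g] D"
    using zigzag_Fwd[OF C f] zigzag_Fwd[OF C g] f by (auto simp: Hom_def)
  ultimately have "zz_class C W A D [Fwd f, Fwd g] = zz_class C W A D [Fwd (cmp C g f)]"
    using zigzag_Fwd[OF C gf] by (rule zz_class_red)
  then show ?thesis
    using cmp_localization[OF C zigzag_Fwd[OF C f] zigzag_Fwd[OF C g], of W]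
    by (simp add: loc_arr_eq[OF f] loc_arr_eq[OF g] loc_arr_eq[OF gf])
qed

text \<open>The inverse is the class of the single step \<open>Bwd f\<close>; each of the two
  cancellation rules gives one of the two identities.\<close>

lemma loc_arr_iso:
  assumes C: "category C" and f: "f \<in> Hom C A B" and W: "f \<in> W"
  shows "iso_arr (localization C W) A B (loc_arr C W f)"
proof -
  have AB: "A \<in> ob C" "B \<in> ob C" using category_Hom_ob[OF C f] by auto
  have F: "zigzag C W A [Fwd f] B" using zigzag_Fwd[OF C f] .
  have b: "zigzag C W B [Bwd f] A" using f W AB by (auto simp: Hom_def)
  have "zz_class C W A A [Fwd f, Bwd f] = zz_class C W A A []"
    using zz_red.intros(3)[of C W "[]" f "[]"] f W AB by (intro zz_class_red) (auto simp: Hom_def)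
  moreover have "zz_class C W B B [Bwd f, Fwd f] = zz_class C W B B []"
    using zz_red.intros(4)[of C W "[]" f "[]"] f W AB by (intro zz_class_red) (auto simp: Hom_def)
  ultimately have "cmp (localization C W) (B, zz_class C W B A [Bwd f], A) (loc_arr C W f)
      = idt (localization C W) A"
    "cmp (localization C W) (loc_arr C W f) (B, zz_class C W B A [Bwd f], A)
      = idt (localization C W) B"
    using cmp_localization[OF C F b] cmp_localization[OF C b F] by (simp_all add: loc_arr_eq[OF f])
  then show ?thesis
    unfolding iso_arr_def using AB loc_arr_Hom[OF C f] b
    by (intro conjI bexI[of _ "(B, zz_class C W B A [Bwd f], A)"])
      (simp_all, auto simp: Hom_localization)
qed

text \<open>For a backward step \<open>s\<close> the arrow \<open>\<eta>\<close> is moved across by inserting \<open>s\<close> and its formal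
  inverse on both sides.\<close>

lemma zz_eq_natural:
  assumes C: "category C" and \<eta>: "\<And>A. A \<in> ob C \<Longrightarrow> \<eta> A \<in> Hom C A A"
    and nat: "\<And>f A B. f \<in> Hom C A B \<Longrightarrow> cmp C (\<eta> B) f = cmp C f (\<eta> A)"
  shows "zigzag C W A p B \<Longrightarrow> zz_eq C W A B (p @ [Fwd (\<eta> B)]) (Fwd (\<eta> A) # p)"
proof (induction p arbitrary: A)
  case Nil
  then show ?case using zigzag_Fwd[OF C \<eta>] by (auto intro: zz_eq.intros(1))
next
  case (Cons x p)
  have \<eta>z: "zigzag C W M (Fwd (\<eta> M) # r) B \<longleftrightarrow> zigzag C W M r B" if "M \<in> ob C" for M r B
    using \<eta>[OF that] by (auto simp: Hom_def)
  note tr = zz_eq.intros(4)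
  show ?case
  proof (cases x)
    case (Fwd f)
    then obtain M where f: "f \<in> Hom C A M" and p: "zigzag C W M p B"
      using Cons.prems by (auto simp: Hom_def)
    have ob: "A \<in> ob C" "M \<in> ob C" using category_Hom_ob[OF C f] by auto
    have h: "\<eta> A \<in> Hom C A A" "\<eta> M \<in> Hom C M M" using \<eta> ob by auto
    have "zz_eq C W A B ([Fwd f] @ (p @ [Fwd (\<eta> B)]) @ []) ([Fwd f] @ (Fwd (\<eta> M) # p) @ [])"
      using zz_eq_append[OF C Cons.IH[OF p] zigzag_Fwd[OF C f], of "[]" B] zigzag_ob[OF C p] by simp
    moreover have "zz_eq C W A B ([Fwd f] @ (Fwd (\<eta> M) # p)) (Fwd (cmp C (\<eta> M) f) # p)"
      using f h p category_cmp[OF C h(2) f] zz_red.intros(2)[of C f "\<eta> M" W "[]" p]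
      by (intro zz_eq.intros(2)) (auto simp: Hom_def)
    moreover have "zz_eq C W A B (Fwd (\<eta> A) # Fwd f # p) (Fwd (cmp C f (\<eta> A)) # p)"
      using f h p category_cmp[OF C f h(1)] zz_red.intros(2)[of C "\<eta> A" f W "[]" p]
      by (intro zz_eq.intros(2)) (auto simp: Hom_def)
    ultimately show ?thesis
      using nat[OF f] Fwd by (auto intro: zz_eq.intros(3,4))
  next
    case (Bwd s)
    then obtain M where s: "s \<in> Hom C M A" "s \<in> W" and p: "zigzag C W M p B"
      using Cons.prems by (auto simp: Hom_def)
    have ob: "A \<in> ob C" "M \<in> ob C" using category_Hom_ob[OF C s(1)] by auto
    have h: "\<eta> A \<in> Hom C A A" "\<eta> M \<in> Hom C M M" using \<eta> ob by auto
    have zs: "zigzag C W A [Bwd s] M" using s ob by (auto simp: Hom_def)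
    have "zz_eq C W A B ([Bwd s] @ (p @ [Fwd (\<eta> B)]) @ []) ([Bwd s] @ (Fwd (\<eta> M) # p) @ [])"
      using zz_eq_append[OF C Cons.IH[OF p] zs, of "[]" B] zigzag_ob[OF C p] by simp
    moreover have "zz_eq C W A B (Bwd s # Fwd (\<eta> M) # Fwd s # Bwd s # p) (Bwd s # Fwd (\<eta> M) # p)"
      using s h p zz_red.intros(3)[of C W "[Bwd s, Fwd (\<eta> M)]" s p]
      by (intro zz_eq.intros(2)) (auto simp: Hom_def)
    moreover have "zz_eq C W A B (Bwd s # Fwd (\<eta> M) # Fwd s # Bwd s # p)
        (Bwd s # Fwd (cmp C s (\<eta> M)) # Bwd s # p)"
      using s h p category_cmp[OF C s(1) h(2)] zz_red.intros(2)[of C "\<eta> M" s W "[Bwd s]" "Bwd s # p"]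
      by (intro zz_eq.intros(2)) (auto simp: Hom_def)
    moreover have "zz_eq C W A B (Bwd s # Fwd s # Fwd (\<eta> A) # Bwd s # p)
        (Bwd s # Fwd (cmp C (\<eta> A) s) # Bwd s # p)"
      using s h p category_cmp[OF C h(1) s(1)] zz_red.intros(2)[of C s "\<eta> A" W "[Bwd s]" "Bwd s # p"]
      by (intro zz_eq.intros(2)) (auto simp: Hom_def)
    moreover have "zz_eq C W A B (Bwd s # Fwd s # Fwd (\<eta> A) # Bwd s # p) (Fwd (\<eta> A) # Bwd s # p)"
      using s h p zz_red.intros(4)[of C W "[]" s "Fwd (\<eta> A) # Bwd s # p"]
      by (intro zz_eq.intros(2)) (auto simp: Hom_def)
    ultimately show ?thesis
      using nat[OF s(1)] Bwd by (simp) (meson zz_eq.intros(3,4))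
  qed
qed

text \<open>Extends a natural endomorphism of the identity functor from \<open>C\<close> to the
  localization, whose arrows need not come from \<open>C\<close>. It is applied to multiplication by
  an integer.\<close>

lemma localization_natural:
  assumes C: "category C" and \<eta>: "\<And>A. A \<in> ob C \<Longrightarrow> \<eta> A \<in> Hom C A A"
    and nat: "\<And>f A B. f \<in> Hom C A B \<Longrightarrow> cmp C (\<eta> B) f = cmp C f (\<eta> A)"
    and f: "f \<in> Hom (localization C W) A B"
  shows "cmp (localization C W) (loc_arr C W (\<eta> B)) f = cmp (localization C W) f (loc_arr C W (\<eta> A))"
proof -
  obtain p where p: "f = (A, zz_class C W A B p, B)" "zigzag C W A p B"
    using f by (auto simp: Hom_localization)
  have ob: "A \<in> ob C" "B \<in> ob C" using zigzag_ob[OF C p(2)] by auto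
  have eq: "zz_eq C W A B (p @ [Fwd (\<eta> B)]) (Fwd (\<eta> A) # p)"
    by (rule zz_eq_natural[OF C \<eta> nat p(2)])
  then have "zz_class C W A B (p @ [Fwd (\<eta> B)]) = zz_class C W A B ([Fwd (\<eta> A)] @ p)"
    using zz_class_eq_iff zz_eq_zigzag by fastforce
  then show ?thesis
    using cmp_localization[OF C p(2) zigzag_Fwd[OF C \<eta>[OF ob(2)]]]
      cmp_localization[OF C zigzag_Fwd[OF C \<eta>[OF ob(1)]] p(2)]
    by (simp add: p(1) loc_arr_eq[OF \<eta>[OF ob(1)]] loc_arr_eq[OF \<eta>[OF ob(2)]])
qed

section \<open>Functors induced on localizations\<close>

lemma zigzag_map:
  assumes F: "is_functor C D F" and V: "snd F ` (arr C \<inter> W) \<subseteq> V"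
  shows "zigzag C W A p B \<Longrightarrow> zigzag D V (fst F A) (map (map_step (snd F)) p) (fst F B)"
proof (induction p arbitrary: A)
  case Nil
  then show ?case using F by (auto simp: is_functor_def)
next
  case (Cons x p)
  show ?case
  proof (cases x)
    case (Fwd f)
    then have "f \<in> Hom C A (tgt C f)" "zigzag C W (tgt C f) p B"
      using Cons.prems by (auto simp: Hom_def)
    then show ?thesis using Cons.IH Fwd functor_Hom[OF F] by (fastforce simp: Hom_def)
  next
    case (Bwd s)
    then have "s \<in> Hom C (src C s) A" "s \<in> arr C \<inter> W" "zigzag C W (src C s) p B"
      using Cons.prems by (auto simp: Hom_def)
    then show ?thesis using Cons.IH Bwd functor_Hom[OF F] V by (fastforce simp: Hom_def)
  qed
qed

text \<open>The first reduction rule deletes \<open>Fwd (idt C A)\<close> for an arbitrary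
  \<open>A\<close>, while a functor preserves identities at objects only. The hypothesis on
  \<open>idt\<close> closes this gap: in a legal zigzag the deleted step is an arrow, hence
  \<open>A\<close> is an object.\<close>

lemma zz_red_map:
  assumes C: "category C" and F: "is_functor C D F" and idt: "\<forall>A. idt C A \<in> arr C \<longrightarrow> A \<in> ob C"
  shows "zz_red C W p q \<Longrightarrow> zigzag C W A p B \<Longrightarrow>
    zz_red D V (map (map_step (snd F)) p) (map (map_step (snd F)) q)"
proof (induction rule: zz_red.induct)
  case (1 p M q)
  then have "M \<in> ob C" using idt by (auto simp: zigzag_append[OF C])
  then show ?case using zz_red.intros(1)[of D V _ "fst F M"] functor_id[OF F] by simp
next
  case (2 f g p q)
  then have fg: "f \<in> Hom C (src C f) (tgt C f)" "g \<in> Hom C (tgt C f) (tgt C g)"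
    by (auto simp: zigzag_append[OF C] Hom_def)
  have "tgt D (snd F f) = src D (snd F g)"
    using functor_Hom[OF F fg(1)] functor_Hom[OF F fg(2)] by (simp add: Hom_def)
  then show ?case using zz_red.intros(2)[of D "snd F f" "snd F g" V] functor_cmp[OF F fg] by simp
qed (simp_all add: zz_red.intros)

lemma zz_eq_map:
  assumes C: "category C" and F: "is_functor C D F" and idt: "\<forall>A. idt C A \<in> arr C \<longrightarrow> A \<in> ob C"
    and V: "snd F ` (arr C \<inter> W) \<subseteq> V"
  shows "zz_eq C W A B p q \<Longrightarrow>
    zz_eq D V (fst F A) (fst F B) (map (map_step (snd F)) p) (map (map_step (snd F)) q)"
proof (induction rule: zz_eq.induct)
  case (1 p)
  then show ?case using zigzag_map[OF F V] by (blast intro: zz_eq.intros(1))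
next
  case (2 p q)
  then show ?case using zigzag_map[OF F V] zz_red_map[OF C F idt] by (blast intro: zz_eq.intros(2))
qed (blast intro: zz_eq.intros)+

text \<open>Equivalent zigzags have equivalent images, so the union over representatives in
  \<open>loc_map\<close> is the class of the image of any one of them.\<close>

lemma loc_map_eq:
  assumes C: "category C" and F: "is_functor C D F" and idt: "\<forall>A. idt C A \<in> arr C \<longrightarrow> A \<in> ob C"
    and V: "snd F ` (arr C \<inter> W) \<subseteq> V" and p: "zigzag C W A p B"
  shows "loc_map D V F (A, zz_class C W A B p, B) =
    (fst F A, zz_class D V (fst F A) (fst F B) (map (map_step (snd F)) p), fst F B)"
proof -
  have "zz_class D V (fst F A) (fst F B) (map (map_step (snd F)) q)
      = zz_class D V (fst F A) (fst F B) (map (map_step (snd F)) p)" if "q \<in> zz_class C W A B p" for q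
  proof -
    have "zz_eq C W A B p q" using that by (simp add: zz_class_def)
    then have "zz_eq D V (fst F A) (fst F B) (map (map_step (snd F)) p) (map (map_step (snd F)) q)"
      using zz_eq_map[OF C F idt] V by blast
    then show ?thesis using zz_class_eq_iff zz_eq_zigzag by metis
  qed
  moreover have "p \<in> zz_class C W A B p"
    using p by (auto simp: zz_class_def intro: zz_eq.intros)
  ultimately have "(\<Union>q\<in>zz_class C W A B p. zz_class D V (fst F A) (fst F B) (map (map_step (snd F)) q))
      = zz_class D V (fst F A) (fst F B) (map (map_step (snd F)) p)"
    by blast
  then show ?thesis by (simp add: loc_map_def)
qed

lemma functor_loc_map:
  assumes C: "category C" and D: "category D" and F: "is_functor C D F"
    and idt: "\<forall>A. idt C A \<in> arr C \<longrightarrow> A \<in> ob C"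
    and V: "snd F ` (arr C \<inter> W) \<subseteq> V"
  shows "is_functor (localization C W) (localization D V) (fst F, loc_map D V F)"
proof -
  let ?L = "localization C W" and ?M = "localization D V"
  have arr: "f \<in> arr ?L \<longleftrightarrow> (\<exists>A B p. f = (A, zz_class C W A B p, B) \<and> zigzag C W A p B)" for f
    by (auto simp: localization_def)
  note eq = loc_map_eq[OF C F idt V] and z = zigzag_map[OF F V]
  show ?thesis
    unfolding is_functor_def
  proof (intro conjI ballI impI; (elim arr[THEN iffD1, elim_format] exE conjE)?)
    fix A assume A: "A \<in> ob ?L"
    then show "fst (fst F, loc_map D V F) A \<in> ob ?M" using functor_ob[OF F] by simp
    show "snd (fst F, loc_map D V F) (idt ?L A) = idt ?M (fst (fst F, loc_map D V F) A)"
      using A eq[of A "[]" A] by simp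
  next
    fix f A B p assume f: "f = (A, zz_class C W A B p, B)" "zigzag C W A p B"
    show "snd (fst F, loc_map D V F) f
        \<in> Hom ?M (fst (fst F, loc_map D V F) (src ?L f)) (fst (fst F, loc_map D V F) (tgt ?L f))"
      using f eq[OF f(2)] z[OF f(2)] by (auto simp: Hom_localization)
    fix g A' B' q assume g: "g = (A', zz_class C W A' B' q, B')" "zigzag C W A' q B'"
      and "src ?L g = tgt ?L f"
    then have g: "g = (B, zz_class C W B B' q, B')" "zigzag C W B q B'" using f by auto
    show "snd (fst F, loc_map D V F) (cmp ?L g f)
        = cmp ?M (snd (fst F, loc_map D V F) g) (snd (fst F, loc_map D V F) f)"
      using cmp_localization[OF C f(2) g(2)] cmp_localization[OF D z[OF f(2)] z[OF g(2)]]
        eq[OF f(2)] eq[OF g(2)] eq[of A "p @ q" B'] f(2) g(2) C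
      by (auto simp: f(1) g(1) zigzag_append)
  qed
qed

lemma loc_map_loc_arr:
  assumes C: "category C" and F: "is_functor C D F"
    and idt: "\<forall>A. idt C A \<in> arr C \<longrightarrow> A \<in> ob C"
    and V: "snd F ` (arr C \<inter> W) \<subseteq> V" and f: "f \<in> Hom C A B"
  shows "loc_map D V F (loc_arr C W f) = loc_arr D V (snd F f)"
  using loc_map_eq[OF C F idt V zigzag_Fwd[OF C f]] loc_arr_eq[OF f] loc_arr_eq[OF functor_Hom[OF F f]]
  by simp

section \<open>Presheaves and stalks\<close>

lemma presheaf_comm_group: "presheaf T F \<Longrightarrow> openin T U \<Longrightarrow> comm_group (sec F U)"
  and presheaf_group: "presheaf T F \<Longrightarrow> openin T U \<Longrightarrow> group (sec F U)"
  and rst_id: "presheaf T F \<Longrightarrow> openin T U \<Longrightarrow> s \<in> carrier (sec F U) \<Longrightarrow> rst F U U s = s"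
  and rst_hom: "presheaf T F \<Longrightarrow> openin T U \<Longrightarrow> openin T V \<Longrightarrow> V \<subseteq> U \<Longrightarrow>
    rst F U V \<in> hom (sec F U) (sec F V)"
  and rst_closed: "presheaf T F \<Longrightarrow> openin T U \<Longrightarrow> openin T V \<Longrightarrow> V \<subseteq> U \<Longrightarrow>
    s \<in> carrier (sec F U) \<Longrightarrow> rst F U V s \<in> carrier (sec F V)"
  and rst_rst: "presheaf T F \<Longrightarrow> openin T U \<Longrightarrow> openin T V \<Longrightarrow> openin T W \<Longrightarrow> V \<subseteq> U \<Longrightarrow> W \<subseteq> V \<Longrightarrow>
    s \<in> carrier (sec F U) \<Longrightarrow> rst F V W (rst F U V s) = rst F U W s"
  by (auto simp: presheaf_def comm_group_def hom_def Pi_def)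

lemma rst_mult: "presheaf T F \<Longrightarrow> openin T U \<Longrightarrow> openin T V \<Longrightarrow> V \<subseteq> U \<Longrightarrow>
    s \<in> carrier (sec F U) \<Longrightarrow> t \<in> carrier (sec F U) \<Longrightarrow>
    rst F U V (s \<otimes>\<^bsub>sec F U\<^esub> t) = rst F U V s \<otimes>\<^bsub>sec F V\<^esub> rst F U V t"
  by (auto simp: presheaf_def hom_def)

lemma rst_one: "presheaf T F \<Longrightarrow> openin T U \<Longrightarrow> openin T V \<Longrightarrow> V \<subseteq> U \<Longrightarrow>
    rst F U V \<one>\<^bsub>sec F U\<^esub> = \<one>\<^bsub>sec F V\<^esub>"
  by (rule hom_one) (auto intro: rst_hom presheaf_group)

lemma sheaf_presheaf: "sheaf T F \<Longrightarrow> presheaf T F"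
  by (simp add: sheaf_def)

lemma on_opens_apply [simp]:
  "openin T U \<Longrightarrow> s \<in> carrier (sec F U) \<Longrightarrow> on_opens T F \<phi> U s = \<phi> U s"
  by (simp add: on_opens_def)

lemma on_opens_cong:
  "(\<And>U s. openin T U \<Longrightarrow> s \<in> carrier (sec F U) \<Longrightarrow> \<phi> U s = \<psi> U s) \<Longrightarrow>
    on_opens T F \<phi> = on_opens T F \<psi>"
  by (auto simp: on_opens_def fun_eq_iff)

lemma on_opens_idem [simp]: "on_opens T F (on_opens T F \<phi>) = on_opens T F \<phi>"
  by (rule on_opens_cong) simp

lemma psh_mor_closed: "psh_mor T F G \<phi> \<Longrightarrow> openin T U \<Longrightarrow> s \<in> carrier (sec F U) \<Longrightarrow>
    \<phi> U s \<in> carrier (sec G U)"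
  and psh_mor_hom: "psh_mor T F G \<phi> \<Longrightarrow> openin T U \<Longrightarrow> \<phi> U \<in> hom (sec F U) (sec G U)"
  and psh_mor_mult: "psh_mor T F G \<phi> \<Longrightarrow> openin T U \<Longrightarrow> s \<in> carrier (sec F U) \<Longrightarrow>
    t \<in> carrier (sec F U) \<Longrightarrow> \<phi> U (s \<otimes>\<^bsub>sec F U\<^esub> t) = \<phi> U s \<otimes>\<^bsub>sec G U\<^esub> \<phi> U t"
  and psh_mor_rst: "psh_mor T F G \<phi> \<Longrightarrow> openin T U \<Longrightarrow> openin T V \<Longrightarrow> V \<subseteq> U \<Longrightarrow>
    s \<in> carrier (sec F U) \<Longrightarrow> \<phi> V (rst F U V s) = rst G U V (\<phi> U s)"
  and psh_mor_on_opens: "psh_mor T F G \<phi> \<Longrightarrow> on_opens T F \<phi> = \<phi>"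
  by (auto simp: psh_mor_def hom_def Pi_def)

lemma psh_mor_one: "psh_mor T F G \<phi> \<Longrightarrow> presheaf T F \<Longrightarrow> presheaf T G \<Longrightarrow> openin T U \<Longrightarrow>
    \<phi> U \<one>\<^bsub>sec F U\<^esub> = \<one>\<^bsub>sec G U\<^esub>"
  by (rule hom_one) (auto intro: psh_mor_hom presheaf_group)

lemma psh_morI:
  assumes "\<And>U s. openin T U \<Longrightarrow> s \<in> carrier (sec F U) \<Longrightarrow> \<phi> U s \<in> carrier (sec G U)"
    and "\<And>U s t. openin T U \<Longrightarrow> s \<in> carrier (sec F U) \<Longrightarrow> t \<in> carrier (sec F U) \<Longrightarrow>
      \<phi> U (s \<otimes>\<^bsub>sec F U\<^esub> t) = \<phi> U s \<otimes>\<^bsub>sec G U\<^esub> \<phi> U t"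
    and "\<And>U V s. openin T U \<Longrightarrow> openin T V \<Longrightarrow> V \<subseteq> U \<Longrightarrow> s \<in> carrier (sec F U) \<Longrightarrow>
      \<phi> V (rst F U V s) = rst G U V (\<phi> U s)"
    and F: "presheaf T F"
  shows "psh_mor T F G (on_opens T F \<phi>)"
proof -
  have "s \<otimes>\<^bsub>sec F U\<^esub> t \<in> carrier (sec F U)"
    if "openin T U" "s \<in> carrier (sec F U)" "t \<in> carrier (sec F U)" for U s t
    using monoid.m_closed[OF group.is_monoid[OF presheaf_group[OF F that(1)]]] that by blast
  then show ?thesis
    using assms by (auto simp: psh_mor_def hom_def rst_closed)
qed

lemma psh_mor_eqI:
  assumes "psh_mor T F G \<phi>" "psh_mor T F H \<psi>"
    and "\<And>U s. openin T U \<Longrightarrow> s \<in> carrier (sec F U) \<Longrightarrow> \<phi> U s = \<psi> U s"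
  shows "\<phi> = \<psi>"
  using on_opens_cong[of T F \<phi> \<psi>] assms psh_mor_on_opens by metis

lemma psh_comp_mor:
  assumes "psh_mor T F G \<phi>" "psh_mor T G H \<psi>" "presheaf T F"
  shows "psh_mor T F H (psh_comp T F \<psi> \<phi>)"
  unfolding psh_comp_def using assms
  by (intro psh_morI) (auto simp: psh_mor_closed psh_mor_mult psh_mor_rst)

lemma psh_id_mor: "presheaf T F \<Longrightarrow> psh_mor T F F (psh_id T F)"
  unfolding psh_id_def by (intro psh_morI) auto

lemma psh_comp_apply [simp]:
  "openin T U \<Longrightarrow> s \<in> carrier (sec F U) \<Longrightarrow> psh_comp T F \<psi> \<phi> U s = \<psi> U (\<phi> U s)"
  and psh_id_apply [simp]: "openin T U \<Longrightarrow> s \<in> carrier (sec F U) \<Longrightarrow> psh_id T F U s = s"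
  by (auto simp: psh_comp_def psh_id_def)

section \<open>Germs and stalks\<close>

lemma germ_eq_iff:
  assumes F: "presheaf T F" and U: "openin T U" "x \<in> U" "s \<in> carrier (sec F U)"
    and V: "openin T V" "x \<in> V" "t \<in> carrier (sec F V)"
  shows "germ T F x U s = germ T F x V t \<longleftrightarrow>
    (\<exists>W. openin T W \<and> x \<in> W \<and> W \<subseteq> U \<inter> V \<and> rst F U W s = rst F V W t)"
proof
  assume "germ T F x U s = germ T F x V t"
  moreover have "(V, t) \<in> germ T F x V t" using V by (auto simp: germ_def)
  ultimately have "(V, t) \<in> germ T F x U s" by simp
  then show "\<exists>W. openin T W \<and> x \<in> W \<and> W \<subseteq> U \<inter> V \<and> rst F U W s = rst F V W t"
    by (auto simp: germ_def)
next
  assume "\<exists>W. openin T W \<and> x \<in> W \<and> W \<subseteq> U \<inter> V \<and> rst F U W s = rst F V W t"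
  then obtain W where W: "openin T W" "x \<in> W" "W \<subseteq> U" "W \<subseteq> V" "rst F U W s = rst F V W t"
    by auto
  \<comment> \<open>One inclusion suffices, because the situation is symmetric in the two sections.
    A third representative is compared over the intersection of the two neighbourhoods of
    agreement.\<close>
  have sub: "germ T F x U s \<subseteq> germ T F x V t"
    if U: "openin T U" "s \<in> carrier (sec F U)" and V: "openin T V" "t \<in> carrier (sec F V)"
      and W: "openin T W" "x \<in> W" "W \<subseteq> U" "W \<subseteq> V" "rst F U W s = rst F V W t" for U V W s t
  proof
    fix p assume p: "p \<in> germ T F x U s"
    then obtain Q q Z where q: "p = (Q, q)" "openin T Q" "x \<in> Q" "q \<in> carrier (sec F Q)"
      "openin T Z" "x \<in> Z" "Z \<subseteq> U \<inter> Q" "rst F U Z s = rst F Q Z q"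
      by (auto simp: germ_def)
    have ZW: "openin T (Z \<inter> W)" using q W by blast
    have "rst F V (Z \<inter> W) t = rst F W (Z \<inter> W) (rst F V W t)"
      using rst_rst[OF F V(1) W(1) ZW] W V by auto
    also have "\<dots> = rst F U (Z \<inter> W) s"
      using rst_rst[OF F U(1) W(1) ZW] W U by (metis inf_le2)
    also have "\<dots> = rst F Z (Z \<inter> W) (rst F U Z s)"
      using rst_rst[OF F U(1) q(5) ZW _ _ U(2)] q(7) by simp
    also have "\<dots> = rst F Q (Z \<inter> W) q"
      using rst_rst[OF F q(2,5) ZW _ _ q(4)] q(7,8) by simp
    finally show "p \<in> germ T F x V t"
      using q W ZW by (auto simp: germ_def intro!: exI[of _ "Z \<inter> W"])
  qed
  show "germ T F x U s = germ T F x V t"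
    using sub[OF U(1,3) V(1,3) W] sub[OF V(1,3) U(1,3) W(1,2,4,3)] W(5) by simp
qed

lemma germ_rst:
  assumes "presheaf T F" "openin T U" "openin T V" "x \<in> V" "V \<subseteq> U" "s \<in> carrier (sec F U)"
  shows "germ T F x V (rst F U V s) = germ T F x U s"
  using assms
  by (subst germ_eq_iff) (auto intro!: exI[of _ V] simp: rst_closed rst_rst rst_id)

lemma carrier_stalk:
  "carrier (stalk T F x) = {germ T F x U s | U s. openin T U \<and> x \<in> U \<and> s \<in> carrier (sec F U)}"
  by (simp add: stalk_def)

lemma germ_in_stalk:
  "openin T U \<Longrightarrow> x \<in> U \<Longrightarrow> s \<in> carrier (sec F U) \<Longrightarrow> germ T F x U s \<in> carrier (stalk T F x)"
  by (auto simp: carrier_stalk)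

text \<open>Weaker than \<open>psh_mor\<close>: neither additive nor extensional. The maps
  \<open>cohomology_mor\<close> are unions of cosets and are not cut off outside the sections, and
  bijectivity on stalks uses closure and restriction only.\<close>

definition presheaf_map ::
  "'p topology \<Rightarrow> ('p, 'u) psh \<Rightarrow> ('p, 'v) psh \<Rightarrow> ('p, 'u, 'v) pmor \<Rightarrow> bool" where
  "presheaf_map T F G \<phi> \<longleftrightarrow>
     (\<forall>U s. openin T U \<longrightarrow> s \<in> carrier (sec F U) \<longrightarrow> \<phi> U s \<in> carrier (sec G U)) \<and>
     (\<forall>U V s. openin T U \<longrightarrow> openin T V \<longrightarrow> V \<subseteq> U \<longrightarrow> s \<in> carrier (sec F U) \<longrightarrow>
        \<phi> V (rst F U V s) = rst G U V (\<phi> U s))"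

lemma presheaf_map_closed:
    "presheaf_map T F G \<phi> \<Longrightarrow> openin T U \<Longrightarrow> s \<in> carrier (sec F U) \<Longrightarrow> \<phi> U s \<in> carrier (sec G U)"
  and presheaf_map_rst:
    "presheaf_map T F G \<phi> \<Longrightarrow> openin T U \<Longrightarrow> openin T V \<Longrightarrow> V \<subseteq> U \<Longrightarrow> s \<in> carrier (sec F U) \<Longrightarrow>
      \<phi> V (rst F U V s) = rst G U V (\<phi> U s)"
  by (auto simp: presheaf_map_def)

lemma stalk_map_germ:
  assumes F: "presheaf T F" and G: "presheaf T G"
    and \<phi>: "presheaf_map T F G \<phi>"
    and U: "openin T U" "x \<in> U" "s \<in> carrier (sec F U)"
  shows "stalk_map T G \<phi> x (germ T F x U s) = germ T G x U (\<phi> U s)"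
proof -
  have "germ T G x V (\<phi> V t) = germ T G x U (\<phi> U s)" if Vt: "(V, t) \<in> germ T F x U s" for V t
  proof -
    obtain W where V: "openin T V" "x \<in> V" "t \<in> carrier (sec F V)"
      and W: "openin T W" "x \<in> W" "W \<subseteq> V" "W \<subseteq> U" "rst F U W s = rst F V W t"
      using Vt by (auto simp: germ_def)
    then have "rst G V W (\<phi> V t) = rst G U W (\<phi> U s)"
      using presheaf_map_rst[OF \<phi>] U by metis
    then show ?thesis
      using W V U presheaf_map_closed[OF \<phi>] by (subst germ_eq_iff[OF G]) auto
  qed
  moreover have "(U, s) \<in> germ T F x U s" using U by (auto simp: germ_def)
  ultimately show ?thesis unfolding stalk_map_def by blast
qed

text \<open>Germs agree exactly when their representatives agree after restriction. Injectivity thus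
  becomes local agreement of sections with equal images, once two germs have been brought over a
  common neighbourhood; surjectivity becomes local lifting.\<close>

lemma stalk_map_bij_iff:
  assumes F: "presheaf T F" and G: "presheaf T G"
    and \<phi>: "presheaf_map T F G \<phi>"
  shows "bij_betw (stalk_map T G \<phi> x) (carrier (stalk T F x)) (carrier (stalk T G x)) \<longleftrightarrow>
    (\<forall>U s t. openin T U \<longrightarrow> x \<in> U \<longrightarrow> s \<in> carrier (sec F U) \<longrightarrow> t \<in> carrier (sec F U) \<longrightarrow>
      \<phi> U s = \<phi> U t \<longrightarrow> (\<exists>W. openin T W \<and> x \<in> W \<and> W \<subseteq> U \<and> rst F U W s = rst F U W t)) \<and>
    (\<forall>U t. openin T U \<longrightarrow> x \<in> U \<longrightarrow> t \<in> carrier (sec G U) \<longrightarrow>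
      (\<exists>W s. openin T W \<and> x \<in> W \<and> W \<subseteq> U \<and> s \<in> carrier (sec F W) \<and> \<phi> W s = rst G U W t))"
    (is "?bij \<longleftrightarrow> ?inj \<and> ?surj")
proof -
  note sm = stalk_map_germ[OF F G \<phi>]
  have 1: "inj_on (stalk_map T G \<phi> x) (carrier (stalk T F x))" if inj: ?inj
  proof (rule inj_onI)
    fix a b assume "a \<in> carrier (stalk T F x)" "b \<in> carrier (stalk T F x)"
      and eq: "stalk_map T G \<phi> x a = stalk_map T G \<phi> x b"
    then obtain U s V t where a: "a = germ T F x U s" "openin T U" "x \<in> U" "s \<in> carrier (sec F U)"
      and b: "b = germ T F x V t" "openin T V" "x \<in> V" "t \<in> carrier (sec F V)"
      by (auto simp: carrier_stalk)
    have "germ T G x U (\<phi> U s) = germ T G x V (\<phi> V t)" using eq a b sm by simp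
    then obtain W where W: "openin T W" "x \<in> W" "W \<subseteq> U" "W \<subseteq> V"
      and "rst G U W (\<phi> U s) = rst G V W (\<phi> V t)"
      using a b presheaf_map_closed[OF \<phi>] by (subst (asm) germ_eq_iff[OF G]) auto
    then have e: "\<phi> W (rst F U W s) = \<phi> W (rst F V W t)" using presheaf_map_rst[OF \<phi>] a b by auto
    obtain Z where Z: "openin T Z" "x \<in> Z" "Z \<subseteq> W"
      "rst F W Z (rst F U W s) = rst F W Z (rst F V W t)"
      using inj[rule_format, OF W(1,2) rst_closed[OF F a(2) W(1,3) a(4)]
          rst_closed[OF F b(2) W(1,4) b(4)] e] by blast
    then have "rst F U Z s = rst F V Z t"
      using rst_rst[OF F a(2) W(1) Z(1) W(3) Z(3) a(4)] rst_rst[OF F b(2) W(1) Z(1) W(4) Z(3) b(4)]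
      by simp
    then show "a = b" using a b Z W by (auto simp: germ_eq_iff[OF F])
  qed
  have 2: ?inj if i: "inj_on (stalk_map T G \<phi> x) (carrier (stalk T F x))"
  proof (intro allI impI)
    fix U s t assume U: "openin T U" "x \<in> U" and s: "s \<in> carrier (sec F U)"
      and t: "t \<in> carrier (sec F U)" and eq: "\<phi> U s = \<phi> U t"
    have "germ T F x U s = germ T F x U t"
      using sm[OF U s] sm[OF U t] eq
      by (intro inj_onD[OF i _ germ_in_stalk[OF U s] germ_in_stalk[OF U t]]) simp
    then show "\<exists>W. openin T W \<and> x \<in> W \<and> W \<subseteq> U \<and> rst F U W s = rst F U W t"
      using U s t by (subst (asm) germ_eq_iff[OF F]) auto
  qed
  have 3: "stalk_map T G \<phi> x ` carrier (stalk T F x) = carrier (stalk T G x)" if surj: ?surj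
  proof
    show "stalk_map T G \<phi> x ` carrier (stalk T F x) \<subseteq> carrier (stalk T G x)"
    proof
      fix b assume "b \<in> stalk_map T G \<phi> x ` carrier (stalk T F x)"
      then obtain U s where "b = stalk_map T G \<phi> x (germ T F x U s)" "openin T U" "x \<in> U"
        "s \<in> carrier (sec F U)"
        by (auto simp: carrier_stalk)
      then show "b \<in> carrier (stalk T G x)"
        using sm by (auto intro!: germ_in_stalk presheaf_map_closed[OF \<phi>])
    qed
    show "carrier (stalk T G x) \<subseteq> stalk_map T G \<phi> x ` carrier (stalk T F x)"
    proof
      fix b assume "b \<in> carrier (stalk T G x)"
      then obtain U t where b: "b = germ T G x U t" "openin T U" "x \<in> U" "t \<in> carrier (sec G U)"
        by (auto simp: carrier_stalk)
      then obtain W s where W: "openin T W" "x \<in> W" "W \<subseteq> U" "s \<in> carrier (sec F W)"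
        "\<phi> W s = rst G U W t"
        using surj[rule_format, OF b(2,3,4)] by blast
      have "b = germ T G x W (\<phi> W s)" using germ_rst[OF G b(2) W(1,2,3) b(4)] W b by simp
      then show "b \<in> stalk_map T G \<phi> x ` carrier (stalk T F x)"
        using sm[OF W(1,2,4)] germ_in_stalk[OF W(1,2,4)] by (metis image_eqI)
    qed
  qed
  have 4: ?surj if im: "stalk_map T G \<phi> x ` carrier (stalk T F x) = carrier (stalk T G x)"
  proof (intro allI impI)
    fix U t assume U: "openin T U" "x \<in> U" and t: "t \<in> carrier (sec G U)"
    then obtain a where "a \<in> carrier (stalk T F x)" "germ T G x U t = stalk_map T G \<phi> x a"
      using germ_in_stalk[OF U t] im by blast
    then obtain V s where V: "openin T V" "x \<in> V" "s \<in> carrier (sec F V)"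
      and "germ T G x U t = germ T G x V (\<phi> V s)"
      using sm by (auto simp: carrier_stalk)
    then obtain W where W: "openin T W" "x \<in> W" "W \<subseteq> U" "W \<subseteq> V" "rst G U W t = rst G V W (\<phi> V s)"
      using U t presheaf_map_closed[OF \<phi>] by (subst (asm) germ_eq_iff[OF G]) auto
    then show "\<exists>W s. openin T W \<and> x \<in> W \<and> W \<subseteq> U \<and> s \<in> carrier (sec F W) \<and> \<phi> W s = rst G U W t"
      using presheaf_map_rst[OF \<phi> V(1) W(1,4) V(3)] rst_closed[OF F V(1) W(1,4) V(3)] by metis
  qed
  show ?thesis
  proof
    assume b: ?bij
    show "?inj \<and> ?surj"
      by (rule conjI[OF 2[OF bij_betw_imp_inj_on[OF b]] 4[OF bij_betw_imp_surj_on[OF b]]])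
  next
    assume c: "?inj \<and> ?surj"
    show ?bij
      by (rule bij_betw_imageI[OF 1[OF conjunct1[OF c]] 3[OF conjunct2[OF c]]])
  qed
qed

text \<open>The product in \<open>stalk\<close> is a union over pairs of representatives with a
  common domain. All pairs give the same germ, as is seen on the intersection of the neighbourhoods
  where the two factors agree with \<open>s\<close> and \<open>t\<close>.\<close>

lemma stalk_mult:
  assumes F: "presheaf T F" and U: "openin T U" "x \<in> U" "s \<in> carrier (sec F U)" "t \<in> carrier (sec F U)"
  shows "germ T F x U s \<otimes>\<^bsub>stalk T F x\<^esub> germ T F x U t = germ T F x U (s \<otimes>\<^bsub>sec F U\<^esub> t)"
proof -
  have cl: "a \<otimes>\<^bsub>sec F V\<^esub> b \<in> carrier (sec F V)"
    if "openin T V" "a \<in> carrier (sec F V)" "b \<in> carrier (sec F V)" for V a b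
    using monoid.m_closed[OF group.is_monoid[OF presheaf_group[OF F that(1)]]] that by blast
  have "germ T F x V (a \<otimes>\<^bsub>sec F V\<^esub> b) = germ T F x U (s \<otimes>\<^bsub>sec F U\<^esub> t)"
    if ab: "(V, a) \<in> germ T F x U s" "(V, b) \<in> germ T F x U t" for V a b
  proof -
    obtain W Z where V: "openin T V" "x \<in> V" "a \<in> carrier (sec F V)" "b \<in> carrier (sec F V)"
      and W: "openin T W" "x \<in> W" "W \<subseteq> U" "W \<subseteq> V" "rst F U W s = rst F V W a"
      and Z: "openin T Z" "x \<in> Z" "Z \<subseteq> U" "Z \<subseteq> V" "rst F U Z t = rst F V Z b"
      using ab by (auto simp: germ_def)
    let ?Y = "W \<inter> Z"
    have Y: "openin T ?Y" using W Z by blast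
    have "rst F U ?Y s = rst F V ?Y a"
      using rst_rst[OF F U(1) W(1) Y W(3) _ U(3)] rst_rst[OF F V(1) W(1) Y W(4) _ V(3)] W by simp
    moreover have "rst F U ?Y t = rst F V ?Y b"
      using rst_rst[OF F U(1) Z(1) Y Z(3) _ U(4)] rst_rst[OF F V(1) Z(1) Y Z(4) _ V(4)] Z by simp
    ultimately have "rst F V ?Y (a \<otimes>\<^bsub>sec F V\<^esub> b) = rst F U ?Y (s \<otimes>\<^bsub>sec F U\<^esub> t)"
      using rst_mult[OF F V(1) Y _ V(3,4)] rst_mult[OF F U(1) Y _ U(3,4)] W by (simp add: le_infI1)
    then show ?thesis
      using U V W Z Y cl by (subst germ_eq_iff[OF F]) (auto intro!: exI[of _ ?Y])
  qed
  moreover have "(U, s) \<in> germ T F x U s" "(U, t) \<in> germ T F x U t"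
    using U by (auto simp: germ_def)
  ultimately have "{germ T F x V (a \<otimes>\<^bsub>sec F V\<^esub> b) | V a b.
      (V, a) \<in> germ T F x U s \<and> (V, b) \<in> germ T F x U t} = {germ T F x U (s \<otimes>\<^bsub>sec F U\<^esub> t)}"
    by blast
  then show ?thesis by (simp add: stalk_def)
qed

section \<open>Complexes of sheaves\<close>

lemma cplx_sheaf: "complex_of_sheaves T K \<Longrightarrow> sheaf T (trm K n)"
  and cplx_presheaf: "complex_of_sheaves T K \<Longrightarrow> presheaf T (trm K n)"
  and cplx_dif: "complex_of_sheaves T K \<Longrightarrow> psh_mor T (trm K n) (trm K (n + 1)) (dif K n)"
  and cplx_dif_dif: "complex_of_sheaves T K \<Longrightarrow> openin T U \<Longrightarrow> s \<in> carrier (sec (trm K n) U) \<Longrightarrow>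
    dif K (n + 1) U (dif K n U s) = \<one>\<^bsub>sec (trm K (n + 2)) U\<^esub>"
  by (auto simp: complex_of_sheaves_def sheaf_def)

lemma cplx_dif_pred:
  "complex_of_sheaves T K \<Longrightarrow> psh_mor T (trm K (n - 1)) (trm K n) (dif K (n - 1))"
  using cplx_dif[of T K "n - 1"] by simp

lemma cplx_dif_dif_pred:
  "complex_of_sheaves T K \<Longrightarrow> openin T U \<Longrightarrow> s \<in> carrier (sec (trm K (n - 1)) U) \<Longrightarrow>
    dif K n U (dif K (n - 1) U s) = \<one>\<^bsub>sec (trm K (n + 1)) U\<^esub>"
  using cplx_dif_dif[of T K U s "n - 1"] by (simp add: algebra_simps)

definition chain_map :: "'p topology \<Rightarrow> 'p cplx \<Rightarrow> (int \<Rightarrow> 'p smor) \<Rightarrow> 'p cplx \<Rightarrow> bool" where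
  "chain_map T K \<phi> L \<longleftrightarrow> complex_of_sheaves T K \<and> complex_of_sheaves T L \<and>
     (\<forall>n. psh_mor T (trm K n) (trm L n) (\<phi> n) \<and>
       (\<forall>U. openin T U \<longrightarrow> (\<forall>s\<in>carrier (sec (trm K n) U).
          \<phi> (n + 1) U (dif K n U s) = dif L n U (\<phi> n U s))))"

lemma chain_map_mor: "chain_map T K \<phi> L \<Longrightarrow> psh_mor T (trm K n) (trm L n) (\<phi> n)"
  and chain_map_dif: "chain_map T K \<phi> L \<Longrightarrow> openin T U \<Longrightarrow> s \<in> carrier (sec (trm K n) U) \<Longrightarrow>
    \<phi> (n + 1) U (dif K n U s) = dif L n U (\<phi> n U s)"
  and chain_map_cplx: "chain_map T K \<phi> L \<Longrightarrow> complex_of_sheaves T K"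
    "chain_map T K \<phi> L \<Longrightarrow> complex_of_sheaves T L"
  by (auto simp: chain_map_def)

lemma Ch_simps [simp]:
  "K \<in> ob (Ch T) \<longleftrightarrow> complex_of_sheaves T K"
  "(K, \<phi>, L) \<in> arr (Ch T) \<longleftrightarrow> chain_map T K \<phi> L"
  "src (Ch T) = fst" "tgt (Ch T) f = snd (snd f)"
  "idt (Ch T) K = (K, \<lambda>n. psh_id T (trm K n), K)"
  "cmp (Ch T) (L', \<psi>, M) (K, \<phi>, L) = (K, \<lambda>n. psh_comp T (trm K n) (\<psi> n) (\<phi> n), M)"
  by (auto simp: Ch_def chain_map_def)

lemma Hom_Ch: "f \<in> Hom (Ch T) K L \<longleftrightarrow> (\<exists>\<phi>. f = (K, \<phi>, L) \<and> chain_map T K \<phi> L)"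
  by (cases f) (auto simp: Hom_def)

lemma chain_map_comp:
  assumes f: "chain_map T K \<phi> L" and g: "chain_map T L \<psi> M"
  shows "chain_map T K (\<lambda>n. psh_comp T (trm K n) (\<psi> n) (\<phi> n)) M"
  unfolding chain_map_def
proof (intro conjI allI impI ballI)
  fix n show "psh_mor T (trm K n) (trm M n) (psh_comp T (trm K n) (\<psi> n) (\<phi> n))"
    using chain_map_mor[OF f] chain_map_mor[OF g] cplx_presheaf[OF chain_map_cplx(1)[OF f]]
    by (rule psh_comp_mor)
  fix U s assume U: "openin T U" and s: "s \<in> carrier (sec (trm K n) U)"
  then show "psh_comp T (trm K (n + 1)) (\<psi> (n + 1)) (\<phi> (n + 1)) U (dif K n U s)
      = dif M n U (psh_comp T (trm K n) (\<psi> n) (\<phi> n) U s)"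
    using psh_mor_closed[OF cplx_dif[OF chain_map_cplx(1)[OF f]] U s] chain_map_dif[OF f U s]
      chain_map_dif[OF g U psh_mor_closed[OF chain_map_mor[OF f] U s]] by simp
qed (use chain_map_cplx f g in auto)

lemma chain_map_id: "complex_of_sheaves T K \<Longrightarrow> chain_map T K (\<lambda>n. psh_id T (trm K n)) K"
  unfolding chain_map_def by (auto simp: psh_id_mor cplx_presheaf psh_mor_closed[OF cplx_dif])

lemma category_Ch: "category (Ch T)"
  unfolding category_def
proof (intro conjI ballI impI)
  fix f assume "f \<in> arr (Ch T)"
  then obtain K \<phi> L where f: "f = (K, \<phi>, L)" "chain_map T K \<phi> L" by (cases f) auto
  show "src (Ch T) f \<in> ob (Ch T)" "tgt (Ch T) f \<in> ob (Ch T)"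
    using f chain_map_cplx by auto
  show "cmp (Ch T) f (idt (Ch T) (src (Ch T) f)) = f"
    using psh_mor_eqI[OF psh_comp_mor[OF psh_id_mor chain_map_mor[OF f(2)]] chain_map_mor[OF f(2)]]
      cplx_presheaf[OF chain_map_cplx(1)[OF f(2)]] by (simp add: f(1))
  show "cmp (Ch T) (idt (Ch T) (tgt (Ch T) f)) f = f"
    using psh_mor_eqI[OF psh_comp_mor[OF chain_map_mor[OF f(2)] psh_id_mor] chain_map_mor[OF f(2)]]
      cplx_presheaf[OF chain_map_cplx(1)[OF f(2)]] cplx_presheaf[OF chain_map_cplx(2)[OF f(2)]]
      psh_mor_closed[OF chain_map_mor[OF f(2)]] by (simp add: f(1))
  fix g assume "g \<in> arr (Ch T)" "src (Ch T) g = tgt (Ch T) f"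
  then obtain \<psi> M where g: "g = (L, \<psi>, M)" "chain_map T L \<psi> M" using f by (cases g) auto
  show "cmp (Ch T) g f \<in> Hom (Ch T) (src (Ch T) f) (tgt (Ch T) g)"
    using chain_map_comp[OF f(2) g(2)] by (auto simp: f(1) g(1) Hom_Ch)
  fix h assume "h \<in> arr (Ch T)" "src (Ch T) h = tgt (Ch T) g"
  then obtain \<theta> N where h: "h = (M, \<theta>, N)" "chain_map T M \<theta> N" using g by (cases h) auto
  have "psh_comp T (trm K n) (\<theta> n) (psh_comp T (trm K n) (\<psi> n) (\<phi> n))
      = psh_comp T (trm K n) (psh_comp T (trm L n) (\<theta> n) (\<psi> n)) (\<phi> n)" for n
    unfolding psh_comp_def using psh_mor_closed[OF chain_map_mor[OF f(2)]]
    by (intro on_opens_cong) simp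
  then show "cmp (Ch T) h (cmp (Ch T) g f) = cmp (Ch T) (cmp (Ch T) h g) f"
    by (simp add: f(1) g(1) h(1))
qed (use chain_map_id in \<open>auto simp: Hom_Ch\<close>)

text \<open>Supplies the side condition on identities under which functors pass to the localization:
  \<open>idt (Ch T)\<close> forms a triple from every record, but only complexes turn it into an
  arrow.\<close>

lemma idt_Ch_arr: "\<forall>K. idt (Ch T) K \<in> arr (Ch T) \<longrightarrow> K \<in> ob (Ch T)"
  by (auto simp: chain_map_def)

lemma category_Der: "category (Der T)"
  unfolding Der_def by (intro category_localization category_Ch)

section \<open>Cohomology presheaves of a complex\<close>

definition cocycles :: "'p cplx \<Rightarrow> int \<Rightarrow> 'p set \<Rightarrow> 'p sec set" where
  "cocycles K n U = {s \<in> carrier (sec (trm K n) U). dif K n U s = \<one>\<^bsub>sec (trm K (n + 1)) U\<^esub>}"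

definition cohom_class :: "'p cplx \<Rightarrow> int \<Rightarrow> 'p set \<Rightarrow> 'p sec \<Rightarrow> 'p sec set" where
  "cohom_class K n U s = coboundaries_of K n U #>\<^bsub>sec (trm K n) U\<^esub> s"

lemma sec_cohomology:
  "sec (cohomology_psh K n) U = (sec (trm K n) U)\<lparr>carrier := cocycles K n U\<rparr> Mod coboundaries_of K n U"
  by (simp add: cohomology_psh_def cocycles_def kernel_def)

lemma carrier_cohomology:
  "carrier (sec (cohomology_psh K n) U) = cohom_class K n U ` cocycles K n U"
  by (simp add: sec_cohomology carrier_FactGroup cohom_class_def[abs_def])

lemma cocycles_carrier: "s \<in> cocycles K n U \<Longrightarrow> s \<in> carrier (sec (trm K n) U)"
  by (simp add: cocycles_def)

lemma group_hom_psh_mor: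
  "psh_mor T F G \<phi> \<Longrightarrow> presheaf T F \<Longrightarrow> presheaf T G \<Longrightarrow> openin T U \<Longrightarrow>
    group_hom (sec F U) (sec G U) (\<phi> U)"
  by (simp add: group_hom_def group_hom_axioms_def psh_mor_hom presheaf_group)

lemma group_hom_rst:
  "presheaf T F \<Longrightarrow> openin T U \<Longrightarrow> openin T V \<Longrightarrow> V \<subseteq> U \<Longrightarrow>
    group_hom (sec F U) (sec F V) (rst F U V)"
  by (simp add: group_hom_def group_hom_axioms_def rst_hom presheaf_group)

lemma subgroup_cocycles:
  assumes "complex_of_sheaves T K" "openin T U"
  shows "subgroup (cocycles K n U) (sec (trm K n) U)"
  using group_hom.subgroup_kernel[OF group_hom_psh_mor[OF cplx_dif]] assms cplx_presheaf
  by (fastforce simp: cocycles_def kernel_def)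

lemma subgroup_coboundaries:
  assumes "complex_of_sheaves T K" "openin T U"
  shows "subgroup (coboundaries_of K n U) (sec (trm K n) U)"
  unfolding coboundaries_of_def using assms
  by (intro group_hom.img_is_subgroup[OF group_hom_psh_mor[OF cplx_dif_pred]] cplx_presheaf)

lemma coboundaries_subset_cocycles:
  assumes "complex_of_sheaves T K" "openin T U"
  shows "coboundaries_of K n U \<subseteq> cocycles K n U"
  using assms psh_mor_closed[OF cplx_dif_pred] cplx_dif_dif_pred
  by (fastforce simp: coboundaries_of_def cocycles_def)

lemma comm_group_subgroup:
  assumes "comm_group G" "subgroup H G"
  shows "comm_group (G\<lparr>carrier := H\<rparr>)"
proof -
  interpret comm_group G by fact
  show ?thesis
    using assms(2) subgroup_imp_group[OF assms(2)]
    by (intro group.group_comm_groupI) (auto intro: m_comm subgroup.mem_carrier)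
qed

lemma subgroup_coboundaries_cocycles:
  assumes "complex_of_sheaves T K" "openin T U"
  shows "subgroup (coboundaries_of K n U) ((sec (trm K n) U)\<lparr>carrier := cocycles K n U\<rparr>)"
  using assms
  by (intro group.subgroup_incl presheaf_group subgroup_coboundaries subgroup_cocycles
      coboundaries_subset_cocycles) (auto intro: cplx_presheaf)

lemma comm_group_cocycles:
  assumes "complex_of_sheaves T K" "openin T U"
  shows "comm_group ((sec (trm K n) U)\<lparr>carrier := cocycles K n U\<rparr>)"
  using assms by (intro comm_group_subgroup subgroup_cocycles presheaf_comm_group cplx_presheaf)

lemma comm_group_cohomology:
  assumes "complex_of_sheaves T K" "openin T U"
  shows "comm_group (sec (cohomology_psh K n) U)"
  unfolding sec_cohomology using assms
  by (intro comm_group.abelian_FactGroup comm_group_cocycles subgroup_coboundaries_cocycles)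

lemma cohom_class_eq_iff:
  assumes K: "complex_of_sheaves T K" and U: "openin T U"
    and s: "s \<in> carrier (sec (trm K n) U)" and t: "t \<in> carrier (sec (trm K n) U)"
  shows "cohom_class K n U s = cohom_class K n U t \<longleftrightarrow>
    (\<exists>b\<in>coboundaries_of K n U. t = b \<otimes>\<^bsub>sec (trm K n) U\<^esub> s)"
proof -
  interpret group "sec (trm K n) U" using presheaf_group[OF cplx_presheaf[OF K] U] .
  have B: "subgroup (coboundaries_of K n U) (sec (trm K n) U)" using subgroup_coboundaries[OF K U] .
  have "t \<in> coboundaries_of K n U #>\<^bsub>sec (trm K n) U\<^esub> s \<longleftrightarrow>
      (\<exists>b\<in>coboundaries_of K n U. t = b \<otimes>\<^bsub>sec (trm K n) U\<^esub> s)"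
    by (auto simp: r_coset_def)
  moreover have "t \<in> coboundaries_of K n U #>\<^bsub>sec (trm K n) U\<^esub> t" using rcos_self[OF t B] .
  ultimately show ?thesis
    using repr_independence[OF _ s B, of t] by (auto simp: cohom_class_def)
qed

text \<open>Restriction and induced maps on cohomology are written as unions of cosets over all
  members of a coset. Since \<open>h\<close> sends \<open>A\<close> into \<open>B\<close>, changing
  the representative by \<open>A\<close> changes the image by \<open>B\<close>, so all these cosets
  coincide. The lemma serves both kinds of map.\<close>

lemma Union_rcosets_hom:
  assumes h: "group_hom G H h" and A: "subgroup A G" and B: "subgroup B H" and AB: "h ` A \<subseteq> B"
    and s: "s \<in> carrier G"
  shows "(\<Union>t\<in>A #>\<^bsub>G\<^esub> s. B #>\<^bsub>H\<^esub> h t) = B #>\<^bsub>H\<^esub> h s"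
proof -
  interpret group_hom G H h by fact
  have "B #>\<^bsub>H\<^esub> h t = B #>\<^bsub>H\<^esub> h s" if t: "t \<in> A #>\<^bsub>G\<^esub> s" for t
  proof -
    obtain a where a: "a \<in> A" "t = a \<otimes>\<^bsub>G\<^esub> s" using t by (auto simp: r_coset_def)
    then have "h t \<in> B #>\<^bsub>H\<^esub> h s" using A AB s subgroup.mem_carrier[OF A] by (auto simp: r_coset_def)
    then show ?thesis using H.repr_independence[OF _ _ B] s by simp
  qed
  moreover have "s \<in> A #>\<^bsub>G\<^esub> s" using G.rcos_self[OF s A] .
  ultimately show ?thesis by blast
qed

lemma rst_coboundaries:
  assumes K: "complex_of_sheaves T K" and U: "openin T U" and V: "openin T V" "V \<subseteq> U"
  shows "rst (trm K n) U V ` coboundaries_of K n U \<subseteq> coboundaries_of K n V"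
proof
  fix b assume "b \<in> rst (trm K n) U V ` coboundaries_of K n U"
  then obtain a where a: "a \<in> carrier (sec (trm K (n - 1)) U)"
    "b = rst (trm K n) U V (dif K (n - 1) U a)"
    by (auto simp: coboundaries_of_def)
  then show "b \<in> coboundaries_of K n V"
    using psh_mor_rst[OF cplx_dif_pred[OF K] U V a(1)] rst_closed[OF cplx_presheaf[OF K] U V a(1)]
    by (auto simp: coboundaries_of_def image_iff intro!: bexI)
qed

lemma rst_cocycles:
  assumes K: "complex_of_sheaves T K" and U: "openin T U" and V: "openin T V" "V \<subseteq> U"
    and s: "s \<in> cocycles K n U"
  shows "rst (trm K n) U V s \<in> cocycles K n V"
  using s psh_mor_rst[OF cplx_dif[OF K] U V] rst_closed[OF cplx_presheaf[OF K] U V]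
    rst_one[OF cplx_presheaf[OF K] U V]
  by (auto simp: cocycles_def)

lemma rst_cohom_class:
  assumes K: "complex_of_sheaves T K" and U: "openin T U" and V: "openin T V" "V \<subseteq> U"
    and s: "s \<in> carrier (sec (trm K n) U)"
  shows "rst (cohomology_psh K n) U V (cohom_class K n U s) = cohom_class K n V (rst (trm K n) U V s)"
  using Union_rcosets_hom[OF group_hom_rst[OF cplx_presheaf[OF K] U V] subgroup_coboundaries[OF K U]
      subgroup_coboundaries[OF K V(1)] rst_coboundaries[OF K U V] s]
  by (simp add: cohom_class_def cohomology_psh_def)

lemma mult_cohom_class:
  assumes K: "complex_of_sheaves T K" and U: "openin T U"
    and s: "s \<in> cocycles K n U" and t: "t \<in> cocycles K n U"
  shows "cohom_class K n U s \<otimes>\<^bsub>sec (cohomology_psh K n) U\<^esub> cohom_class K n U t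
    = cohom_class K n U (s \<otimes>\<^bsub>sec (trm K n) U\<^esub> t)"
  using normal.rcos_sum[OF comm_group.subgroup_imp_normal[OF comm_group_cocycles[OF K U]
        subgroup_coboundaries_cocycles[OF K U]], of s n t] s t
  by (simp add: sec_cohomology cohom_class_def)

lemma presheaf_cohomology:
  assumes K: "complex_of_sheaves T K"
  shows "presheaf T (cohomology_psh K n)"
  unfolding presheaf_def
proof (intro conjI allI impI ballI)
  note P = cplx_presheaf[OF K]
  fix U assume U: "openin T U"
  show "comm_group (sec (cohomology_psh K n) U)" using comm_group_cohomology[OF K U] .
  show "rst (cohomology_psh K n) U U s = s" if "s \<in> carrier (sec (cohomology_psh K n) U)" for s
    using that rst_cohom_class[OF K U U] cocycles_carrier rst_id[OF P U]
    by (force simp: carrier_cohomology)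
  fix V assume V: "openin T V" "V \<subseteq> U"
  show "rst (cohomology_psh K n) U V \<in> hom (sec (cohomology_psh K n) U) (sec (cohomology_psh K n) V)"
  proof (rule homI)
    fix a b assume "a \<in> carrier (sec (cohomology_psh K n) U)" "b \<in> carrier (sec (cohomology_psh K n) U)"
    then obtain s t where a: "a = cohom_class K n U s" "s \<in> cocycles K n U"
      and b: "b = cohom_class K n U t" "t \<in> cocycles K n U"
      by (auto simp: carrier_cohomology)
    show "rst (cohomology_psh K n) U V a \<in> carrier (sec (cohomology_psh K n) V)"
      using rst_cocycles[OF K U V a(2)]
      by (simp add: a(1) rst_cohom_class[OF K U V] cocycles_carrier[OF a(2)] carrier_cohomology)
    have st: "s \<otimes>\<^bsub>sec (trm K n) U\<^esub> t \<in> cocycles K n U"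
      using a b subgroup.m_closed[OF subgroup_cocycles[OF K U]] by blast
    show "rst (cohomology_psh K n) U V (a \<otimes>\<^bsub>sec (cohomology_psh K n) U\<^esub> b) =
        rst (cohomology_psh K n) U V a \<otimes>\<^bsub>sec (cohomology_psh K n) V\<^esub> rst (cohomology_psh K n) U V b"
      using a b st by (simp add: mult_cohom_class[OF K U] mult_cohom_class[OF K V(1)]
          rst_cohom_class[OF K U V] cocycles_carrier rst_cocycles[OF K U V] rst_mult[OF P U V])
  qed
  fix W s assume W: "openin T W" "W \<subseteq> V" and "s \<in> carrier (sec (cohomology_psh K n) U)"
  then obtain t where t: "s = cohom_class K n U t" "t \<in> carrier (sec (trm K n) U)"
    by (auto simp: carrier_cohomology cocycles_carrier)
  then show "rst (cohomology_psh K n) V W (rst (cohomology_psh K n) U V s)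
      = rst (cohomology_psh K n) U W s"
    using rst_closed[OF P U V t(2)] rst_rst[OF P U V(1) W(1) V(2) W(2) t(2)] W V
    by (simp add: rst_cohom_class[OF K U] rst_cohom_class[OF K V(1) W])
qed

lemma chain_map_coboundaries:
  assumes f: "chain_map T K \<phi> L" and U: "openin T U"
  shows "\<phi> n U ` coboundaries_of K n U \<subseteq> coboundaries_of L n U"
  using chain_map_dif[OF f U, of _ "n - 1"] psh_mor_closed[OF chain_map_mor[OF f] U]
  by (auto simp: coboundaries_of_def)

lemma chain_map_cocycles:
  assumes f: "chain_map T K \<phi> L" and U: "openin T U" and s: "s \<in> cocycles K n U"
  shows "\<phi> n U s \<in> cocycles L n U"
proof -
  have "dif L n U (\<phi> n U s) = \<phi> (n + 1) U (dif K n U s)"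
    using chain_map_dif[OF f U cocycles_carrier[OF s]] by simp
  also have "\<dots> = \<one>\<^bsub>sec (trm L (n + 1)) U\<^esub>"
    using s psh_mor_one[OF chain_map_mor[OF f] cplx_presheaf cplx_presheaf U] chain_map_cplx[OF f]
    by (simp add: cocycles_def)
  finally show ?thesis
    using psh_mor_closed[OF chain_map_mor[OF f] U cocycles_carrier[OF s]] by (simp add: cocycles_def)
qed

lemma cohomology_mor_class:
  assumes f: "chain_map T K \<phi> L" and U: "openin T U" and s: "s \<in> carrier (sec (trm K n) U)"
  shows "cohomology_mor (K, \<phi>, L) n U (cohom_class K n U s) = cohom_class L n U (\<phi> n U s)"
proof -
  have K: "complex_of_sheaves T K" and L: "complex_of_sheaves T L" using chain_map_cplx[OF f] by auto
  show ?thesis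
    using Union_rcosets_hom[OF group_hom_psh_mor[OF chain_map_mor[OF f] cplx_presheaf[OF K]
          cplx_presheaf[OF L] U] subgroup_coboundaries[OF K U] subgroup_coboundaries[OF L U]
        chain_map_coboundaries[OF f U] s]
    by (simp add: cohom_class_def cohomology_mor_def)
qed

lemma presheaf_map_cohomology_mor:
  assumes f: "chain_map T K \<phi> L"
  shows "presheaf_map T (cohomology_psh K n) (cohomology_psh L n) (cohomology_mor (K, \<phi>, L) n)"
  unfolding presheaf_map_def
proof (intro conjI allI impI)
  have K: "complex_of_sheaves T K" and L: "complex_of_sheaves T L" using chain_map_cplx[OF f] by auto
  fix U s assume U: "openin T U" and "s \<in> carrier (sec (cohomology_psh K n) U)"
  then obtain t where t: "s = cohom_class K n U t" "t \<in> cocycles K n U"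
    by (auto simp: carrier_cohomology)
  show "cohomology_mor (K, \<phi>, L) n U s \<in> carrier (sec (cohomology_psh L n) U)"
    using t chain_map_cocycles[OF f U t(2)]
    by (simp add: cohomology_mor_class[OF f U] cocycles_carrier carrier_cohomology)
  fix V assume V: "openin T V" "V \<subseteq> U"
  show "cohomology_mor (K, \<phi>, L) n V (rst (cohomology_psh K n) U V s)
      = rst (cohomology_psh L n) U V (cohomology_mor (K, \<phi>, L) n U s)"
    using t chain_map_cocycles[OF f U t(2)] rst_cocycles[OF K U V t(2)]
      psh_mor_rst[OF chain_map_mor[OF f] U V cocycles_carrier[OF t(2)]]
    by (simp add: cohomology_mor_class[OF f U] cohomology_mor_class[OF f V(1)] cocycles_carrier
        rst_cohom_class[OF K U V] rst_cohom_class[OF L U V])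
qed

text \<open>Bijectivity on the stalk of cohomology at \<open>x\<close>, stated for sections instead of germs of cosets.\<close>

definition local_qis :: "'p topology \<Rightarrow> 'p cplx \<Rightarrow> (int \<Rightarrow> 'p smor) \<Rightarrow> 'p cplx \<Rightarrow> int \<Rightarrow> 'p \<Rightarrow> bool" where
  "local_qis T K \<phi> L n x \<longleftrightarrow>
     (\<forall>U s. openin T U \<longrightarrow> x \<in> U \<longrightarrow> s \<in> cocycles K n U \<longrightarrow> \<phi> n U s \<in> coboundaries_of L n U \<longrightarrow>
       (\<exists>W. openin T W \<and> x \<in> W \<and> W \<subseteq> U \<and> rst (trm K n) U W s \<in> coboundaries_of K n W)) \<and>
     (\<forall>U t. openin T U \<longrightarrow> x \<in> U \<longrightarrow> t \<in> cocycles L n U \<longrightarrow>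
       (\<exists>W s. openin T W \<and> x \<in> W \<and> W \<subseteq> U \<and> s \<in> cocycles K n W \<and>
         (\<exists>b\<in>coboundaries_of L n W. rst (trm L n) U W t = b \<otimes>\<^bsub>sec (trm L n) W\<^esub> \<phi> n W s)))"

text \<open>Two classes with equal images are compared by applying the kernel condition to the
  quotient of their representatives; here the group structure is added to the criterion for bare
  maps of presheaves. For surjectivity only the equality of cosets is unfolded.\<close>

lemma stalk_map_bij_iff_local_qis:
  assumes f: "chain_map T K \<phi> L"
  shows "bij_betw (stalk_map T (cohomology_psh L n) (cohomology_mor (K, \<phi>, L) n) x)
       (carrier (stalk T (cohomology_psh K n) x)) (carrier (stalk T (cohomology_psh L n) x))
    \<longleftrightarrow> local_qis T K \<phi> L n x"
proof -
  have K: "complex_of_sheaves T K" and L: "complex_of_sheaves T L" using chain_map_cplx[OF f] by auto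
  note PK = cplx_presheaf[OF K] and PL = cplx_presheaf[OF L]
  have inj: "(\<forall>U s t. openin T U \<longrightarrow> x \<in> U \<longrightarrow> s \<in> carrier (sec (cohomology_psh K n) U) \<longrightarrow>
       t \<in> carrier (sec (cohomology_psh K n) U) \<longrightarrow>
       cohomology_mor (K, \<phi>, L) n U s = cohomology_mor (K, \<phi>, L) n U t \<longrightarrow>
       (\<exists>W. openin T W \<and> x \<in> W \<and> W \<subseteq> U \<and>
         rst (cohomology_psh K n) U W s = rst (cohomology_psh K n) U W t)) \<longleftrightarrow>
     (\<forall>U s. openin T U \<longrightarrow> x \<in> U \<longrightarrow> s \<in> cocycles K n U \<longrightarrow> \<phi> n U s \<in> coboundaries_of L n U \<longrightarrow>
       (\<exists>W. openin T W \<and> x \<in> W \<and> W \<subseteq> U \<and> rst (trm K n) U W s \<in> coboundaries_of K n W))"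
    (is "?A \<longleftrightarrow> ?B")
  proof
    assume A: ?A
    show ?B
    proof (intro allI impI)
      fix U s assume U: "openin T U" "x \<in> U" and s: "s \<in> cocycles K n U"
        and b: "\<phi> n U s \<in> coboundaries_of L n U"
      let ?e = "\<one>\<^bsub>sec (trm K n) U\<^esub>"
      interpret GK: group "sec (trm K n) U" using presheaf_group[OF PK U(1)] .
      interpret GL: group "sec (trm L n) U" using presheaf_group[OF PL U(1)] .
      \<comment> \<open>Lying in the kernel means having the same image as the neutral class, so the
        injectivity condition is used for \<open>?e\<close> and \<open>s\<close>.\<close>
      have e: "?e \<in> cocycles K n U" using subgroup.one_closed[OF subgroup_cocycles[OF K U(1)]] .
      have ps: "\<phi> n U s \<in> carrier (sec (trm L n) U)"
        using psh_mor_closed[OF chain_map_mor[OF f] U(1) cocycles_carrier[OF s]] .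
      have "cohom_class L n U (\<phi> n U ?e) = cohom_class L n U (\<phi> n U s)"
        using b ps psh_mor_one[OF chain_map_mor[OF f] PK PL U(1), of n]
        by (simp add: cohom_class_eq_iff[OF L U(1)] bexI[of _ "\<phi> n U s"])
      then have "cohomology_mor (K, \<phi>, L) n U (cohom_class K n U ?e)
          = cohomology_mor (K, \<phi>, L) n U (cohom_class K n U s)"
        using s e by (simp add: cohomology_mor_class[OF f U(1)] cocycles_carrier)
      then obtain W where W: "openin T W" "x \<in> W" "W \<subseteq> U"
        "rst (cohomology_psh K n) U W (cohom_class K n U ?e)
          = rst (cohomology_psh K n) U W (cohom_class K n U s)"
        using A[rule_format, OF U, of "cohom_class K n U ?e" "cohom_class K n U s"] s e
        by (auto simp: carrier_cohomology)
      interpret GW: group "sec (trm K n) W" using presheaf_group[OF PK W(1)] .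
      have "cohom_class K n W \<one>\<^bsub>sec (trm K n) W\<^esub> = cohom_class K n W (rst (trm K n) U W s)"
        using W s by (simp add: rst_cohom_class[OF K U(1) W(1,3)] cocycles_carrier
            rst_one[OF PK U(1) W(1,3)])
      then obtain c where "c \<in> coboundaries_of K n W"
        "rst (trm K n) U W s = c \<otimes>\<^bsub>sec (trm K n) W\<^esub> \<one>\<^bsub>sec (trm K n) W\<^esub>"
        using rst_closed[OF PK U(1) W(1,3) cocycles_carrier[OF s]]
        by (auto simp: cohom_class_eq_iff[OF K W(1)])
      then have "rst (trm K n) U W s \<in> coboundaries_of K n W"
        using subgroup.mem_carrier[OF subgroup_coboundaries[OF K W(1)]] by simp
      then show "\<exists>W. openin T W \<and> x \<in> W \<and> W \<subseteq> U \<and> rst (trm K n) U W s \<in> coboundaries_of K n W"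
        using W by blast
    qed
  next
    assume B: ?B
    show ?A
    proof (intro allI impI)
      fix U a b assume U: "openin T U" "x \<in> U" and "a \<in> carrier (sec (cohomology_psh K n) U)"
        and "b \<in> carrier (sec (cohomology_psh K n) U)"
        and eq: "cohomology_mor (K, \<phi>, L) n U a = cohomology_mor (K, \<phi>, L) n U b"
      then obtain s t where a: "a = cohom_class K n U s" "s \<in> cocycles K n U"
        and b: "b = cohom_class K n U t" "t \<in> cocycles K n U"
        by (auto simp: carrier_cohomology)
      interpret GK: group "sec (trm K n) U" using presheaf_group[OF PK U(1)] .
      interpret GL: group "sec (trm L n) U" using presheaf_group[OF PL U(1)] .
      interpret h: group_hom "sec (trm K n) U" "sec (trm L n) U" "\<phi> n U"
        using group_hom_psh_mor[OF chain_map_mor[OF f] PK PL U(1)] .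
      have s: "s \<in> carrier (sec (trm K n) U)" and t: "t \<in> carrier (sec (trm K n) U)"
        using a b cocycles_carrier by auto
      let ?r = "t \<otimes>\<^bsub>sec (trm K n) U\<^esub> inv\<^bsub>sec (trm K n) U\<^esub> s"
      have r: "?r \<in> cocycles K n U"
        using subgroup.m_closed subgroup.m_inv_closed subgroup_cocycles[OF K U(1)] a(2) b(2) by metis
      obtain c where c: "c \<in> coboundaries_of L n U"
        "\<phi> n U t = c \<otimes>\<^bsub>sec (trm L n) U\<^esub> \<phi> n U s"
        using eq a b s t by (auto simp: cohomology_mor_class[OF f U(1)] cohom_class_eq_iff[OF L U(1)])
      have "c \<in> carrier (sec (trm L n) U)"
        using subgroup.mem_carrier[OF subgroup_coboundaries[OF L U(1)] c(1)] .
      then have "\<phi> n U ?r = c" using s t c(2) by (simp add: GL.m_assoc)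
      then obtain W where W: "openin T W" "x \<in> W" "W \<subseteq> U"
        "rst (trm K n) U W ?r \<in> coboundaries_of K n W"
        using B[rule_format, OF U r] c by auto
      interpret GW: group "sec (trm K n) W" using presheaf_group[OF PK W(1)] .
      interpret hW: group_hom "sec (trm K n) U" "sec (trm K n) W" "rst (trm K n) U W"
        using group_hom_rst[OF PK U(1) W(1,3)] .
      have "rst (trm K n) U W t = rst (trm K n) U W ?r \<otimes>\<^bsub>sec (trm K n) W\<^esub> rst (trm K n) U W s"
        using s t by (simp add: GW.m_assoc)
      then have "cohom_class K n W (rst (trm K n) U W s) = cohom_class K n W (rst (trm K n) U W t)"
        using s t W(4) by (subst cohom_class_eq_iff[OF K W(1)]) auto
      then show "\<exists>W. openin T W \<and> x \<in> W \<and> W \<subseteq> U \<and>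
          rst (cohomology_psh K n) U W a = rst (cohomology_psh K n) U W b"
        using W a b s t by (auto simp: rst_cohom_class[OF K U(1)])
    qed
  qed
  have surj: "(\<forall>U t. openin T U \<longrightarrow> x \<in> U \<longrightarrow> t \<in> carrier (sec (cohomology_psh L n) U) \<longrightarrow>
      (\<exists>W s. openin T W \<and> x \<in> W \<and> W \<subseteq> U \<and> s \<in> carrier (sec (cohomology_psh K n) W) \<and>
        cohomology_mor (K, \<phi>, L) n W s = rst (cohomology_psh L n) U W t)) \<longleftrightarrow>
    (\<forall>U t. openin T U \<longrightarrow> x \<in> U \<longrightarrow> t \<in> cocycles L n U \<longrightarrow>
       (\<exists>W s. openin T W \<and> x \<in> W \<and> W \<subseteq> U \<and> s \<in> cocycles K n W \<and>
         (\<exists>b\<in>coboundaries_of L n W. rst (trm L n) U W t = b \<otimes>\<^bsub>sec (trm L n) W\<^esub> \<phi> n W s)))"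
    (is "?A \<longleftrightarrow> ?B")
  proof -
    have *: "cohomology_mor (K, \<phi>, L) n W (cohom_class K n W s)
        = rst (cohomology_psh L n) U W (cohom_class L n U t) \<longleftrightarrow>
        (\<exists>b\<in>coboundaries_of L n W. rst (trm L n) U W t = b \<otimes>\<^bsub>sec (trm L n) W\<^esub> \<phi> n W s)"
      if "openin T U" "t \<in> cocycles L n U" "openin T W" "W \<subseteq> U" "s \<in> cocycles K n W" for U t W s
      using that by (simp add: cohomology_mor_class[OF f] rst_cohom_class[OF L] cocycles_carrier
          cohom_class_eq_iff[OF L] psh_mor_closed[OF chain_map_mor[OF f]] rst_closed[OF PL])
    show ?thesis
    proof
      assume A: ?A
      show ?B
      proof (intro allI impI)
        fix U t assume U: "openin T U" "x \<in> U" and t: "t \<in> cocycles L n U"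
        then have "cohom_class L n U t \<in> carrier (sec (cohomology_psh L n) U)"
          by (simp add: carrier_cohomology)
        from A[rule_format, OF U this] obtain W s where W: "openin T W" "x \<in> W" "W \<subseteq> U"
          "s \<in> cocycles K n W" "cohomology_mor (K, \<phi>, L) n W (cohom_class K n W s)
            = rst (cohomology_psh L n) U W (cohom_class L n U t)"
          by (auto simp: carrier_cohomology)
        then show "\<exists>W s. openin T W \<and> x \<in> W \<and> W \<subseteq> U \<and> s \<in> cocycles K n W \<and>
           (\<exists>b\<in>coboundaries_of L n W. rst (trm L n) U W t = b \<otimes>\<^bsub>sec (trm L n) W\<^esub> \<phi> n W s)"
          using *[OF U(1) t W(1,3,4)] by blast
      qed
    next
      assume B: ?B
      show ?A
      proof (intro allI impI)
        fix U a assume U: "openin T U" "x \<in> U" and "a \<in> carrier (sec (cohomology_psh L n) U)"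
        then obtain t where t: "a = cohom_class L n U t" "t \<in> cocycles L n U"
          by (auto simp: carrier_cohomology)
        obtain W s where W: "openin T W" "x \<in> W" "W \<subseteq> U" "s \<in> cocycles K n W"
          "\<exists>b\<in>coboundaries_of L n W. rst (trm L n) U W t = b \<otimes>\<^bsub>sec (trm L n) W\<^esub> \<phi> n W s"
          using B[rule_format, OF U t(2)] by blast
        have "cohom_class K n W s \<in> carrier (sec (cohomology_psh K n) W)"
          using W by (simp add: carrier_cohomology)
        then show "\<exists>W s. openin T W \<and> x \<in> W \<and> W \<subseteq> U \<and> s \<in> carrier (sec (cohomology_psh K n) W) \<and>
            cohomology_mor (K, \<phi>, L) n W s = rst (cohomology_psh L n) U W a"
          using *[OF U(1) t(2) W(1,3,4)] W t(1) by blast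
      qed
    qed
  qed
  show ?thesis
    unfolding local_qis_def stalk_map_bij_iff[OF presheaf_cohomology[OF K] presheaf_cohomology[OF L]
        presheaf_map_cohomology_mor[OF f]] inj surj ..
qed

lemma quasi_isos_iff:
  "(K, \<phi>, L) \<in> quasi_isos T \<longleftrightarrow>
    chain_map T K \<phi> L \<and> (\<forall>n. \<forall>x\<in>topspace T. local_qis T K \<phi> L n x)"
  unfolding quasi_isos_def using stalk_map_bij_iff_local_qis by fastforce

section \<open>Shift, direct image and multiplication by integers\<close>

lemma functor_Ch_Der:
  assumes F: "is_functor (Ch T') (Ch T) F" and Q: "snd F ` quasi_isos T' \<subseteq> quasi_isos T"
  shows "is_functor (Der T') (Der T) (fst F, loc_map (Ch T) (quasi_isos T) F)"
    and "f \<in> Hom (Ch T') K L \<Longrightarrow>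
      loc_map (Ch T) (quasi_isos T) F (der_arr T' f) = der_arr T (snd F f)"
proof -
  have Q': "snd F ` (arr (Ch T') \<inter> quasi_isos T') \<subseteq> quasi_isos T" using Q by blast
  show "is_functor (Der T') (Der T) (fst F, loc_map (Ch T) (quasi_isos T) F)"
    unfolding Der_def by (rule functor_loc_map[OF category_Ch category_Ch F idt_Ch_arr Q'])
  show "loc_map (Ch T) (quasi_isos T) F (der_arr T' f) = der_arr T (snd F f)"
    if "f \<in> Hom (Ch T') K L"
    unfolding der_arr_def by (rule loc_map_loc_arr[OF category_Ch F idt_Ch_arr Q' that])
qed

lemma cshift_simps [simp]:
  "trm (fst (cshift T) K) n = trm K (n + 1)"
  "snd (cshift T) (K, \<phi>, L) = (fst (cshift T) K, \<lambda>n. \<phi> (n + 1), fst (cshift T) L)"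
  by (auto simp: cshift_def Let_def)

lemma dif_cshift [simp]:
  assumes "openin T U" "s \<in> carrier (sec (trm K (n + 1)) U)"
  shows "dif (fst (cshift T) K) n U s = inv\<^bsub>sec (trm K (n + 2)) U\<^esub> (dif K (n + 1) U s)"
  using assms by (simp add: cshift_def Let_def)

lemma complex_cshift:
  assumes K: "complex_of_sheaves T K"
  shows "complex_of_sheaves T (fst (cshift T) K)"
  unfolding complex_of_sheaves_def
proof (intro conjI allI impI ballI)
  note P = cplx_presheaf[OF K]
  fix n
  show "sheaf T (trm (fst (cshift T) K) n)" using cplx_sheaf[OF K] by simp
  have d: "psh_mor T (trm K (n + 1)) (trm K (n + 2)) (dif K (n + 1))" for n
    using cplx_dif[OF K, of "n + 1"] by (simp add: algebra_simps)
  have m: "psh_mor T (trm K (n + 1)) (trm K (n + 2))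
      (on_opens T (trm K (n + 1)) (\<lambda>U s. inv\<^bsub>sec (trm K (n + 2)) U\<^esub> (dif K (n + 1) U s)))" for n
  proof (rule psh_morI)
    fix U s assume U: "openin T U" and s: "s \<in> carrier (sec (trm K (n + 1)) U)"
    interpret comm_group "sec (trm K (n + 2)) U" using presheaf_comm_group[OF P U] .
    note ds = psh_mor_closed[OF d U s]
    show "inv\<^bsub>sec (trm K (n + 2)) U\<^esub> dif K (n + 1) U s \<in> carrier (sec (trm K (n + 2)) U)"
      using ds by simp
    show "inv\<^bsub>sec (trm K (n + 2)) U\<^esub> dif K (n + 1) U (s \<otimes>\<^bsub>sec (trm K (n + 1)) U\<^esub> t) =
        inv\<^bsub>sec (trm K (n + 2)) U\<^esub> dif K (n + 1) U s \<otimes>\<^bsub>sec (trm K (n + 2)) U\<^esub>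
        inv\<^bsub>sec (trm K (n + 2)) U\<^esub> dif K (n + 1) U t"
      if t: "t \<in> carrier (sec (trm K (n + 1)) U)" for t
      using psh_mor_closed[OF d U t] ds by (simp add: psh_mor_mult[OF d U s t] inv_mult)
    fix V assume V: "openin T V" "V \<subseteq> U"
    show "inv\<^bsub>sec (trm K (n + 2)) V\<^esub> dif K (n + 1) V (rst (trm K (n + 1)) U V s) =
        rst (trm K (n + 2)) U V (inv\<^bsub>sec (trm K (n + 2)) U\<^esub> dif K (n + 1) U s)"
      using ds group_hom.hom_inv[OF group_hom_rst[OF P U V]] by (simp add: psh_mor_rst[OF d U V s])
  qed (rule P)
  show "psh_mor T (trm (fst (cshift T) K) n) (trm (fst (cshift T) K) (n + 1)) (dif (fst (cshift T) K) n)"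
    using m[of n] by (simp add: cshift_def Let_def algebra_simps)
  fix U s assume U: "openin T U" and s: "s \<in> carrier (sec (trm (fst (cshift T) K) n) U)"
  interpret h: group_hom "sec (trm K (n + 2)) U" "sec (trm K (n + 3)) U" "dif K (n + 2) U"
    using group_hom_psh_mor[OF d[of "n + 1"] P P U] by (simp add: algebra_simps)
  have s': "s \<in> carrier (sec (trm K (n + 1)) U)" using s by simp
  have "dif K (n + 2) U (dif K (n + 1) U s) = \<one>\<^bsub>sec (trm K (n + 3)) U\<^esub>"
    using cplx_dif_dif[OF K U s'] by (simp add: algebra_simps)
  then show "dif (fst (cshift T) K) (n + 1) U (dif (fst (cshift T) K) n U s)
      = \<one>\<^bsub>sec (trm (fst (cshift T) K) (n + 2)) U\<^esub>"
    using U s' psh_mor_closed[OF d U s'] by (simp add: algebra_simps)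
qed

lemma functor_cshift: "is_functor (Ch T) (Ch T) (cshift T)"
proof -
  have f: "chain_map T (fst (cshift T) K) (\<lambda>n. \<phi> (n + 1)) (fst (cshift T) L)"
    if f: "chain_map T K \<phi> L" for K \<phi> L
    unfolding chain_map_def
  proof (intro conjI allI impI ballI)
    note K = chain_map_cplx(1)[OF f] and L = chain_map_cplx(2)[OF f]
    fix n
    show "psh_mor T (trm (fst (cshift T) K) n) (trm (fst (cshift T) L) n) (\<phi> (n + 1))"
      using chain_map_mor[OF f] by simp
    fix U s assume U: "openin T U" and "s \<in> carrier (sec (trm (fst (cshift T) K) n) U)"
    then have s: "s \<in> carrier (sec (trm K (n + 1)) U)" by simp
    have ds: "dif K (n + 1) U s \<in> carrier (sec (trm K (n + 2)) U)"
      using psh_mor_closed[OF cplx_dif[OF K] U s] by (simp add: algebra_simps)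
    have "\<phi> (n + 2) U (inv\<^bsub>sec (trm K (n + 2)) U\<^esub> dif K (n + 1) U s)
        = inv\<^bsub>sec (trm L (n + 2)) U\<^esub> (\<phi> (n + 2) U (dif K (n + 1) U s))"
      using group_hom.hom_inv[OF group_hom_psh_mor[OF chain_map_mor[OF f] cplx_presheaf[OF K]
            cplx_presheaf[OF L] U] ds] .
    then show "\<phi> (n + 1 + 1) U (dif (fst (cshift T) K) n U s)
        = dif (fst (cshift T) L) n U (\<phi> (n + 1) U s)"
      using chain_map_dif[OF f U s] psh_mor_closed[OF chain_map_mor[OF f] U s] U s
      by (simp add: algebra_simps)
  qed (use complex_cshift chain_map_cplx[OF f] in auto)
  show ?thesis
    unfolding is_functor_def
  proof (intro conjI ballI impI)
    fix f g assume "f \<in> arr (Ch T)" "g \<in> arr (Ch T)"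
    then show "snd (cshift T) (cmp (Ch T) g f) = cmp (Ch T) (snd (cshift T) g) (snd (cshift T) f)"
      by (cases f; cases g) simp
  next
    fix h assume "h \<in> arr (Ch T)"
    then show "snd (cshift T) h \<in> Hom (Ch T) (fst (cshift T) (src (Ch T) h)) (fst (cshift T) (tgt (Ch T) h))"
      using f by (cases h) (auto simp: Hom_Ch)
  qed (auto simp: complex_cshift)
qed

lemma cocycles_cshift:
  assumes K: "complex_of_sheaves T K" and U: "openin T U"
  shows "cocycles (fst (cshift T) K) n U = cocycles K (n + 1) U"
proof -
  interpret group "sec (trm K (n + 2)) U" using presheaf_group[OF cplx_presheaf[OF K] U] .
  show ?thesis
    using U psh_mor_closed[OF cplx_dif[OF K, of "n + 1"] U]
    by (auto simp: cocycles_def algebra_simps)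
qed

text \<open>The sign in the shifted differential is absorbed by inverting the preimage. Together
  with the equality of cocycles this turns \<open>local_qis\<close> of the shift in degree
  \<open>n\<close> into that of the original in degree \<open>n + 1\<close>.\<close>

lemma coboundaries_cshift:
  assumes K: "complex_of_sheaves T K" and U: "openin T U"
  shows "coboundaries_of (fst (cshift T) K) n U = coboundaries_of K (n + 1) U"
proof -
  interpret h: group_hom "sec (trm K n) U" "sec (trm K (n + 1)) U" "dif K n U"
    using group_hom_psh_mor[OF cplx_dif[OF K] cplx_presheaf[OF K] cplx_presheaf[OF K] U] .
  have d: "dif (fst (cshift T) K) (n - 1) U s = inv\<^bsub>sec (trm K (n + 1)) U\<^esub> (dif K n U s)"
    if "s \<in> carrier (sec (trm K n) U)" for s
    using dif_cshift[of T U s K "n - 1"] U that by (simp add: algebra_simps)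
  have "(\<lambda>s. inv\<^bsub>sec (trm K (n + 1)) U\<^esub> (dif K n U s)) ` carrier (sec (trm K n) U)
      = dif K n U ` carrier (sec (trm K n) U)" (is "?f ` _ = _")
  proof (intro equalityI image_subsetI)
    fix s assume s: "s \<in> carrier (sec (trm K n) U)"
    show "?f s \<in> dif K n U ` carrier (sec (trm K n) U)"
      using s h.hom_inv[OF s] by (metis h.G.inv_closed image_eqI)
    show "dif K n U s \<in> ?f ` carrier (sec (trm K n) U)"
      using s by (intro image_eqI[of _ _ "inv\<^bsub>sec (trm K n) U\<^esub> s"]) auto
  qed
  then show ?thesis using d by (simp add: coboundaries_of_def cong: image_cong_simp)
qed

lemma cshift_quasi_isos: "snd (cshift T) ` quasi_isos T \<subseteq> quasi_isos T"
proof (rule image_subsetI)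
  fix f assume f: "f \<in> quasi_isos T"
  obtain K \<phi> L where [simp]: "f = (K, \<phi>, L)" by (cases f)
  have q: "chain_map T K \<phi> L" "\<And>n x. x \<in> topspace T \<Longrightarrow> local_qis T K \<phi> L n x"
    using f by (auto simp: quasi_isos_iff)
  have "local_qis T (fst (cshift T) K) (\<lambda>n. \<phi> (n + 1)) (fst (cshift T) L) n x"
    if "x \<in> topspace T" for n x
    using q(2)[OF that, of "n + 1"] chain_map_cplx[OF q(1)]
    by (simp add: local_qis_def cocycles_cshift coboundaries_cshift cong: conj_cong)
  moreover have "chain_map T (fst (cshift T) K) (\<lambda>n. \<phi> (n + 1)) (fst (cshift T) L)"
    using functor_Hom[OF functor_cshift] q(1) by (fastforce simp: Hom_Ch)
  ultimately show "snd (cshift T) f \<in> quasi_isos T" by (simp add: quasi_isos_iff)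
qed

lemma functor_dshift: "is_functor (Der T) (Der T) (fst (cshift T), dshift T)"
  unfolding dshift_def by (rule functor_Ch_Der(1)[OF functor_cshift cshift_quasi_isos])

lemma dshift_der_arr:
  "f \<in> Hom (Ch T) K L \<Longrightarrow> dshift T (der_arr T f) = der_arr T (snd (cshift T) f)"
  unfolding dshift_def by (rule functor_Ch_Der(2)[OF functor_cshift cshift_quasi_isos])

section \<open>Direct image from a subspace\<close>

lemma sheaf_image_simps [simp]:
  "sec (sheaf_image S F) U = sec F (U \<inter> S)"
  "rst (sheaf_image S F) U V = rst F (U \<inter> S) (V \<inter> S)"
  by (auto simp: sheaf_image_def)

lemma cimage_simps [simp]:
  "trm (fst (cimage T S) K) n = sheaf_image S (trm K n)"
  "dif (fst (cimage T S) K) n = mor_image T S (dif K n)"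
  "snd (cimage T S) (K, \<phi>, L) = (fst (cimage T S) K, \<lambda>n. mor_image T S (\<phi> n), fst (cimage T S) L)"
  by (auto simp: cimage_def Let_def)

lemma mor_image_apply [simp]: "openin T U \<Longrightarrow> mor_image T S \<phi> U = \<phi> (U \<inter> S)"
  by (simp add: mor_image_def)

lemma openin_subtopology_Int_trace: "openin T U \<Longrightarrow> openin (subtopology T S) (U \<inter> S)"
  by (auto simp: openin_subtopology)

lemma presheaf_image:
  assumes F: "presheaf (subtopology T S) F"
  shows "presheaf T (sheaf_image S F)"
  unfolding presheaf_def sheaf_image_simps
proof (intro conjI allI impI ballI)
  note o = openin_subtopology_Int_trace[of T _ S]
  fix U assume U: "openin T U"
  show "comm_group (sec F (U \<inter> S))" using presheaf_comm_group[OF F o[OF U]] .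
  show "rst F (U \<inter> S) (U \<inter> S) s = s" if "s \<in> carrier (sec F (U \<inter> S))" for s
    using rst_id[OF F o[OF U] that] .
  fix V assume V: "openin T V" "V \<subseteq> U"
  have VU: "V \<inter> S \<subseteq> U \<inter> S" using V by auto
  show "rst F (U \<inter> S) (V \<inter> S) \<in> hom (sec F (U \<inter> S)) (sec F (V \<inter> S))"
    using rst_hom[OF F o[OF U] o[OF V(1)] VU] .
  fix W s assume W: "openin T W" "W \<subseteq> V" and s: "s \<in> carrier (sec F (U \<inter> S))"
  have WV: "W \<inter> S \<subseteq> V \<inter> S" using W by auto
  show "rst F (V \<inter> S) (W \<inter> S) (rst F (U \<inter> S) (V \<inter> S) s) = rst F (U \<inter> S) (W \<inter> S) s"
    using rst_rst[OF F o[OF U] o[OF V(1)] o[OF W(1)] VU WV s] .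
qed

lemma sheaf_unique_gluing:
  assumes "sheaf T F" "\<And>U. U \<in> \<U> \<Longrightarrow> openin T U \<and> s U \<in> carrier (sec F U)"
    "\<And>U V. U \<in> \<U> \<Longrightarrow> V \<in> \<U> \<Longrightarrow> rst F U (U \<inter> V) (s U) = rst F V (U \<inter> V) (s V)"
  shows "\<exists>!t. t \<in> carrier (sec F (\<Union>\<U>)) \<and> (\<forall>U\<in>\<U>. rst F (\<Union>\<U>) U t = s U)"
  by (rule conjunct2[OF iffD1[OF sheaf_def assms(1)], rule_format]) (use assms(2,3) in blast)+

text \<open>A gluing family on \<open>T\<close> is indexed by open sets of \<open>T\<close>, whereas
  gluing for \<open>F\<close> wants one section for each trace on \<open>S\<close>. Members with the
  same trace carry the same section, by compatibility on their intersection, so choosing one member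
  for each trace is harmless.\<close>

lemma sheaf_image:
  assumes F: "sheaf (subtopology T S) F"
  shows "sheaf T (sheaf_image S F)"
  unfolding sheaf_def
proof (intro conjI allI impI)
  note P = sheaf_presheaf[OF F]
  show "presheaf T (sheaf_image S F)" using presheaf_image[OF P] .
  fix \<U> and s :: "'a set \<Rightarrow> 'b"
  assume s: "\<forall>U\<in>\<U>. openin T U \<and> s U \<in> carrier (sec (sheaf_image S F) U)"
    and comp: "\<forall>U\<in>\<U>. \<forall>V\<in>\<U>. rst (sheaf_image S F) U (U \<inter> V) (s U) = rst (sheaf_image S F) V (U \<inter> V) (s V)"
  have op: "openin (subtopology T S) (U \<inter> S)" if "U \<in> \<U>" for U
    using s that openin_subtopology_Int_trace by blast
  have eq: "s U = s V" if "U \<in> \<U>" "V \<in> \<U>" "U \<inter> S = V \<inter> S" for U V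
  proof -
    have "U \<inter> V \<inter> S = U \<inter> S" "U \<inter> V \<inter> S = V \<inter> S" using that by auto
    moreover have "rst F (U \<inter> S) (U \<inter> V \<inter> S) (s U) = rst F (V \<inter> S) (U \<inter> V \<inter> S) (s V)"
      using comp that(1,2) unfolding sheaf_image_simps by blast
    ultimately show ?thesis
      using rst_id[OF P op[OF that(1)]] rst_id[OF P op[OF that(2)]] s that by auto
  qed
  define r where "r W = s (SOME U. U \<in> \<U> \<and> U \<inter> S = W)" for W
  have r: "r (U \<inter> S) = s U" if "U \<in> \<U>" for U
  proof -
    have "(SOME V. V \<in> \<U> \<and> V \<inter> S = U \<inter> S) \<in> \<U> \<and> (SOME V. V \<in> \<U> \<and> V \<inter> S = U \<inter> S) \<inter> S = U \<inter> S"
      by (rule someI[of "\<lambda>V. V \<in> \<U> \<and> V \<inter> S = U \<inter> S" U]) (use that in simp)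
    then show ?thesis unfolding r_def using eq that by blast
  qed
  have "\<exists>!t. t \<in> carrier (sec F (\<Union>((\<lambda>U. U \<inter> S) ` \<U>))) \<and>
      (\<forall>W\<in>(\<lambda>U. U \<inter> S) ` \<U>. rst F (\<Union>((\<lambda>U. U \<inter> S) ` \<U>)) W t = r W)"
  proof (rule sheaf_unique_gluing[OF F])
    fix W W' assume "W \<in> (\<lambda>U. U \<inter> S) ` \<U>" "W' \<in> (\<lambda>U. U \<inter> S) ` \<U>"
    then obtain U V where U: "U \<in> \<U>" "W = U \<inter> S" and V: "V \<in> \<U>" "W' = V \<inter> S" by auto
    have "U \<inter> V \<inter> S = W \<inter> W'" using U V by auto
    moreover have "rst F (U \<inter> S) (U \<inter> V \<inter> S) (s U) = rst F (V \<inter> S) (U \<inter> V \<inter> S) (s V)"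
      using comp U V unfolding sheaf_image_simps by blast
    ultimately show "rst F W (W \<inter> W') (r W) = rst F W' (W \<inter> W') (r W')"
      using r U V by simp
  qed (use r s op in auto)
  moreover have "\<Union>((\<lambda>U. U \<inter> S) ` \<U>) = \<Union>\<U> \<inter> S" by auto
  ultimately show "\<exists>!t. t \<in> carrier (sec (sheaf_image S F) (\<Union>\<U>)) \<and>
      (\<forall>U\<in>\<U>. rst (sheaf_image S F) (\<Union>\<U>) U t = s U)"
    by (simp add: r)
qed

lemma psh_mor_image:
  assumes "psh_mor (subtopology T S) F G \<phi>"
  shows "psh_mor T (sheaf_image S F) (sheaf_image S G) (mor_image T S \<phi>)"
proof -
  have "restrict (\<phi> (U \<inter> S)) (carrier (sec F (U \<inter> S))) = \<phi> (U \<inter> S)" if "openin T U" for U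
    using psh_mor_on_opens[OF assms] openin_subtopology_Int_trace[OF that, of S]
    by (metis on_opens_def)
  then have "mor_image T S \<phi> = on_opens T (sheaf_image S F) (mor_image T S \<phi>)"
    by (auto simp: mor_image_def on_opens_def)
  then show ?thesis
    unfolding psh_mor_def
    by (auto intro: psh_mor_hom[OF assms] psh_mor_rst[OF assms] simp: openin_subtopology_Int_trace)
qed

lemma complex_cimage:
  assumes K: "complex_of_sheaves (subtopology T S) K"
  shows "complex_of_sheaves T (fst (cimage T S) K)"
  using cplx_sheaf[OF K] cplx_dif[OF K] cplx_dif_dif[OF K]
  by (auto simp: complex_of_sheaves_def sheaf_image psh_mor_image openin_subtopology_Int_trace)

lemma functor_cimage: "is_functor (Ch (subtopology T S)) (Ch T) (cimage T S)"
proof -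
  have f: "chain_map T (fst (cimage T S) K) (\<lambda>n. mor_image T S (\<phi> n)) (fst (cimage T S) L)"
    if f: "chain_map (subtopology T S) K \<phi> L" for K \<phi> L
    using f complex_cimage by (auto simp: chain_map_def psh_mor_image openin_subtopology_Int_trace)
  show ?thesis
    unfolding is_functor_def
  proof (intro conjI ballI impI)
    fix K assume "K \<in> ob (Ch (subtopology T S))"
    then show "fst (cimage T S) K \<in> ob (Ch T)" by (simp add: complex_cimage)
    have "mor_image T S (psh_id (subtopology T S) F) = psh_id T (sheaf_image S F)" for F :: "'a sh"
      by (auto simp: fun_eq_iff mor_image_def psh_id_def on_opens_def openin_subtopology_Int_trace)
    then show "snd (cimage T S) (idt (Ch (subtopology T S)) K) = idt (Ch T) (fst (cimage T S) K)"
      by simp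
  next
    fix h assume "h \<in> arr (Ch (subtopology T S))"
    then show "snd (cimage T S) h \<in> Hom (Ch T) (fst (cimage T S) (src (Ch (subtopology T S)) h))
        (fst (cimage T S) (tgt (Ch (subtopology T S)) h))"
      using f by (cases h) (auto simp: Hom_Ch)
  next
    fix f g assume "f \<in> arr (Ch (subtopology T S))" "g \<in> arr (Ch (subtopology T S))"
    moreover have "mor_image T S (psh_comp (subtopology T S) F \<psi> \<phi>) =
        psh_comp T (sheaf_image S F) (mor_image T S \<psi>) (mor_image T S \<phi>)"
      for F :: "'a sh" and \<phi> \<psi> :: "'a smor"
      by (auto simp: fun_eq_iff mor_image_def psh_comp_def on_opens_def openin_subtopology_Int_trace)
    ultimately show "snd (cimage T S) (cmp (Ch (subtopology T S)) g f)
        = cmp (Ch T) (snd (cimage T S) g) (snd (cimage T S) f)"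
      by (cases f; cases g) simp
  qed
qed

lemma cocycles_cimage:
  "openin T U \<Longrightarrow> cocycles (fst (cimage T S) K) n U = cocycles K n (U \<inter> S)"
  and coboundaries_cimage:
  "openin T U \<Longrightarrow> coboundaries_of (fst (cimage T S) K) n U = coboundaries_of K n (U \<inter> S)"
  by (auto simp: cocycles_def coboundaries_of_def)

text \<open>This is the gluing axiom for the empty cover: the empty family is compatible and has
  exactly one gluing.\<close>

lemma sheaf_empty:
  assumes F: "sheaf T F" and s: "s \<in> carrier (sec F {})"
  shows "s = \<one>\<^bsub>sec F {}\<^esub>"
proof -
  have "\<exists>!t. t \<in> carrier (sec F (\<Union>{})) \<and> (\<forall>U\<in>{}. rst F (\<Union>{}) U t = undefined U)"
    by (rule sheaf_unique_gluing[OF F]) auto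
  moreover have "\<one>\<^bsub>sec F {}\<^esub> \<in> carrier (sec F {})"
    using presheaf_group[OF sheaf_presheaf[OF F], of "{}"] by (simp add: group.is_monoid)
  ultimately show ?thesis using s by auto
qed

text \<open>Exactness of the direct image along a closed subspace. At a point of \<open>S\<close>
  the condition is inherited from the subspace; at a point off \<open>S\<close> the open set
  \<open>U - S\<close> has empty trace, and over it all sections are neutral.\<close>

lemma local_qis_cimage:
  assumes f: "chain_map (subtopology T S) K \<phi> L" and S: "closedin T S" and x: "x \<in> topspace T"
    and q: "x \<in> S \<Longrightarrow> local_qis (subtopology T S) K \<phi> L n x"
  shows "local_qis T (fst (cimage T S) K) (\<lambda>n. mor_image T S (\<phi> n)) (fst (cimage T S) L) n x"
proof (cases "x \<in> S")
  case True
  \<comment> \<open>A neighbourhood found inside the subspace must be the trace of an open set of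
    \<open>T\<close> that stays within \<open>U\<close>.\<close>
  have lift: "\<exists>W'. openin T W' \<and> W' \<subseteq> U \<and> W' \<inter> S = W"
    if h: "openin T U" "openin (subtopology T S) W" "W \<subseteq> U \<inter> S" for U W
  proof -
    obtain V where "openin T V" "W = V \<inter> S" using h by (auto simp: openin_subtopology)
    then show ?thesis using h by (intro exI[of _ "V \<inter> U"]) auto
  qed
  show ?thesis
    unfolding local_qis_def
  proof (intro conjI allI impI)
    fix U s assume U: "openin T U" "x \<in> U" and s: "s \<in> cocycles (fst (cimage T S) K) n U"
      "mor_image T S (\<phi> n) U s \<in> coboundaries_of (fst (cimage T S) L) n U"
    then have s': "s \<in> cocycles K n (U \<inter> S)" "\<phi> n (U \<inter> S) s \<in> coboundaries_of L n (U \<inter> S)"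
      by (auto simp: cocycles_cimage coboundaries_cimage)
    obtain W where W: "openin (subtopology T S) W" "x \<in> W" "W \<subseteq> U \<inter> S"
      "rst (trm K n) (U \<inter> S) W s \<in> coboundaries_of K n W"
      using conjunct1[OF q[OF True, unfolded local_qis_def], rule_format,
          OF openin_subtopology_Int_trace[OF U(1)] IntI[OF U(2) True] s'] by blast
    obtain W' where W': "openin T W'" "W' \<subseteq> U" "W' \<inter> S = W" using lift[OF U(1) W(1,3)] by blast
    show "\<exists>W. openin T W \<and> x \<in> W \<and> W \<subseteq> U \<and>
        rst (trm (fst (cimage T S) K) n) U W s \<in> coboundaries_of (fst (cimage T S) K) n W"
      using W W' by (intro exI[of _ W']) (auto simp: coboundaries_cimage)
  next
    fix U t assume U: "openin T U" "x \<in> U" and t: "t \<in> cocycles (fst (cimage T S) L) n U"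
    then have t': "t \<in> cocycles L n (U \<inter> S)" by (auto simp: cocycles_cimage)
    obtain W s where W: "openin (subtopology T S) W" "x \<in> W" "W \<subseteq> U \<inter> S" "s \<in> cocycles K n W"
      "\<exists>b\<in>coboundaries_of L n W. rst (trm L n) (U \<inter> S) W t = b \<otimes>\<^bsub>sec (trm L n) W\<^esub> \<phi> n W s"
      using conjunct2[OF q[OF True, unfolded local_qis_def], rule_format,
          OF openin_subtopology_Int_trace[OF U(1)] IntI[OF U(2) True] t'] by blast
    obtain W' where W': "openin T W'" "W' \<subseteq> U" "W' \<inter> S = W" using lift[OF U(1) W(1,3)] by blast
    show "\<exists>W s. openin T W \<and> x \<in> W \<and> W \<subseteq> U \<and> s \<in> cocycles (fst (cimage T S) K) n W \<and>
        (\<exists>b\<in>coboundaries_of (fst (cimage T S) L) n W. rst (trm (fst (cimage T S) L) n) U W t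
          = b \<otimes>\<^bsub>sec (trm (fst (cimage T S) L) n) W\<^esub> mor_image T S (\<phi> n) W s)"
      using W W' by (intro exI[of _ W'] exI[of _ s]) (auto simp: coboundaries_cimage cocycles_cimage)
  qed
next
  case False
  have K: "complex_of_sheaves (subtopology T S) K" and L: "complex_of_sheaves (subtopology T S) L"
    using chain_map_cplx[OF f] by auto
  have W: "openin T (U - S)" "x \<in> U - S" "U - S \<subseteq> U" "(U - S) \<inter> S = {}"
    if "openin T U" "x \<in> U" for U
    using that S False by auto
  note oneK = subgroup.one_closed[OF subgroup_coboundaries[OF K, of "{}"]]
    subgroup.one_closed[OF subgroup_cocycles[OF K, of "{}"]]
  note oneL = subgroup.one_closed[OF subgroup_coboundaries[OF L, of "{}"]]
  interpret GL: group "sec (trm L n) {}" using presheaf_group[OF cplx_presheaf[OF L], of "{}"] by simp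
  show ?thesis
    unfolding local_qis_def
  proof (intro conjI allI impI)
    fix U s assume U: "openin T U" "x \<in> U" and s: "s \<in> cocycles (fst (cimage T S) K) n U"
    then have "rst (trm K n) (U \<inter> S) {} s \<in> carrier (sec (trm K n) {})"
      using openin_subtopology_Int_trace[OF U(1), of S]
      by (intro rst_closed[OF cplx_presheaf[OF K]]) (auto simp: cocycles_cimage cocycles_carrier)
    then have "rst (trm K n) (U \<inter> S) {} s = \<one>\<^bsub>sec (trm K n) {}\<^esub>"
      using sheaf_empty[OF cplx_sheaf[OF K]] by blast
    then show "\<exists>W. openin T W \<and> x \<in> W \<and> W \<subseteq> U \<and>
        rst (trm (fst (cimage T S) K) n) U W s \<in> coboundaries_of (fst (cimage T S) K) n W"
      using W[OF U] oneK by (intro exI[of _ "U - S"]) (auto simp: coboundaries_cimage)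
  next
    fix U t assume U: "openin T U" "x \<in> U" and t: "t \<in> cocycles (fst (cimage T S) L) n U"
    then have "rst (trm L n) (U \<inter> S) {} t \<in> carrier (sec (trm L n) {})"
      using openin_subtopology_Int_trace[OF U(1), of S]
      by (intro rst_closed[OF cplx_presheaf[OF L]]) (auto simp: cocycles_cimage cocycles_carrier)
    then have t1: "rst (trm L n) (U \<inter> S) {} t = \<one>\<^bsub>sec (trm L n) {}\<^esub>"
      using sheaf_empty[OF cplx_sheaf[OF L]] by blast
    let ?s = "\<one>\<^bsub>sec (trm K n) {}\<^esub>"
    have "\<phi> n {} ?s = \<one>\<^bsub>sec (trm L n) {}\<^esub>"
      using psh_mor_one[OF chain_map_mor[OF f] cplx_presheaf[OF K] cplx_presheaf[OF L], of "{}"] by simp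
    then have "\<exists>b\<in>coboundaries_of L n {}. rst (trm L n) (U \<inter> S) {} t = b \<otimes>\<^bsub>sec (trm L n) {}\<^esub> \<phi> n {} ?s"
      using t1 oneL by (intro bexI[of _ "\<one>\<^bsub>sec (trm L n) {}\<^esub>"]) auto
    then show "\<exists>W s. openin T W \<and> x \<in> W \<and> W \<subseteq> U \<and> s \<in> cocycles (fst (cimage T S) K) n W \<and>
        (\<exists>b\<in>coboundaries_of (fst (cimage T S) L) n W. rst (trm (fst (cimage T S) L) n) U W t
          = b \<otimes>\<^bsub>sec (trm (fst (cimage T S) L) n) W\<^esub> mor_image T S (\<phi> n) W s)"
      using W[OF U] oneK by (intro exI[of _ "U - S"] exI[of _ ?s])
        (auto simp: coboundaries_cimage cocycles_cimage)
  qed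
qed

lemma cimage_quasi_isos:
  assumes S: "closedin T S"
  shows "snd (cimage T S) ` quasi_isos (subtopology T S) \<subseteq> quasi_isos T"
proof (rule image_subsetI)
  fix f assume f: "f \<in> quasi_isos (subtopology T S)"
  obtain K \<phi> L where [simp]: "f = (K, \<phi>, L)" by (cases f)
  have q: "chain_map (subtopology T S) K \<phi> L"
    "\<And>n x. x \<in> topspace (subtopology T S) \<Longrightarrow> local_qis (subtopology T S) K \<phi> L n x"
    using f by (auto simp: quasi_isos_iff)
  have "local_qis T (fst (cimage T S) K) (\<lambda>n. mor_image T S (\<phi> n)) (fst (cimage T S) L) n x"
    if "x \<in> topspace T" for n x
    using q(2) that by (intro local_qis_cimage[OF q(1) S]) auto
  moreover have "chain_map T (fst (cimage T S) K) (\<lambda>n. mor_image T S (\<phi> n)) (fst (cimage T S) L)"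
    using functor_Hom[OF functor_cimage] q(1) by (fastforce simp: Hom_Ch)
  ultimately show "snd (cimage T S) f \<in> quasi_isos T" by (simp add: quasi_isos_iff)
qed

lemma functor_dimage:
  "closedin T S \<Longrightarrow> is_functor (Der (subtopology T S)) (Der T) (fst (cimage T S), dimage T S)"
  unfolding dimage_def by (rule functor_Ch_Der(1)[OF functor_cimage cimage_quasi_isos])

lemma dimage_der_arr:
  "closedin T S \<Longrightarrow> f \<in> Hom (Ch (subtopology T S)) K L \<Longrightarrow>
    dimage T S (der_arr (subtopology T S) f) = der_arr T (snd (cimage T S) f)"
  unfolding dimage_def by (rule functor_Ch_Der(2)[OF functor_cimage cimage_quasi_isos])

section \<open>Multiplication by integers on complexes\<close>

lemma cmult_Hom:
  assumes K: "complex_of_sheaves T K"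
  shows "cmult T n K \<in> Hom (Ch T) K K"
proof -
  note P = cplx_presheaf[OF K]
  have "chain_map T K (\<lambda>m. on_opens T (trm K m) (\<lambda>U s. s [^]\<^bsub>sec (trm K m) U\<^esub> n)) K"
    unfolding chain_map_def
  proof (intro conjI allI impI ballI K)
    fix m show "psh_mor T (trm K m) (trm K m) (on_opens T (trm K m) (\<lambda>U s. s [^]\<^bsub>sec (trm K m) U\<^esub> n))"
    proof (rule psh_morI)
      fix U s assume U: "openin T U" and s: "s \<in> carrier (sec (trm K m) U)"
      interpret comm_group "sec (trm K m) U" using presheaf_comm_group[OF P U] .
      show "s [^]\<^bsub>sec (trm K m) U\<^esub> n \<in> carrier (sec (trm K m) U)" using s by simp
      show "(s \<otimes>\<^bsub>sec (trm K m) U\<^esub> t) [^]\<^bsub>sec (trm K m) U\<^esub> n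
          = s [^]\<^bsub>sec (trm K m) U\<^esub> n \<otimes>\<^bsub>sec (trm K m) U\<^esub> t [^]\<^bsub>sec (trm K m) U\<^esub> n"
        if "t \<in> carrier (sec (trm K m) U)" for t
        using s that by (rule int_pow_distrib)
      show "rst (trm K m) U V s [^]\<^bsub>sec (trm K m) V\<^esub> n = rst (trm K m) U V (s [^]\<^bsub>sec (trm K m) U\<^esub> n)"
        if "openin T V" "V \<subseteq> U" for V
        using group_hom.hom_int_pow[OF group_hom_rst[OF P U that] s] by simp
    qed (rule P)
    fix U s assume U: "openin T U" and s: "s \<in> carrier (sec (trm K m) U)"
    interpret group "sec (trm K m) U" using presheaf_group[OF P U] .
    show "on_opens T (trm K (m + 1)) (\<lambda>U s. s [^]\<^bsub>sec (trm K (m + 1)) U\<^esub> n) U (dif K m U s)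
        = dif K m U (on_opens T (trm K m) (\<lambda>U s. s [^]\<^bsub>sec (trm K m) U\<^esub> n) U s)"
      using U s psh_mor_closed[OF cplx_dif[OF K] U s]
        group_hom.hom_int_pow[OF group_hom_psh_mor[OF cplx_dif[OF K] P P U] s] by simp
  qed
  then show ?thesis by (auto simp: cmult_def Hom_Ch)
qed

lemma cmult_natural:
  assumes f: "f \<in> Hom (Ch T) K L"
  shows "cmp (Ch T) (cmult T n L) f = cmp (Ch T) f (cmult T n K)"
proof -
  obtain \<phi> where \<phi>: "f = (K, \<phi>, L)" "chain_map T K \<phi> L" using f by (auto simp: Hom_Ch)
  note K = chain_map_cplx(1)[OF \<phi>(2)] and L = chain_map_cplx(2)[OF \<phi>(2)]
  have "psh_comp T (trm K m) (on_opens T (trm L m) (\<lambda>U s. s [^]\<^bsub>sec (trm L m) U\<^esub> n)) (\<phi> m)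
      = psh_comp T (trm K m) (\<phi> m) (on_opens T (trm K m) (\<lambda>U s. s [^]\<^bsub>sec (trm K m) U\<^esub> n))" for m
    unfolding psh_comp_def
  proof (rule on_opens_cong)
    fix U s assume U: "openin T U" and s: "s \<in> carrier (sec (trm K m) U)"
    show "on_opens T (trm L m) (\<lambda>U s. s [^]\<^bsub>sec (trm L m) U\<^esub> n) U (\<phi> m U s) =
        \<phi> m U (on_opens T (trm K m) (\<lambda>U s. s [^]\<^bsub>sec (trm K m) U\<^esub> n) U s)"
      using U s psh_mor_closed[OF chain_map_mor[OF \<phi>(2)] U s]
        group_hom.hom_int_pow[OF group_hom_psh_mor[OF chain_map_mor[OF \<phi>(2)] cplx_presheaf[OF K]
            cplx_presheaf[OF L] U] s] by simp
  qed
  then show ?thesis by (simp add: \<phi>(1) cmult_def)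
qed

lemma cmult_natural_Der:
  assumes f: "f \<in> Hom (Der T) K L"
  shows "cmp (Der T) (der_arr T (cmult T n L)) f = cmp (Der T) f (der_arr T (cmult T n K))"
  unfolding Der_def der_arr_def
  by (rule localization_natural[OF category_Ch _ _ f[unfolded Der_def]])
    (auto simp: cmult_Hom cmult_natural)

lemma der_arr_Hom: "f \<in> Hom (Ch T) K L \<Longrightarrow> der_arr T f \<in> Hom (Der T) K L"
  unfolding Der_def der_arr_def by (rule loc_arr_Hom[OF category_Ch])

lemma der_arr_cmp: "f \<in> Hom (Ch T) K L \<Longrightarrow> g \<in> Hom (Ch T) L M \<Longrightarrow>
    der_arr T (cmp (Ch T) g f) = cmp (Der T) (der_arr T g) (der_arr T f)"
  unfolding Der_def der_arr_def by (rule loc_arr_cmp[OF category_Ch])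

lemma der_arr_iso: "f \<in> Hom (Ch T) K L \<Longrightarrow> f \<in> quasi_isos T \<Longrightarrow> iso_arr (Der T) K L (der_arr T f)"
  unfolding Der_def der_arr_def by (rule loc_arr_iso[OF category_Ch])

section \<open>The analytic topology of a subvariety\<close>

text \<open>Having an open trace passes through finite intersections and unions, so it need be
  checked on generators only. With \<open>S = UNIV\<close> this compares two topologies
  directly.\<close>

lemma generate_topology_on_openin:
  assumes "generate_topology_on \<S> U" and "\<And>s. s \<in> \<S> \<Longrightarrow> openin T (s \<inter> S)"
  shows "openin T (U \<inter> S)"
  using assms(1)
proof induction
  case (Int a b)
  then have "openin T ((a \<inter> S) \<inter> (b \<inter> S))" using assms(2) by (simp add: openin_Int)
  moreover have "(a \<inter> S) \<inter> (b \<inter> S) = a \<inter> b \<inter> S" by blast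
  ultimately show ?case by simp
next
  case (UN K)
  have "openin T (\<Union>((\<lambda>k. k \<inter> S) ` K))"
  proof (rule openin_Union)
    fix U assume "U \<in> (\<lambda>k. k \<inter> S) ` K"
    then obtain k where "k \<in> K" "U = k \<inter> S" by (elim imageE)
    then show "openin T U" using UN.IH by simp
  qed
  then show ?case by (simp only: Int_Union2)
qed (use assms(2) in auto)

text \<open>Regularity of constants is not an axiom of \<open>variety\<close>; it is read off in
  affine charts, where 1 is the quotient of two constant polynomials, and then glued. It shows that
  Zariski open sets are analytically open: such a set is the preimage of \<open>UNIV\<close> under
  the constant function on it.\<close>

lemma const_one_regular:
  assumes X: "variety X" and U: "openin (zar X) U"
  shows "restrict (\<lambda>_. 1) U \<in> reg X U"
proof -
  obtain \<C> where \<C>: "\<And>C. C \<in> \<C> \<Longrightarrow> affine_chart X C" "\<Union>\<C> = topspace (zar X)"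
    using conjunct1[OF conjunct2[OF conjunct2[OF X[unfolded variety_def]]]] by (elim exE) auto
  have glue: "(\<forall>U\<in>\<U>. openin (zar X) U) \<Longrightarrow> f \<in> extensional (\<Union>\<U>) \<Longrightarrow>
      f \<in> reg X (\<Union>\<U>) \<longleftrightarrow> (\<forall>U\<in>\<U>. restrict f U \<in> reg X U)" for \<U> f
    using conjunct1[OF conjunct2[OF X[unfolded variety_def]], rule_format, of \<U> f] by simp
  have UC: "(\<Union>C\<in>\<C>. U \<inter> C) = U" using \<C>(2) openin_subset[OF U] by auto
  have "restrict (\<lambda>_. 1) (U \<inter> C) \<in> reg X (U \<inter> C)" if "C \<in> \<C>" for C
  proof -
    let ?W = "U \<inter> C" and ?f = "restrict (\<lambda>_. 1) (U \<inter> C) :: 'a \<Rightarrow> complex"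
    obtain n P \<phi> where C: "openin (zar X) C" "bij_betw \<phi> C (zero_locus n P)"
      and op: "\<And>W. W \<subseteq> C \<Longrightarrow> openin (zar X) W \<longleftrightarrow> affine_open n (zero_locus n P) (\<phi> ` W)"
      and re: "\<And>W f. openin (zar X) W \<Longrightarrow> W \<subseteq> C \<Longrightarrow> f \<in> extensional W \<Longrightarrow>
        f \<in> reg X W \<longleftrightarrow> affine_regular n (zero_locus n P) (\<phi> ` W) (f \<circ> inv_into C \<phi>)"
      using \<C>(1)[OF \<open>C \<in> \<C>\<close>] unfolding affine_chart_def by auto
    have W: "openin (zar X) ?W" "?W \<subseteq> C" using U C by auto
    have "(?f \<circ> inv_into C \<phi>) z = 1" if "z \<in> \<phi> ` ?W" for z
      using that C(2) by (auto simp: bij_betw_def inv_into_f_f)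
    moreover have "(\<lambda>z. 1) \<in> poly_funs n" by (rule poly_funs.intros)
    moreover have "affine_open n (zero_locus n P) (\<phi> ` ?W)" using op W by simp
    ultimately have "affine_regular n (zero_locus n P) (\<phi> ` ?W) (?f \<circ> inv_into C \<phi>)"
      unfolding affine_regular_def
      by (intro ballI exI[of _ "\<phi> ` ?W"] conjI bexI[of _ "\<lambda>z. 1"]) auto
    then show ?thesis using re[OF W] by simp
  qed
  then have "\<forall>V\<in>(\<inter>) U ` \<C>. restrict (restrict (\<lambda>_. 1) U) V \<in> reg X V"
    by (auto simp: Int_absorb1 restrict_restrict)
  moreover have "\<forall>V\<in>(\<inter>) U ` \<C>. openin (zar X) V"
    using U \<C>(1) by (auto simp: affine_chart_def)
  ultimately show ?thesis
    using glue[of "(\<inter>) U ` \<C>" "restrict (\<lambda>_. 1) U"] UC by simp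
qed

lemma openin_an_basis:
  "openin (zar X) U \<Longrightarrow> f \<in> reg X U \<Longrightarrow> open W \<Longrightarrow> openin (an X) {x \<in> U. f x \<in> W}"
  unfolding an_def by (rule topology_generated_by_Basis) blast

lemma openin_zar_an:
  assumes "variety X" "openin (zar X) U"
  shows "openin (an X) U"
  using openin_an_basis[OF assms(2) const_one_regular[OF assms] open_UNIV] by simp

lemma topspace_an:
  assumes X: "variety X"
  shows "topspace (an X) = topspace (zar X)"
proof
  show "topspace (an X) \<subseteq> topspace (zar X)"
    unfolding an_def using openin_subset by fastforce
  show "topspace (zar X) \<subseteq> topspace (an X)"
    using openin_zar_an[OF X] openin_subset by blast
qed

lemma closedin_zar_an: "variety X \<Longrightarrow> closedin (zar X) S \<Longrightarrow> closedin (an X) S"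
  by (simp add: closedin_def topspace_an openin_zar_an)

text \<open>A regular function on the subvariety is locally the restriction of a regular function of
  \<open>X\<close>, so each generator of its analytic topology is a neighbourhood, within the trace
  topology, of each of its points. Conversely generators of \<open>an X\<close> restrict to
  generators.\<close>

lemma an_subvariety:
  assumes X: "variety X"
  shows "an (subvariety X S) = subtopology (an X) S"
proof (rule topology_eq[THEN iffD2], intro allI iffI)
  fix U assume "openin (subtopology (an X) S) U"
  then obtain V where V: "openin (an X) V" "U = V \<inter> S" by (auto simp: openin_subtopology)
  have "openin (an (subvariety X S)) (V \<inter> S)"
  proof (rule generate_topology_on_openin)
    show "generate_topology_on {{x \<in> U. f x \<in> W} | U f W. openin (zar X) U \<and> f \<in> reg X U \<and> open W} V"
      using V(1) unfolding an_def by (rule openin_topology_generated_by)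
    fix B assume "B \<in> {{x \<in> U. f x \<in> W} | U f W. openin (zar X) U \<and> f \<in> reg X U \<and> open W}"
    then obtain U f W where B: "B = {x \<in> U. f x \<in> W}" "openin (zar X) U" "f \<in> reg X U" "open W" by auto
    have "restrict f (U \<inter> S) \<in> reg (subvariety X S) (U \<inter> S)"
      using B(2,3) by (auto simp: subvariety_def)
    moreover have "openin (zar (subvariety X S)) (U \<inter> S)"
      using B(2) by (simp add: subvariety_def openin_subtopology_Int_trace)
    ultimately have "openin (an (subvariety X S)) {x \<in> U \<inter> S. restrict f (U \<inter> S) x \<in> W}"
      using B(4) by (intro openin_an_basis)
    moreover have "{x \<in> U \<inter> S. restrict f (U \<inter> S) x \<in> W} = B \<inter> S" using B(1) by auto
    ultimately show "openin (an (subvariety X S)) (B \<inter> S)" by simp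
  qed
  then show "openin (an (subvariety X S)) U" using V by simp
next
  fix U assume U: "openin (an (subvariety X S)) U"
  have "openin (subtopology (an X) S) (U \<inter> UNIV)"
  proof (rule generate_topology_on_openin)
    show "generate_topology_on {{x \<in> U. f x \<in> W} | U f W.
        openin (zar (subvariety X S)) U \<and> f \<in> reg (subvariety X S) U \<and> open W} U"
      using U unfolding an_def by (rule openin_topology_generated_by)
    fix B assume "B \<in> {{x \<in> U. f x \<in> W} | U f W.
        openin (zar (subvariety X S)) U \<and> f \<in> reg (subvariety X S) U \<and> open W}"
    then obtain U f W where B: "B = {x \<in> U. f x \<in> W}" "openin (zar (subvariety X S)) U"
      "f \<in> reg (subvariety X S) U" "open W" by auto
    obtain U' where U': "openin (zar X) U'" "U = U' \<inter> S"
      using B(2) by (auto simp: subvariety_def openin_subtopology)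
    have "\<exists>N. openin (subtopology (an X) S) N \<and> x \<in> N \<and> N \<subseteq> B" if "x \<in> B" for x
    proof -
      have "x \<in> U" "f x \<in> W" using \<open>x \<in> B\<close> B(1) by auto
      then obtain V g where V: "openin (zar X) V" "x \<in> V" "g \<in> reg X V" "\<forall>y\<in>U \<inter> V. f y = g y"
        using B(3) by (auto simp: subvariety_def)
      have "openin (an X) (U' \<inter> {y \<in> V. g y \<in> W})"
        using openin_zar_an[OF X U'(1)] openin_an_basis[OF V(1,3) B(4)] by blast
      from openin_subtopology_Int_trace[OF this, of S] show ?thesis
        using V \<open>x \<in> U\<close> \<open>f x \<in> W\<close> U'(2) B(1)
        by (intro exI[of _ "U' \<inter> {y \<in> V. g y \<in> W} \<inter> S"]) auto
    qed
    then show "openin (subtopology (an X) S) (B \<inter> UNIV)"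
      by (subst openin_subopen) simp
  qed
  then show "openin (subtopology (an X) S) U" by simp
qed

text \<open>The formalism provides \<open>pushforward\<close> for proper morphisms only. For an
  injective continuous map properness amounts to closedness, which the inclusion of a closed set
  has.\<close>

lemma proper_morphism_inclusion:
  assumes X: "variety X" and S: "closedin (zar X) S"
  shows "proper_morphism (subvariety X S) X id"
  unfolding proper_morphism_def regular_map_def
proof (intro conjI allI impI ballI)
  show "continuous_map (zar (subvariety X S)) (zar X) id"
    by (simp add: subvariety_def continuous_map_from_subtopology)
  show "restrict (g \<circ> id) {x \<in> topspace (zar (subvariety X S)). id x \<in> U}
      \<in> reg (subvariety X S) {x \<in> topspace (zar (subvariety X S)). id x \<in> U}"
    if "openin (zar X) U" "g \<in> reg X U" for U g
    using that by (auto simp: subvariety_def)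
  have "closed_map (subtopology (an X) S) (an X) id"
    by (rule closed_map_inclusion[OF closedin_zar_an[OF X S]])
  then show "proper_map (an (subvariety X S)) (an X) id"
    unfolding an_subvariety[OF X] by (intro injective_imp_proper_eq_closed_map[THEN iffD2]) auto
qed

section \<open>Constant sheaves\<close>

text \<open>As in \<open>const_sheaf\<close>, the neighbourhood \<open>V\<close> is open in
  \<open>T\<close> and is merely intersected with \<open>U\<close>; the notion thus makes sense for
  sets \<open>U\<close> that are not open.\<close>

definition locally_const :: "'p topology \<Rightarrow> 'p set \<Rightarrow> ('p \<Rightarrow> 'g) \<Rightarrow> bool" where
  "locally_const T U f \<longleftrightarrow> (\<forall>x\<in>U. \<exists>V. openin T V \<and> x \<in> V \<and> (\<forall>y\<in>U \<inter> V. f y = f x))"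

lemma locally_constI:
  "(\<And>x. x \<in> U \<Longrightarrow> \<exists>V. openin T V \<and> x \<in> V \<and> (\<forall>y\<in>U \<inter> V. f y = f x)) \<Longrightarrow> locally_const T U f"
  by (simp add: locally_const_def)

lemma locally_constE:
  assumes "locally_const T U f" "x \<in> U"
  obtains V where "openin T V" "x \<in> V" "\<And>y. y \<in> U \<Longrightarrow> y \<in> V \<Longrightarrow> f y = f x"
proof -
  from assms obtain V where "openin T V \<and> x \<in> V \<and> (\<forall>y\<in>U \<inter> V. f y = f x)"
    unfolding locally_const_def by metis
  then show ?thesis by (intro that[of V]) auto
qed

lemma locally_const_subset:
  assumes f: "locally_const T U f" and V: "V \<subseteq> U"
  shows "locally_const T V f"
proof (rule locally_constI)
  fix x assume "x \<in> V"
  then have "x \<in> U" using V by auto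
  from locally_constE[OF f this] obtain W where "openin T W" "x \<in> W"
    "\<And>y. y \<in> U \<Longrightarrow> y \<in> W \<Longrightarrow> f y = f x" by blast
  then show "\<exists>W. openin T W \<and> x \<in> W \<and> (\<forall>y\<in>V \<inter> W. f y = f x)"
    using V by (intro exI[of _ W]) auto
qed

lemma locally_const_cong: "(\<And>x. x \<in> U \<Longrightarrow> f x = g x) \<Longrightarrow> locally_const T U f = locally_const T U g"
  unfolding locally_const_def by (intro ball_cong refl ex_cong) auto

lemma locally_const_comp2:
  assumes f: "locally_const T U f" and g: "locally_const T U g"
  shows "locally_const T U (\<lambda>x. h (f x) (g x))"
proof (rule locally_constI)
  fix x assume x: "x \<in> U"
  from locally_constE[OF f x] obtain V where V: "openin T V" "x \<in> V"
    "\<And>y. y \<in> U \<Longrightarrow> y \<in> V \<Longrightarrow> f y = f x" by blast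
  from locally_constE[OF g x] obtain W where W: "openin T W" "x \<in> W"
    "\<And>y. y \<in> U \<Longrightarrow> y \<in> W \<Longrightarrow> g y = g x" by blast
  show "\<exists>V. openin T V \<and> x \<in> V \<and> (\<forall>y\<in>U \<inter> V. h (f y) (g y) = h (f x) (g x))"
    using V W by (intro exI[of _ "V \<inter> W"]) auto
qed

lemma locally_const_comp: "locally_const T U f \<Longrightarrow> locally_const T U (\<lambda>x. h (f x))"
  using locally_const_comp2[of T U f f "\<lambda>a _. h a"] by simp

lemma locally_const_const: "U \<subseteq> topspace T \<Longrightarrow> locally_const T U (\<lambda>_. c)"
  unfolding locally_const_def by (intro ballI exI[of _ "topspace T"]) auto

lemma carrier_coded_const:
  "Fn f \<in> carrier (sec (coded_const T G) U) \<longleftrightarrow> f \<in> U \<rightarrow>\<^sub>E carrier G \<and> locally_const T U f"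
  "s \<in> carrier (sec (coded_const T G) U) \<longleftrightarrow> (\<exists>f. s = Fn f \<and> f \<in> U \<rightarrow>\<^sub>E carrier G \<and> locally_const T U f)"
  by (auto simp: coded_const_def fn_sheaf_def const_sheaf_def locally_const_def)

lemma coded_const_simps [simp]:
  "Fn f \<otimes>\<^bsub>sec (coded_const T G) U\<^esub> Fn g = Fn (\<lambda>x\<in>U. f x \<otimes>\<^bsub>G\<^esub> g x)"
  "\<one>\<^bsub>sec (coded_const T G) U\<^esub> = Fn (\<lambda>x\<in>U. \<one>\<^bsub>G\<^esub>)"
  "rst (coded_const T G) U V (Fn f) = Fn (restrict f V)"
  by (auto simp: coded_const_def fn_sheaf_def const_sheaf_def)

lemma comm_group_coded_const:
  assumes G: "comm_group G" and U: "U \<subseteq> topspace T"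
  shows "comm_group (sec (coded_const T G) U)"
proof -
  interpret G: comm_group G by fact
  show ?thesis
  proof (rule comm_groupI)
    fix s t r assume "s \<in> carrier (sec (coded_const T G) U)" "t \<in> carrier (sec (coded_const T G) U)"
      "r \<in> carrier (sec (coded_const T G) U)"
    then obtain f g h where s: "s = Fn f" "f \<in> U \<rightarrow>\<^sub>E carrier G" "locally_const T U f"
      and t: "t = Fn g" "g \<in> U \<rightarrow>\<^sub>E carrier G" "locally_const T U g"
      and r: "r = Fn h" "h \<in> U \<rightarrow>\<^sub>E carrier G"
      by (auto simp: carrier_coded_const(2))
    have cl: "f x \<in> carrier G" "g x \<in> carrier G" "h x \<in> carrier G" if "x \<in> U" for x
      using that s t r by auto
    have "locally_const T U (\<lambda>x\<in>U. f x \<otimes>\<^bsub>G\<^esub> g x)"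
      using locally_const_comp2[OF s(3) t(3), of "monoid.mult G"]
      by (subst locally_const_cong[of U _ "\<lambda>x. f x \<otimes>\<^bsub>G\<^esub> g x"]) auto
    then show "s \<otimes>\<^bsub>sec (coded_const T G) U\<^esub> t \<in> carrier (sec (coded_const T G) U)"
      using cl by (auto simp: s(1) t(1) carrier_coded_const)
    show "s \<otimes>\<^bsub>sec (coded_const T G) U\<^esub> t \<otimes>\<^bsub>sec (coded_const T G) U\<^esub> r
        = s \<otimes>\<^bsub>sec (coded_const T G) U\<^esub> (t \<otimes>\<^bsub>sec (coded_const T G) U\<^esub> r)"
      using cl by (auto simp: s(1) t(1) r(1) G.m_assoc)
    show "s \<otimes>\<^bsub>sec (coded_const T G) U\<^esub> t = t \<otimes>\<^bsub>sec (coded_const T G) U\<^esub> s"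
      using cl by (auto simp: s(1) t(1) G.m_comm)
  next
    show "\<one>\<^bsub>sec (coded_const T G) U\<^esub> \<in> carrier (sec (coded_const T G) U)"
      using locally_const_const[OF U, of "\<one>\<^bsub>G\<^esub>"]
      by (auto simp: carrier_coded_const(1) cong: locally_const_cong)
  next
    fix s assume "s \<in> carrier (sec (coded_const T G) U)"
    then obtain f where s: "s = Fn f" "f \<in> U \<rightarrow>\<^sub>E carrier G" "locally_const T U f"
      by (auto simp: carrier_coded_const(2))
    have cl: "f x \<in> carrier G" if "x \<in> U" for x using that s by auto
    have e: "(\<lambda>x\<in>U. f x) = f" using s(2) by auto
    show "\<one>\<^bsub>sec (coded_const T G) U\<^esub> \<otimes>\<^bsub>sec (coded_const T G) U\<^esub> s = s"
      using cl e by (auto simp: s(1) cong: restrict_cong)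
    have "locally_const T U (\<lambda>x\<in>U. inv\<^bsub>G\<^esub> f x)"
      using locally_const_comp[OF s(3), of "m_inv G"]
      by (subst locally_const_cong[of U _ "\<lambda>x. inv\<^bsub>G\<^esub> f x"]) auto
    then have "Fn (\<lambda>x\<in>U. inv\<^bsub>G\<^esub> f x) \<in> carrier (sec (coded_const T G) U)"
      using cl by (auto simp: carrier_coded_const)
    moreover have "Fn (\<lambda>x\<in>U. inv\<^bsub>G\<^esub> f x) \<otimes>\<^bsub>sec (coded_const T G) U\<^esub> s = \<one>\<^bsub>sec (coded_const T G) U\<^esub>"
      using cl by (auto simp: s(1))
    ultimately show "\<exists>t\<in>carrier (sec (coded_const T G) U).
        t \<otimes>\<^bsub>sec (coded_const T G) U\<^esub> s = \<one>\<^bsub>sec (coded_const T G) U\<^esub>" by blast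
  qed
qed

lemma presheaf_coded_const:
  assumes G: "comm_group G"
  shows "presheaf T (coded_const T G)"
  unfolding presheaf_def
proof (intro conjI allI impI ballI)
  fix U assume U: "openin T U"
  show "comm_group (sec (coded_const T G) U)"
    using comm_group_coded_const[OF G] openin_subset[OF U] .
  show "rst (coded_const T G) U U s = s" if "s \<in> carrier (sec (coded_const T G) U)" for s
    using that by (auto simp: carrier_coded_const(2))
  fix V assume V: "openin T V" "V \<subseteq> U"
  show "rst (coded_const T G) U V \<in> hom (sec (coded_const T G) U) (sec (coded_const T G) V)"
  proof (rule homI)
    fix s t assume "s \<in> carrier (sec (coded_const T G) U)" "t \<in> carrier (sec (coded_const T G) U)"
    then obtain f g where s: "s = Fn f" "f \<in> U \<rightarrow>\<^sub>E carrier G" "locally_const T U f"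
      and t: "t = Fn g"
      by (auto simp: carrier_coded_const(2))
    have "locally_const T V (restrict f V)"
      using locally_const_subset[OF s(3) V(2)] by (simp cong: locally_const_cong)
    then show "rst (coded_const T G) U V s \<in> carrier (sec (coded_const T G) V)"
      using s V by (auto simp: carrier_coded_const)
    show "rst (coded_const T G) U V (s \<otimes>\<^bsub>sec (coded_const T G) U\<^esub> t) =
        rst (coded_const T G) U V s \<otimes>\<^bsub>sec (coded_const T G) V\<^esub> rst (coded_const T G) U V t"
      using V by (auto simp: s(1) t fun_eq_iff)
  qed
  fix W s assume "openin T W" "W \<subseteq> V" "s \<in> carrier (sec (coded_const T G) U)"
  then show "rst (coded_const T G) V W (rst (coded_const T G) U V s) = rst (coded_const T G) U W s"
    by (auto simp: carrier_coded_const(2) restrict_restrict Int_absorb1)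
qed

lemma sheaf_coded_const:
  assumes G: "comm_group G"
  shows "sheaf T (coded_const T G)"
  unfolding sheaf_def
proof (intro conjI allI impI)
  show "presheaf T (coded_const T G)" using presheaf_coded_const[OF G] .
  fix \<U> s assume s: "\<forall>U\<in>\<U>. openin T U \<and> s U \<in> carrier (sec (coded_const T G) U)"
    and comp: "\<forall>U\<in>\<U>. \<forall>V\<in>\<U>. rst (coded_const T G) U (U \<inter> V) (s U) = rst (coded_const T G) V (U \<inter> V) (s V)"
  define f where "f U = fn (s U)" for U
  have f: "s U = Fn (f U)" "f U \<in> U \<rightarrow>\<^sub>E carrier G" "locally_const T U (f U)" if "U \<in> \<U>" for U
  proof -
    have "s U \<in> carrier (sec (coded_const T G) U)" using s that by blast
    then show "s U = Fn (f U)" "f U \<in> U \<rightarrow>\<^sub>E carrier G" "locally_const T U (f U)"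
      by (auto simp: f_def carrier_coded_const(2))
  qed
  have eq: "f U x = f V x" if UV: "U \<in> \<U>" "V \<in> \<U>" "x \<in> U" "x \<in> V" for U V x
  proof -
    have "restrict (f U) (U \<inter> V) = restrict (f V) (U \<inter> V)"
      using comp UV f(1)[OF UV(1)] f(1)[OF UV(2)] by force
    then have "restrict (f U) (U \<inter> V) x = restrict (f V) (U \<inter> V) x" by simp
    then show ?thesis using UV by simp
  qed
  \<comment> \<open>All members of the cover that contain \<open>x\<close> give the same value at
    \<open>x\<close>, so the choice does not matter.\<close>
  define h where "h = (\<lambda>x\<in>\<Union>\<U>. f (SOME U. U \<in> \<U> \<and> x \<in> U) x)"
  have h: "h x = f U x" if "U \<in> \<U>" "x \<in> U" for U x
  proof -
    have "(SOME U. U \<in> \<U> \<and> x \<in> U) \<in> \<U> \<and> x \<in> (SOME U. U \<in> \<U> \<and> x \<in> U)"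
      by (rule someI[of "\<lambda>U. U \<in> \<U> \<and> x \<in> U" U]) (use that in simp)
    then have "f (SOME U. U \<in> \<U> \<and> x \<in> U) x = f U x" using that eq by blast
    then show ?thesis using that by (simp only: h_def restrict_apply) auto
  qed
  have "locally_const T (\<Union>\<U>) h"
  proof (rule locally_constI)
    fix x assume "x \<in> \<Union>\<U>"
    then obtain U where U: "U \<in> \<U>" "x \<in> U" by auto
    from locally_constE[OF f(3)[OF U(1)] U(2)] obtain V where V: "openin T V" "x \<in> V"
      "\<And>y. y \<in> U \<Longrightarrow> y \<in> V \<Longrightarrow> f U y = f U x" by blast
    have "openin T (U \<inter> V)" using s U(1) V(1) by (simp add: openin_Int)
    moreover have "\<forall>y\<in>\<Union>\<U> \<inter> (U \<inter> V). h y = h x"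
    proof
      fix y assume y: "y \<in> \<Union>\<U> \<inter> (U \<inter> V)"
      then have "f U y = f U x" using V(3)[of y] by blast
      then show "h y = h x" using h[OF U(1), of y] h[OF U] y by simp
    qed
    ultimately show "\<exists>V. openin T V \<and> x \<in> V \<and> (\<forall>y\<in>\<Union>\<U> \<inter> V. h y = h x)"
      using U(2) V(2) by (intro exI[of _ "U \<inter> V"] conjI IntI)
  qed
  moreover have "h \<in> \<Union>\<U> \<rightarrow>\<^sub>E carrier G"
  proof (rule PiE_I)
    fix x assume "x \<in> \<Union>\<U>"
    then obtain U where "U \<in> \<U>" "x \<in> U" by auto
    then show "h x \<in> carrier G" using h f(2)[of U] by auto
  qed (simp only: h_def restrict_apply if_False)
  ultimately have 1: "Fn h \<in> carrier (sec (coded_const T G) (\<Union>\<U>))"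
    by (simp add: carrier_coded_const)
  have 2: "rst (coded_const T G) (\<Union>\<U>) U (Fn h) = s U" if "U \<in> \<U>" for U
  proof -
    have "restrict h U = f U"
      using h[OF that] f(2)[OF that] by (auto simp: fun_eq_iff PiE_def extensional_def)
    then show ?thesis using f(1)[OF that] by simp
  qed
  have 3: "t = Fn h" if t: "t \<in> carrier (sec (coded_const T G) (\<Union>\<U>))"
    "\<forall>U\<in>\<U>. rst (coded_const T G) (\<Union>\<U>) U t = s U" for t
  proof -
    obtain g where g: "t = Fn g" "g \<in> \<Union>\<U> \<rightarrow>\<^sub>E carrier G" using t by (auto simp: carrier_coded_const(2))
    have "g x = h x" for x
    proof (cases "x \<in> \<Union>\<U>")
      case True
      then obtain U where U: "U \<in> \<U>" "x \<in> U" by auto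
      then have "restrict g U = f U" using t(2) f(1) g(1) by auto
      then show ?thesis using h[OF U] U by (metis restrict_apply)
    next
      case False
      then show ?thesis using g(2) by (auto simp: h_def PiE_def extensional_def)
    qed
    then show ?thesis using g by auto
  qed
  show "\<exists>!t. t \<in> carrier (sec (coded_const T G) (\<Union>\<U>)) \<and>
      (\<forall>U\<in>\<U>. rst (coded_const T G) (\<Union>\<U>) U t = s U)"
    using 1 2 3 by blast
qed

lemma zero_sheaf_simps [simp]:
  "carrier (sec zero_sheaf U) = {Fn (\<lambda>_. 0)}" "\<one>\<^bsub>sec zero_sheaf U\<^esub> = Fn (\<lambda>_. 0)"
  "s \<otimes>\<^bsub>sec zero_sheaf U\<^esub> t = Fn (\<lambda>_. 0)" "rst zero_sheaf U V s = s"
  by (auto simp: zero_sheaf_def singleton_group_def)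

lemma comm_group_zero_sheaf [simp]: "comm_group (sec zero_sheaf U)"
  by (simp add: zero_sheaf_def)

lemma sheaf_zero_sheaf: "sheaf T zero_sheaf"
  by (auto simp: sheaf_def presheaf_def hom_def)

lemma constant_map_mor:
  assumes h: "h \<in> hom G H" and G: "comm_group G"
  shows "psh_mor T (coded_const T G) (coded_const T H) (constant_map T G h)"
  unfolding constant_map_def
proof (rule psh_morI[OF _ _ _ presheaf_coded_const[OF G]])
  fix U s assume U: "openin T U" and "s \<in> carrier (sec (coded_const T G) U)"
  then obtain f where s: "s = Fn f" "f \<in> U \<rightarrow>\<^sub>E carrier G" "locally_const T U f"
    by (auto simp: carrier_coded_const(2))
  have "locally_const T U (\<lambda>x\<in>U. h (f x))"
    using locally_const_comp[OF s(3), of h] by (simp cong: locally_const_cong)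
  then show "Fn (\<lambda>x\<in>U. h (fn s x)) \<in> carrier (sec (coded_const T H) U)"
    using s h by (auto simp: carrier_coded_const hom_def)
  show "Fn (\<lambda>x\<in>U. h (fn (s \<otimes>\<^bsub>sec (coded_const T G) U\<^esub> t) x)) =
      Fn (\<lambda>x\<in>U. h (fn s x)) \<otimes>\<^bsub>sec (coded_const T H) U\<^esub> Fn (\<lambda>x\<in>U. h (fn t x))"
    if t: "t \<in> carrier (sec (coded_const T G) U)" for t
    using s h t by (auto simp: carrier_coded_const(2) hom_def fun_eq_iff PiE_def Pi_def)
  show "Fn (\<lambda>x\<in>V. h (fn (rst (coded_const T G) U V s) x)) =
      rst (coded_const T H) U V (Fn (\<lambda>x\<in>U. h (fn s x)))" if "V \<subseteq> U" for V
    using that by (auto simp: s(1) fun_eq_iff)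
qed

lemma constant_map_apply [simp]:
  "openin T U \<Longrightarrow> Fn f \<in> carrier (sec (coded_const T G) U) \<Longrightarrow>
    constant_map T G h U (Fn f) = Fn (\<lambda>x\<in>U. h (f x))"
  by (simp add: constant_map_def)

section \<open>Complexes concentrated in degree zero\<close>

lemma sheaf_cplx_simps [simp]:
  "trm (sheaf_cplx T F) n = (if n = 0 then F else zero_sheaf)"
  by (simp add: sheaf_cplx_def Let_def)

lemma dif_sheaf_cplx [simp]:
  "openin T U \<Longrightarrow> s \<in> carrier (sec (trm (sheaf_cplx T F) n) U) \<Longrightarrow>
    dif (sheaf_cplx T F) n U s = \<one>\<^bsub>sec (trm (sheaf_cplx T F) (n + 1)) U\<^esub>"
  by (auto simp: sheaf_cplx_def Let_def)

lemma complex_sheaf_cplx: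
  assumes F: "sheaf T F"
  shows "complex_of_sheaves T (sheaf_cplx T F)"
  unfolding complex_of_sheaves_def
proof (intro conjI allI impI ballI)
  have S: "sheaf T (trm (sheaf_cplx T F) n)" for n using F by (simp add: sheaf_zero_sheaf)
  note P = sheaf_presheaf[OF S]
  fix n
  show "sheaf T (trm (sheaf_cplx T F) n)" by fact
  have cl: "\<one>\<^bsub>sec (trm (sheaf_cplx T F) m) U\<^esub> \<in> carrier (sec (trm (sheaf_cplx T F) m) U)"
    if "openin T U" for m U
    using group.is_monoid[OF presheaf_group[OF P that]] by (rule monoid.one_closed)
  have "psh_mor T (trm (sheaf_cplx T F) n) (trm (sheaf_cplx T F) (n + 1))
    (on_opens T (trm (sheaf_cplx T F) n) (\<lambda>U s. \<one>\<^bsub>sec (trm (sheaf_cplx T F) (n + 1)) U\<^esub>))"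
    by (rule psh_morI[OF _ _ _ P])
      (use cl in \<open>simp_all only: rst_one[OF P] monoid.l_one[OF group.is_monoid[OF presheaf_group[OF P]]]\<close>)
  then show "psh_mor T (trm (sheaf_cplx T F) n) (trm (sheaf_cplx T F) (n + 1)) (dif (sheaf_cplx T F) n)"
    by (simp only: sheaf_cplx_def Let_def cplx.simps)
  fix U s assume U: "openin T U" and s: "s \<in> carrier (sec (trm (sheaf_cplx T F) n) U)"
  have "\<one>\<^bsub>sec (trm (sheaf_cplx T F) (n + 1)) U\<^esub> \<in> carrier (sec (trm (sheaf_cplx T F) (n + 1)) U)"
    using cl U by blast
  then show "dif (sheaf_cplx T F) (n + 1) U (dif (sheaf_cplx T F) n U s)
      = \<one>\<^bsub>sec (trm (sheaf_cplx T F) (n + 2)) U\<^esub>"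
    using dif_sheaf_cplx[OF U, of _ F "n + 1"] dif_sheaf_cplx[OF U s] by (simp only: add.assoc one_add_one)
qed

lemma sheaf_cmap_Hom:
  assumes F: "sheaf T F" and G: "sheaf T G" and \<phi>: "psh_mor T F G \<phi>"
  shows "sheaf_cmap T F G \<phi> \<in> Hom (Ch T) (sheaf_cplx T F) (sheaf_cplx T G)"
proof -
  let ?K = "sheaf_cplx T F" and ?L = "sheaf_cplx T G"
  let ?f = "\<lambda>n::int. if n = 0 then \<phi> else psh_id T zero_sheaf"
  note K = complex_sheaf_cplx[OF F] and L = complex_sheaf_cplx[OF G]
  have m: "psh_mor T (trm ?K n) (trm ?L n) (?f n)" for n
    using \<phi> by (simp add: psh_id_mor[OF sheaf_presheaf[OF sheaf_zero_sheaf]])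
  have "?f (n + 1) U (dif ?K n U s) = dif ?L n U (?f n U s)"
    if U: "openin T U" and s: "s \<in> carrier (sec (trm ?K n) U)" for n U s
    using dif_sheaf_cplx[OF U s] dif_sheaf_cplx[OF U psh_mor_closed[OF m U s]]
      psh_mor_one[OF m[of "n + 1"] cplx_presheaf[OF K] cplx_presheaf[OF L] U] by presburger
  then have "chain_map T ?K ?f ?L"
    using K L m unfolding chain_map_def by blast
  then show ?thesis by (auto simp: sheaf_cmap_def Hom_Ch)
qed

section \<open>The cone of multiplication by an integer\<close>

lemma dsum_sheaf_simps [simp]:
  "Pr a b \<in> carrier (sec (dsum_sheaf F G) U) \<longleftrightarrow> a \<in> carrier (sec F U) \<and> b \<in> carrier (sec G U)"
  "Pr a b \<otimes>\<^bsub>sec (dsum_sheaf F G) U\<^esub> Pr c d = Pr (a \<otimes>\<^bsub>sec F U\<^esub> c) (b \<otimes>\<^bsub>sec G U\<^esub> d)"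
  "\<one>\<^bsub>sec (dsum_sheaf F G) U\<^esub> = Pr \<one>\<^bsub>sec F U\<^esub> \<one>\<^bsub>sec G U\<^esub>"
  "rst (dsum_sheaf F G) U V (Pr a b) = Pr (rst F U V a) (rst G U V b)"
  by (auto simp: dsum_sheaf_def)

lemma carrier_dsum_sheafE:
  assumes "s \<in> carrier (sec (dsum_sheaf F G) U)"
  obtains a b where "s = Pr a b" "a \<in> carrier (sec F U)" "b \<in> carrier (sec G U)"
  using assms by (auto simp: dsum_sheaf_def)

lemma trm_ccone [simp]: "trm (ccone T (K, \<phi>, L)) n = dsum_sheaf (trm K (n + 1)) (trm L n)"
  by (simp add: ccone_def Let_def)

lemma dif_ccone [simp]:
  "openin T U \<Longrightarrow> a \<in> carrier (sec (trm K (n + 1)) U) \<Longrightarrow> b \<in> carrier (sec (trm L n) U) \<Longrightarrow>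
    dif (ccone T (K, \<phi>, L)) n U (Pr a b) =
      Pr (inv\<^bsub>sec (trm K (n + 2)) U\<^esub> (dif K (n + 1) U a))
         (\<phi> (n + 1) U a \<otimes>\<^bsub>sec (trm L (n + 1)) U\<^esub> dif L n U b)"
  by (simp add: ccone_def Let_def)

text \<open>That the cone is a complex is taken as a premise because the cone hypothesis delivers
  it: its isomorphism in \<open>Dbc\<close> has the cone as an object.\<close>

lemma ccone_in_Hom:
  assumes f: "chain_map T K \<phi> L" and C: "complex_of_sheaves T (ccone T (K, \<phi>, L))"
  shows "ccone_in T (K, \<phi>, L) \<in> Hom (Ch T) L (ccone T (K, \<phi>, L))"
proof -
  let ?i = "\<lambda>n. on_opens T (trm L n) (\<lambda>U s. Pr \<one>\<^bsub>sec (trm K (n + 1)) U\<^esub> s)"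
  have K: "complex_of_sheaves T K" and L: "complex_of_sheaves T L" using chain_map_cplx[OF f] by auto
  have gK: "group (sec (trm K n) U)" if "openin T U" for n U
    using presheaf_group[OF cplx_presheaf[OF K] that] .
  have gL: "group (sec (trm L n) U)" if "openin T U" for n U
    using presheaf_group[OF cplx_presheaf[OF L] that] .
  have m: "psh_mor T (trm L n) (trm (ccone T (K, \<phi>, L)) n) (?i n)" for n
    using rst_one[OF cplx_presheaf[OF K]]
    by (intro psh_morI cplx_presheaf[OF L]) (simp_all add: gK group.is_monoid)
  have "?i (n + 1) U (dif L n U s) = dif (ccone T (K, \<phi>, L)) n U (?i n U s)"
    if U: "openin T U" and s: "s \<in> carrier (sec (trm L n) U)" for n U s
  proof -
    have ds: "dif L n U s \<in> carrier (sec (trm L (n + 1)) U)"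
      using psh_mor_closed[OF cplx_dif[OF L] U s] .
    have "dif K (n + 1) U \<one>\<^bsub>sec (trm K (n + 1)) U\<^esub> = \<one>\<^bsub>sec (trm K (n + 2)) U\<^esub>"
      using psh_mor_one[OF cplx_dif[OF K] cplx_presheaf[OF K] cplx_presheaf[OF K] U, of "n + 1"]
      by (simp add: algebra_simps)
    moreover have "\<phi> (n + 1) U \<one>\<^bsub>sec (trm K (n + 1)) U\<^esub> = \<one>\<^bsub>sec (trm L (n + 1)) U\<^esub>"
      using psh_mor_one[OF chain_map_mor[OF f] cplx_presheaf[OF K] cplx_presheaf[OF L] U] .
    ultimately show ?thesis
      using U s ds gK[OF U] gL[OF U] by (simp add: group.is_monoid monoid.inv_one add.assoc)
  qed
  then have "chain_map T L ?i (ccone T (K, \<phi>, L))"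
    using L C m unfolding chain_map_def by blast
  then show ?thesis by (auto simp: ccone_in_def Hom_Ch Let_def)
qed

lemma comm_group_integer_group: "comm_group integer_group"
  using abelian_integer_mod_group[of 0] by (simp add: integer_mod_group_def)

text \<open>Evaluation at a point is a homomorphism into \<open>integer_group\<close>, and
  homomorphisms commute with integral powers; so the abstract power can be computed
  pointwise.\<close>

lemma pow_const_Z:
  assumes U: "openin T U" and f: "Fn f \<in> carrier (sec (const_Z T) U)"
  shows "Fn f [^]\<^bsub>sec (const_Z T) U\<^esub> (k::int) = Fn (\<lambda>x\<in>U. k * f x)"
proof -
  interpret group "sec (const_Z T) U"
    using presheaf_group[OF presheaf_coded_const[OF comm_group_integer_group] U] .
  have "Fn f [^]\<^bsub>sec (const_Z T) U\<^esub> k \<in> carrier (sec (const_Z T) U)" using f by simp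
  then obtain g where g: "Fn f [^]\<^bsub>sec (const_Z T) U\<^esub> k = Fn g" "g \<in> extensional U"
    by (auto simp: carrier_coded_const(2) PiE_def)
  have "g x = k * f x" if x: "x \<in> U" for x
  proof -
    have "(\<lambda>s. fn s x) \<in> hom (sec (const_Z T) U) integer_group"
      using x by (auto simp: hom_def carrier_coded_const(2))
    then have "fn (Fn f [^]\<^bsub>sec (const_Z T) U\<^esub> k) x = fn (Fn f) x [^]\<^bsub>integer_group\<^esub> k"
      using f by (intro hom_int_pow[of "\<lambda>s. fn s x"]) auto
    then show ?thesis using g by simp
  qed
  then show ?thesis using g by (auto simp: extensional_def fun_eq_iff)
qed

text \<open>In degree 0 the first summand of the cone is zero and the second is \<int>, hence the
  reduction reads \<open>pr2\<close>. In every other degree the target is the zero sheaf, whose only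
  section is \<open>Fn (\<lambda>_. 0)\<close>.\<close>

definition cone_mod :: "'p topology \<Rightarrow> nat \<Rightarrow> 'p cmap" where
  "cone_mod T n = (let C = ccone T (cmult T (int n) (sheaf_cplx T (const_Z T))) in
     (C, \<lambda>m. on_opens T (trm C m) (\<lambda>U s. if m = 0 then Fn (\<lambda>x\<in>U. fn (pr2 s) x mod int n) else Fn (\<lambda>_. 0)),
      sheaf_cplx T (const_Zmod T n)))"

text \<open>The cone is \<int> in degrees -1 and 0 with multiplication by \<open>n\<close> as its
  only nontrivial differential. This map is injective with cokernel \<int>/n, and every instance of
  \<open>local_qis\<close> holds over the given open set itself, without shrinking it.\<close>

lemma cone_mod_props:
  assumes n: "n > 0"
    and C: "complex_of_sheaves T (ccone T (cmult T (int n) (sheaf_cplx T (const_Z T))))"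
  shows "cone_mod T n \<in> Hom (Ch T) (ccone T (cmult T (int n) (sheaf_cplx T (const_Z T))))
      (sheaf_cplx T (const_Zmod T n))" (is ?hom)
    and "cone_mod T n \<in> quasi_isos T"
    and "cmp (Ch T) (cone_mod T n) (ccone_in T (cmult T (int n) (sheaf_cplx T (const_Z T)))) =
      sheaf_cmap T (const_Z T) (const_Zmod T n) (constant_map T integer_group (\<lambda>k. k mod int n))"
proof -
  let ?Z = "sheaf_cplx T (const_Z T)" and ?L = "sheaf_cplx T (const_Zmod T n)"
  let ?\<mu> = "\<lambda>m. on_opens T (trm ?Z m) (\<lambda>U s. s [^]\<^bsub>sec (trm ?Z m) U\<^esub> int n)"
  define z :: "'a sec" where "z = Fn (\<lambda>_. 0)"
  define D where "D = ccone T (?Z, ?\<mu>, ?Z)"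
  have cm: "cmult T (int n) ?Z = (?Z, ?\<mu>, ?Z)" by (simp add: cmult_def)
  have D: "complex_of_sheaves T D" using C by (simp only: D_def cm)
  define \<pi> where "\<pi> m = on_opens T (trm D m)
    (\<lambda>U s. if m = 0 then Fn (\<lambda>x\<in>U. fn (pr2 s) x mod int n) else z)" for m :: int
  have cone_mod: "cone_mod T n = (D, \<pi>, ?L)"
    by (simp only: cone_mod_def D_def \<pi>_def[abs_def] z_def cm Let_def)
  have Z: "complex_of_sheaves T ?Z" and L: "complex_of_sheaves T ?L"
    by (simp_all add: complex_sheaf_cplx sheaf_coded_const comm_group_integer_group)
  have \<mu>: "chain_map T ?Z ?\<mu> ?Z" using cmult_Hom[OF Z, of "int n"] by (auto simp: cm Hom_Ch)
  have trmD: "trm D m = dsum_sheaf (trm ?Z (m + 1)) (trm ?Z m)" for m by (simp only: D_def trm_ccone)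
  have D0: "\<exists>g. s = Pr z (Fn g) \<and> Fn g \<in> carrier (sec (const_Z T) U)"
    if "s \<in> carrier (sec (trm D 0) U)" for s U
    using that by (auto simp: trmD z_def carrier_coded_const(2) elim!: carrier_dsum_sheafE)
  \<comment> \<open>The first summand of the cone in degree -1 is the degree-0 term of the
    source.\<close>
  have D1: "\<exists>f. s = Pr (Fn f) z \<and> Fn f \<in> carrier (sec (const_Z T) U)"
    if "s \<in> carrier (sec (trm D (-1)) U)" for s U
    using that by (auto simp: trmD z_def carrier_coded_const(2) elim!: carrier_dsum_sheafE)
  have Dm: "s = \<one>\<^bsub>sec (trm D m) U\<^esub>" if "s \<in> carrier (sec (trm D m) U)" "m \<noteq> 0" "m \<noteq> -1" for s U m
    using that by (auto simp: trmD elim!: carrier_dsum_sheafE)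
  have dif1: "dif D (-1) U (Pr (Fn f) z) = Pr z (Fn (\<lambda>x\<in>U. int n * f x))"
    if U: "openin T U" and f: "Fn f \<in> carrier (sec (const_Z T) U)" for U f
  proof -
    have zc: "z \<in> carrier (sec (trm ?Z (-1)) U)" "Fn f \<in> carrier (sec (trm ?Z (-1 + 1)) U)"
      using f by (auto simp: z_def)
    have "dif D (-1) U (Pr (Fn f) z) \<in> carrier (sec (trm D (-1 + 1)) U)"
      using zc by (intro psh_mor_closed[OF cplx_dif[OF D] U]) (simp add: trmD)
    \<comment> \<open>The first component lies in the zero sheaf, so only the second one has to be
      computed.\<close>
    then obtain b where b: "dif D (-1) U (Pr (Fn f) z) = Pr z b"
      by (auto simp: trmD z_def elim!: carrier_dsum_sheafE)
    have "pr2 (dif D (-1) U (Pr (Fn f) z)) = Fn (\<lambda>x\<in>U. int n * f x)"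
      using dif_ccone[OF U zc(2,1), of ?\<mu>] dif_sheaf_cplx[OF U zc(1)] U f
      by (simp add: D_def pow_const_Z fun_eq_iff)
    then show ?thesis using b by simp
  qed
  have \<pi>mor: "psh_mor T (trm D m) (trm ?L m) (\<pi> m)" for m
    unfolding \<pi>_def
  proof (rule psh_morI[OF _ _ _ cplx_presheaf[OF D]])
    fix U s assume U: "openin T U" and s: "s \<in> carrier (sec (trm D m) U)"
    let ?p = "\<lambda>U s. if m = 0 then Fn (\<lambda>x\<in>U. fn (pr2 s) x mod int n) else z"
    have lc: "locally_const T U (\<lambda>x\<in>U. g x mod int n)" if "locally_const T U g" for g
      using locally_const_comp[OF that, of "\<lambda>k. k mod int n"] by (simp cong: locally_const_cong)
    show "?p U s \<in> carrier (sec (trm ?L m) U)"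
      using D0[of s U] s n lc
      by (auto simp: z_def carrier_coded_const carrier_integer_mod_group)
    show "?p U (s \<otimes>\<^bsub>sec (trm D m) U\<^esub> t) = ?p U s \<otimes>\<^bsub>sec (trm ?L m) U\<^esub> ?p U t"
      if t: "t \<in> carrier (sec (trm D m) U)" for t
    proof (cases "m = 0")
      case True
      then obtain g h where "s = Pr z (Fn g)" "t = Pr z (Fn h)" using D0 s t by blast
      then show ?thesis using True by (auto simp: trmD mod_add_eq fun_eq_iff)
    qed (simp add: z_def)
    show "?p V (rst (trm D m) U V s) = rst (trm ?L m) U V (?p U s)" if V: "openin T V" "V \<subseteq> U" for V
    proof (cases "m = 0")
      case True
      then obtain g where "s = Pr z (Fn g)" using D0 s by blast
      then show ?thesis using True V by (auto simp: trmD fun_eq_iff)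
    qed (simp add: z_def)
  qed
  have \<pi>0: "\<pi> 0 U (Pr z (Fn g)) = Fn (\<lambda>x\<in>U. g x mod int n)"
    if "openin T U" "Fn g \<in> carrier (sec (const_Z T) U)" for U g
    using that by (simp add: \<pi>_def trmD z_def)
  have \<pi>dif: "\<pi> (m + 1) U (dif D m U s) = dif ?L m U (\<pi> m U s)"
    if U: "openin T U" and s: "s \<in> carrier (sec (trm D m) U)" for m U s
  proof (cases "m = -1")
    case True
    then obtain f where f: "s = Pr (Fn f) z" "Fn f \<in> carrier (sec (const_Z T) U)" using D1 s by blast
    have "dif D (-1) U s \<in> carrier (sec (trm D (-1 + 1)) U)"
      using psh_mor_closed[OF cplx_dif[OF D] U] s True by blast
    then have "Fn (\<lambda>x\<in>U. int n * f x) \<in> carrier (sec (const_Z T) U)"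
      using dif1[OF U f(2)] f(1) by (simp add: trmD)
    then have "\<pi> (m + 1) U (dif D m U s) = \<one>\<^bsub>sec (trm ?L (m + 1)) U\<^esub>"
      using \<pi>0[OF U] dif1[OF U f(2)] f(1) True by (simp cong: restrict_cong)
    then show ?thesis using dif_sheaf_cplx[OF U psh_mor_closed[OF \<pi>mor U s]] by simp
  next
    case False
    have "\<pi> (m + 1) U (dif D m U s) \<in> carrier (sec (trm ?L (m + 1)) U)"
      using psh_mor_closed[OF \<pi>mor U psh_mor_closed[OF cplx_dif[OF D] U s]] .
    then show ?thesis using dif_sheaf_cplx[OF U psh_mor_closed[OF \<pi>mor U s]] False by simp
  qed
  have \<pi>: "chain_map T D \<pi> ?L"
    unfolding chain_map_def using D L \<pi>mor \<pi>dif by blast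
  show hom: ?hom using \<pi> by (auto simp: cone_mod Hom_Ch D_def cm)
  \<comment> \<open>The target has trivial differentials, so a class vanishes there only if its
    representative is neutral.\<close>
  have cobL: "coboundaries_of ?L m U = {\<one>\<^bsub>sec (trm ?L m) U\<^esub>}" if U: "openin T U" for m U
  proof -
    have "dif ?L (m - 1) U s = \<one>\<^bsub>sec (trm ?L m) U\<^esub>" if "s \<in> carrier (sec (trm ?L (m - 1)) U)" for s
      using dif_sheaf_cplx[OF U that] by (simp only: diff_add_cancel)
    moreover have "carrier (sec (trm ?L (m - 1)) U) \<noteq> {}"
      using group.is_monoid[OF presheaf_group[OF cplx_presheaf[OF L] U], THEN monoid.one_closed] by blast
    ultimately show ?thesis unfolding coboundaries_of_def by (auto cong: image_cong)
  qed
  have "local_qis T D \<pi> ?L m x" if "x \<in> topspace T" for m x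
    unfolding local_qis_def
  proof (intro conjI allI impI)
    fix U s assume U: "openin T U" "x \<in> U" and s: "s \<in> cocycles D m U"
      and \<pi>s: "\<pi> m U s \<in> coboundaries_of ?L m U"
    have sc: "s \<in> carrier (sec (trm D m) U)" using cocycles_carrier[OF s] .
    have one: "\<one>\<^bsub>sec (trm D m) U\<^esub> \<in> coboundaries_of D m U"
      using subgroup.one_closed[OF subgroup_coboundaries[OF D U(1)]] .
    have "s \<in> coboundaries_of D m U"
    proof -
      consider "m = 0" | "m = -1" | "m \<noteq> 0" "m \<noteq> -1" by blast
      then show ?thesis
      proof cases
        case 1
        then obtain g where g: "s = Pr z (Fn g)" "Fn g \<in> carrier (sec (const_Z T) U)" using D0 sc by blast
        have "Fn (\<lambda>x\<in>U. g x mod int n) = Fn (\<lambda>x\<in>U. 0)"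
          using \<pi>s cobL[OF U(1)] \<pi>0[OF U(1) g(2)] g(1) 1 by simp
        then have "g x mod int n = 0" if "x \<in> U" for x
          using that by (metis (mono_tags, lifting) restrict_apply sec.inject(1))
        then have dvd: "int n * (g x div int n) = g x" if "x \<in> U" for x using that by (simp add: mod_eq_0_iff_dvd)
        \<comment> \<open>Pointwise division of a locally constant function is locally constant, so
          \<open>s\<close> is a coboundary over the whole of \<open>U\<close>.\<close>
        let ?f = "\<lambda>x\<in>U. g x div int n"
        have "locally_const T U ?f"
          using g(2) locally_const_comp[of T U g "\<lambda>k. k div int n"]
          by (simp add: carrier_coded_const cong: locally_const_cong)
        then have f: "Fn ?f \<in> carrier (sec (const_Z T) U)" by (simp add: carrier_coded_const)
        have "(\<lambda>x\<in>U. int n * ?f x) = g"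
          using dvd g(2) by (auto simp: fun_eq_iff carrier_coded_const PiE_def extensional_def)
        then have "s = dif D (-1) U (Pr (Fn ?f) z)" using dif1[OF U(1) f] g(1) by simp
        moreover have "Pr (Fn ?f) z \<in> carrier (sec (trm D (-1)) U)" using f by (simp add: trmD z_def)
        ultimately show ?thesis using 1 by (simp add: coboundaries_of_def)
      next
        case 2
        then obtain f where f: "s = Pr (Fn f) z" "Fn f \<in> carrier (sec (const_Z T) U)" using D1 sc by blast
        have "dif D (-1) U s = \<one>\<^bsub>sec (trm D 0) U\<^esub>" using s 2 by (simp add: cocycles_def)
        then have "Fn (\<lambda>x\<in>U. int n * f x) = Fn (\<lambda>x\<in>U. 0)"
          using dif1[OF U(1) f(2)] f(1) by (simp add: trmD)
        then have "int n * f x = 0" if "x \<in> U" for x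
          using that by (metis (mono_tags, lifting) restrict_apply sec.inject(1))
        \<comment> \<open>Since \<open>n > 0\<close>, multiplication by \<open>n\<close> is
          injective on \<int>; the cone has no nonzero cocycle in degree -1.\<close>
        then have "f = (\<lambda>x\<in>U. 0)"
          using n f(2) by (auto simp: fun_eq_iff carrier_coded_const PiE_def extensional_def)
        then have "s = \<one>\<^bsub>sec (trm D m) U\<^esub>" using f(1) 2 by (simp add: trmD z_def)
        then show ?thesis using one by simp
      next
        case 3
        then show ?thesis using Dm[OF sc] one by simp
      qed
    qed
    then show "\<exists>W. openin T W \<and> x \<in> W \<and> W \<subseteq> U \<and> rst (trm D m) U W s \<in> coboundaries_of D m W"
      using U rst_id[OF cplx_presheaf[OF D] U(1) sc] by (intro exI[of _ U]) simp
  next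
    fix U t assume U: "openin T U" "x \<in> U" and t: "t \<in> cocycles ?L m U"
    have tc: "t \<in> carrier (sec (trm ?L m) U)" using cocycles_carrier[OF t] .
    interpret GL: group "sec (trm ?L m) U" using presheaf_group[OF cplx_presheaf[OF L] U(1)] .
    have "\<exists>s\<in>cocycles D m U. \<pi> m U s = t"
    proof (cases "m = 0")
      case True
      then obtain f where f: "t = Fn f" "f \<in> U \<rightarrow>\<^sub>E {0..<int n}" "locally_const T U f"
        using tc n by (auto simp: carrier_coded_const(2) carrier_integer_mod_group)
      \<comment> \<open>The elements of \<open>integer_mod_group n\<close> are the integers from 0
        to \<open>n - 1\<close>, so a section of \<int>/n is also a section of \<int> and serves as
        its own lift.\<close>
      have fZ: "Fn f \<in> carrier (sec (const_Z T) U)" using f by (auto simp: carrier_coded_const)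
      have sc: "Pr z (Fn f) \<in> carrier (sec (trm D 0) U)" using fZ by (simp add: trmD z_def)
      have "dif D 0 U (Pr z (Fn f)) = \<one>\<^bsub>sec (trm D (0 + 1)) U\<^esub>"
        using psh_mor_closed[OF cplx_dif[OF D] U(1) sc] by (intro Dm) auto
      then have "Pr z (Fn f) \<in> cocycles D 0 U" using sc by (simp add: cocycles_def)
      moreover have "(\<lambda>x\<in>U. f x mod int n) = f"
        using f(2) by (auto simp: fun_eq_iff PiE_def Pi_def extensional_def)
      then have "\<pi> 0 U (Pr z (Fn f)) = t" using \<pi>0[OF U(1) fZ] f(1) by simp
      ultimately show ?thesis using True by blast
    next
      case False
      have e: "\<one>\<^bsub>sec (trm D m) U\<^esub> \<in> cocycles D m U"
        using subgroup.one_closed[OF subgroup_cocycles[OF D U(1)]] .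
      then have "\<pi> m U \<one>\<^bsub>sec (trm D m) U\<^esub> \<in> carrier (sec (trm ?L m) U)"
        using psh_mor_closed[OF \<pi>mor U(1) cocycles_carrier] by blast
      then have "\<pi> m U \<one>\<^bsub>sec (trm D m) U\<^esub> = t" using tc False by simp
      then show ?thesis using e by blast
    qed
    then obtain s where s: "s \<in> cocycles D m U" "\<pi> m U s = t" by blast
    have "rst (trm ?L m) U U t = \<one>\<^bsub>sec (trm ?L m) U\<^esub> \<otimes>\<^bsub>sec (trm ?L m) U\<^esub> \<pi> m U s"
      using rst_id[OF cplx_presheaf[OF L] U(1) tc] s(2) GL.l_one[OF tc] by (simp only:)
    then show "\<exists>W s. openin T W \<and> x \<in> W \<and> W \<subseteq> U \<and> s \<in> cocycles D m W \<and>
         (\<exists>b\<in>coboundaries_of ?L m W. rst (trm ?L m) U W t = b \<otimes>\<^bsub>sec (trm ?L m) W\<^esub> \<pi> m W s)"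
      using U s(1) cobL[OF U(1)] by (intro exI[of _ U] exI[of _ s]) blast
  qed
  then show "cone_mod T n \<in> quasi_isos T"
    using \<pi> by (simp add: cone_mod quasi_isos_iff)
  \<comment> \<open>The compatibility with the reduction that \<open>canonical_ident\<close> demands
    holds already for chain maps, degree by degree.\<close>
  have "psh_comp T (trm ?Z m) (\<pi> m) (on_opens T (trm ?Z m) (\<lambda>U s. Pr \<one>\<^bsub>sec (trm ?Z (m + 1)) U\<^esub> s))
      = (if m = 0 then constant_map T integer_group (\<lambda>k. k mod int n) else psh_id T zero_sheaf)" for m
  proof (cases "m = 0")
    case True
    have "psh_comp T (const_Z T) (\<pi> 0) (on_opens T (const_Z T) (\<lambda>U s. Pr z s))
        = constant_map T integer_group (\<lambda>k. k mod int n)"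
      unfolding psh_comp_def constant_map_def
    proof (rule on_opens_cong)
      fix U s assume U: "openin T U" and s: "s \<in> carrier (sec (const_Z T) U)"
      then obtain g where "s = Fn g" by (auto simp: carrier_coded_const(2))
      then show "\<pi> 0 U (on_opens T (const_Z T) (\<lambda>U. Pr z) U s) = Fn (\<lambda>x\<in>U. fn s x mod int n)"
        using U s \<pi>0[OF U] by simp
    qed
    then show ?thesis using True by (simp add: z_def)
  next
    case False
    have "psh_comp T zero_sheaf (\<pi> m) (on_opens T zero_sheaf (\<lambda>U s. Pr \<one>\<^bsub>sec (trm ?Z (m + 1)) U\<^esub> s))
        = psh_id T zero_sheaf"
      unfolding psh_comp_def psh_id_def
    proof (rule on_opens_cong)
      fix U s assume U: "openin T U" and s: "s \<in> carrier (sec (zero_sheaf :: 'a sh) U)"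
      have "Pr \<one>\<^bsub>sec (trm ?Z (m + 1)) U\<^esub> s \<in> carrier (sec (trm D m) U)"
        using s False group.is_monoid[OF presheaf_group[OF cplx_presheaf[OF Z] U], THEN monoid.one_closed]
        by (simp only: trmD dsum_sheaf_simps sheaf_cplx_simps if_False)
      from psh_mor_closed[OF \<pi>mor U this]
      have "\<pi> m U (Pr \<one>\<^bsub>sec (trm ?Z (m + 1)) U\<^esub> s) = z" using False by (simp add: z_def)
      moreover have "s = z" using s by (simp add: z_def)
      ultimately show "\<pi> m U (on_opens T zero_sheaf (\<lambda>U. Pr \<one>\<^bsub>sec (trm ?Z (m + 1)) U\<^esub>) U s) = s"
        by (subst on_opens_apply[OF U s]) simp
    qed
    then show ?thesis using False by simp
  qed
  then show "cmp (Ch T) (cone_mod T n) (ccone_in T (cmult T (int n) ?Z)) =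
      sheaf_cmap T (const_Z T) (const_Zmod T n) (constant_map T integer_group (\<lambda>k. k mod int n))"
    by (simp only: cone_mod ccone_in_def cm Let_def fst_conv snd_conv Ch_simps sheaf_cmap_def)
qed

section \<open>Constructibility\<close>

lemma one_stalk:
  "openin T U \<Longrightarrow> x \<in> U \<Longrightarrow> presheaf T F \<Longrightarrow> germ T F x U \<one>\<^bsub>sec F U\<^esub> = \<one>\<^bsub>stalk T F x\<^esub>"
  using germ_rst[of T F "topspace T" U x "\<one>\<^bsub>sec F (topspace T)\<^esub>"]
    rst_one[of T F "topspace T" U] openin_subset[of T U]
    monoid.one_closed[OF group.is_monoid[OF presheaf_group[of T F "topspace T"]]]
  by (simp add: stalk_def)

text \<open>Sections of \<open>F\<close> have values in \<open>G\<close> at the points of \<open>S\<close>, and the value at a point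
  determines the germ; \<open>c g\<close> is a section with constant value \<open>g\<close>.\<close>

locale presheaf_evaluation =
  fixes T :: "'p topology" and F :: "('p, 'u) psh" and S :: "'p set" and G :: "'g monoid"
    and ev :: "'p set \<Rightarrow> 'u \<Rightarrow> 'p \<Rightarrow> 'g" and c :: "'g \<Rightarrow> 'u"
  assumes F: "presheaf T F" and S: "S \<subseteq> topspace T" and G: "group G"
    and ev_closed: "openin T U \<Longrightarrow> s \<in> carrier (sec F U) \<Longrightarrow> y \<in> U \<Longrightarrow> y \<in> S \<Longrightarrow> ev U s y \<in> carrier G"
    and ev_mult: "openin T U \<Longrightarrow> s \<in> carrier (sec F U) \<Longrightarrow> t \<in> carrier (sec F U) \<Longrightarrow> y \<in> U \<Longrightarrow> y \<in> S \<Longrightarrow>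
      ev U (s \<otimes>\<^bsub>sec F U\<^esub> t) y = ev U s y \<otimes>\<^bsub>G\<^esub> ev U t y"
    and ev_rst: "openin T U \<Longrightarrow> openin T V \<Longrightarrow> V \<subseteq> U \<Longrightarrow> s \<in> carrier (sec F U) \<Longrightarrow> y \<in> V \<Longrightarrow> y \<in> S \<Longrightarrow>
      ev V (rst F U V s) y = ev U s y"
    and ev_lc: "openin T U \<Longrightarrow> s \<in> carrier (sec F U) \<Longrightarrow> locally_const (subtopology T S) (U \<inter> S) (ev U s)"
    and ev_inj: "openin T U \<Longrightarrow> s \<in> carrier (sec F U) \<Longrightarrow> t \<in> carrier (sec F U) \<Longrightarrow> y \<in> U \<Longrightarrow> y \<in> S \<Longrightarrow>
      ev U s y = ev U t y \<Longrightarrow> \<exists>W. openin T W \<and> y \<in> W \<and> W \<subseteq> U \<and> rst F U W s = rst F U W t"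
    and c_closed: "g \<in> carrier G \<Longrightarrow> c g \<in> carrier (sec F (topspace T))"
    and ev_c: "g \<in> carrier G \<Longrightarrow> y \<in> S \<Longrightarrow> ev (topspace T) (c g) y = g"
begin

text \<open>The elements of \<open>G\<close> name germs at all points of \<open>S\<close> at once,
  through the global sections \<open>c g\<close>. This is what makes stalks at different points
  comparable.\<close>

definition const_germ :: "'p \<Rightarrow> 'g \<Rightarrow> ('p set \<times> 'u) set" where
  "const_germ y g = germ T F y (topspace T) (c g)"

definition germ_value :: "'p \<Rightarrow> ('p set \<times> 'u) set \<Rightarrow> 'g" where
  "germ_value y = inv_into (carrier G) (const_germ y)"

lemma germ_eq_const_germ:
  assumes U: "openin T U" "y \<in> U" and y: "y \<in> S" and s: "s \<in> carrier (sec F U)"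
  shows "germ T F y U s = const_germ y (ev U s y)"
proof -
  have U': "U \<subseteq> topspace T" using openin_subset[OF U(1)] .
  let ?g = "ev U s y"
  have g: "?g \<in> carrier G" using ev_closed[OF U(1) s U(2) y] .
  note r = rst_closed[OF F openin_topspace U(1) U' c_closed[OF g]]
  have "ev U (rst F (topspace T) U (c ?g)) y = ?g"
    using ev_rst[OF openin_topspace U(1) U' c_closed[OF g] U(2) y] ev_c[OF g y] by simp
  then obtain W where W: "openin T W" "y \<in> W" "W \<subseteq> U"
    "rst F U W s = rst F U W (rst F (topspace T) U (c ?g))"
    using ev_inj[OF U(1) s r U(2) y] by auto
  have yt: "y \<in> topspace T" using U U' by auto
  show ?thesis
    unfolding const_germ_def germ_eq_iff[OF F U s openin_topspace yt c_closed[OF g]]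
    using W U' rst_rst[OF F openin_topspace U(1) W(1) U' W(3) c_closed[OF g]]
    by (intro exI[of _ W]) auto
qed

lemma const_germ_closed: "y \<in> S \<Longrightarrow> g \<in> carrier G \<Longrightarrow> const_germ y g \<in> carrier (stalk T F y)"
  unfolding const_germ_def using S c_closed by (auto intro: germ_in_stalk)

lemma inj_const_germ:
  assumes y: "y \<in> S"
  shows "inj_on (const_germ y) (carrier G)"
proof (rule inj_onI)
  fix g h assume g: "g \<in> carrier G" and h: "h \<in> carrier G" and "const_germ y g = const_germ y h"
  moreover have yt: "y \<in> topspace T" using y S by auto
  ultimately have "\<exists>W. openin T W \<and> y \<in> W \<and> W \<subseteq> topspace T \<inter> topspace T \<and>
      rst F (topspace T) W (c g) = rst F (topspace T) W (c h)"
    unfolding const_germ_def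
    by (subst (asm) germ_eq_iff[OF F openin_topspace yt c_closed[OF g] openin_topspace yt c_closed[OF h]])
  then obtain W where W: "openin T W" "y \<in> W" "W \<subseteq> topspace T"
    "rst F (topspace T) W (c g) = rst F (topspace T) W (c h)"
    by (elim exE conjE) simp
  from W(4) have "ev W (rst F (topspace T) W (c g)) y = ev W (rst F (topspace T) W (c h)) y" by (rule arg_cong)
  then show "g = h"
    using ev_rst[OF openin_topspace W(1,3) c_closed[OF g] W(2) y] ev_rst[OF openin_topspace W(1,3) c_closed[OF h] W(2) y]
      ev_c[OF g y] ev_c[OF h y] by (simp only:)
qed

lemma stalk_const_germ:
  assumes y: "y \<in> S"
  shows "carrier (stalk T F y) = const_germ y ` carrier G"
proof
  show "carrier (stalk T F y) \<subseteq> const_germ y ` carrier G"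
  proof
    fix a assume "a \<in> carrier (stalk T F y)"
    then obtain U s where "a = germ T F y U s" "openin T U" "y \<in> U" "s \<in> carrier (sec F U)"
      by (auto simp: carrier_stalk)
    then show "a \<in> const_germ y ` carrier G" using germ_eq_const_germ[of U y s] ev_closed[of U s y] y by simp
  qed
  show "const_germ y ` carrier G \<subseteq> carrier (stalk T F y)" using const_germ_closed[OF y] by auto
qed

lemma const_germ_mult:
  assumes y: "y \<in> S" and g: "g \<in> carrier G" and h: "h \<in> carrier G"
  shows "const_germ y g \<otimes>\<^bsub>stalk T F y\<^esub> const_germ y h = const_germ y (g \<otimes>\<^bsub>G\<^esub> h)"
proof -
  have yt: "y \<in> topspace T" using y S by auto
  have m: "c g \<otimes>\<^bsub>sec F (topspace T)\<^esub> c h \<in> carrier (sec F (topspace T))"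
    using monoid.m_closed[OF group.is_monoid[OF presheaf_group[OF F openin_topspace]]] c_closed g h by blast
  have "const_germ y g \<otimes>\<^bsub>stalk T F y\<^esub> const_germ y h
      = germ T F y (topspace T) (c g \<otimes>\<^bsub>sec F (topspace T)\<^esub> c h)"
    unfolding const_germ_def by (rule stalk_mult[OF F openin_topspace yt c_closed[OF g] c_closed[OF h]])
  also have "\<dots> = const_germ y (ev (topspace T) (c g \<otimes>\<^bsub>sec F (topspace T)\<^esub> c h) y)"
    by (rule germ_eq_const_germ[OF openin_topspace yt y m])
  also have "ev (topspace T) (c g \<otimes>\<^bsub>sec F (topspace T)\<^esub> c h) y = g \<otimes>\<^bsub>G\<^esub> h"
    using ev_mult[OF openin_topspace c_closed[OF g] c_closed[OF h] yt y] ev_c g h y by simp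
  finally show ?thesis .
qed

text \<open>The stalk is a bare record; its group laws are carried over from \<open>G\<close> along
  the surjective homomorphism \<open>const_germ y\<close>.\<close>

lemma group_stalk:
  assumes y: "y \<in> S"
  shows "group (stalk T F y)"
proof -
  interpret G: group G by (rule G)
  have hom: "const_germ y \<in> hom G (stalk T F y)"
    using const_germ_closed[OF y] const_germ_mult[OF y] by (intro homI) auto
  have yt: "y \<in> topspace T" using y S by auto
  interpret FT: group "sec F (topspace T)" using presheaf_group[OF F openin_topspace] .
  let ?e = "ev (topspace T) \<one>\<^bsub>sec F (topspace T)\<^esub> y"
  have e: "?e \<in> carrier G" using ev_closed[OF openin_topspace FT.one_closed yt y] .
  \<comment> \<open>The value of the neutral section is idempotent in \<open>G\<close>, hence
    neutral. This matches the \<open>one\<close> of the stalk with that of the homomorphic image of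
    \<open>G\<close>.\<close>
  have "?e \<otimes>\<^bsub>G\<^esub> ?e = ?e"
    using ev_mult[OF openin_topspace FT.one_closed FT.one_closed yt y] by simp
  then have "?e = \<one>\<^bsub>G\<^esub>" using e by simp
  then have "const_germ y \<one>\<^bsub>G\<^esub> = \<one>\<^bsub>stalk T F y\<^esub>"
    using germ_eq_const_germ[OF openin_topspace yt y FT.one_closed] one_stalk[OF openin_topspace yt F] by simp
  then have "(stalk T F y)\<lparr>carrier := const_germ y ` carrier G, one := const_germ y \<one>\<^bsub>G\<^esub>\<rparr> = stalk T F y"
    using stalk_const_germ[OF y] by (simp add: stalk_def)
  then show ?thesis using G.hom_imp_img_group[OF hom] by simp
qed

lemma germ_value_germ:
  assumes "openin T U" "y \<in> U" "y \<in> S" "s \<in> carrier (sec F U)"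
  shows "germ_value y (germ T F y U s) = ev U s y"
  unfolding germ_value_def germ_eq_const_germ[OF assms]
  using assms by (intro inv_into_f_f inj_const_germ ev_closed)

lemma germ_value_const_germ: "y \<in> S \<Longrightarrow> g \<in> carrier G \<Longrightarrow> germ_value y (const_germ y g) = g"
  unfolding germ_value_def by (intro inv_into_f_f inj_const_germ)

lemma const_germ_value: "y \<in> S \<Longrightarrow> a \<in> carrier (stalk T F y) \<Longrightarrow> const_germ y (germ_value y a) = a"
  unfolding germ_value_def stalk_const_germ by (rule f_inv_into_f)

lemma germ_value_closed: "y \<in> S \<Longrightarrow> a \<in> carrier (stalk T F y) \<Longrightarrow> germ_value y a \<in> carrier G"
  unfolding germ_value_def stalk_const_germ by (rule inv_into_into)

lemma germ_value_mult:
  assumes "y \<in> S" "a \<in> carrier (stalk T F y)" "b \<in> carrier (stalk T F y)"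
  shows "germ_value y (a \<otimes>\<^bsub>stalk T F y\<^esub> b) = germ_value y a \<otimes>\<^bsub>G\<^esub> germ_value y b"
proof -
  interpret group G by (rule G)
  have "a \<otimes>\<^bsub>stalk T F y\<^esub> b = const_germ y (germ_value y a \<otimes>\<^bsub>G\<^esub> germ_value y b)"
    using const_germ_mult[OF assms(1) germ_value_closed[OF assms(1,2)] germ_value_closed[OF assms(1,3)]]
      const_germ_value assms by simp
  then show ?thesis using germ_value_const_germ germ_value_closed assms by simp
qed

lemma germ_sheaf_sec:
  "carrier (sec (germ_sheaf T F S) W) = {s \<in> extensional W. \<forall>x\<in>W. \<exists>U d. openin T U \<and> x \<in> U \<and>
      d \<in> carrier (sec F U) \<and> (\<forall>y\<in>W \<inter> U. s y = germ T F y U d)}"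
  "s \<otimes>\<^bsub>sec (germ_sheaf T F S) W\<^esub> t = (\<lambda>x\<in>W. s x \<otimes>\<^bsub>stalk T F x\<^esub> t x)"
  "rst (germ_sheaf T F S) U V s = restrict s V"
  by (auto simp: germ_sheaf_def)

lemma germ_sheaf_secE:
  assumes "s \<in> carrier (sec (germ_sheaf T F S) W)" "x \<in> W"
  obtains U d where "openin T U" "x \<in> U" "d \<in> carrier (sec F U)"
    "\<And>y. y \<in> W \<Longrightarrow> y \<in> U \<Longrightarrow> s y = germ T F y U d"
proof -
  from assms have "\<exists>U d. openin T U \<and> x \<in> U \<and> d \<in> carrier (sec F U) \<and> (\<forall>y\<in>W \<inter> U. s y = germ T F y U d)"
    by (simp add: germ_sheaf_sec)
  then show ?thesis using that by (elim exE conjE) simp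
qed

lemma germ_sheaf_secI:
  assumes "s \<in> extensional W" and "\<And>x. x \<in> W \<Longrightarrow> \<exists>U d. openin T U \<and> x \<in> U \<and>
      d \<in> carrier (sec F U) \<and> (\<forall>y\<in>W \<inter> U. s y = germ T F y U d)"
  shows "s \<in> carrier (sec (germ_sheaf T F S) W)"
  using assms by (simp add: germ_sheaf_sec)

lemma locally_const_germ_value:
  assumes W: "W \<subseteq> S" and s: "s \<in> carrier (sec (germ_sheaf T F S) W)"
  shows "locally_const (subtopology T S) W (\<lambda>y. germ_value y (s y))"
proof (rule locally_constI)
  fix x assume x: "x \<in> W"
  from germ_sheaf_secE[OF s x] obtain U d where U: "openin T U" "x \<in> U" "d \<in> carrier (sec F U)"
    "\<And>y. y \<in> W \<Longrightarrow> y \<in> U \<Longrightarrow> s y = germ T F y U d" by blast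
  have v: "germ_value y (s y) = ev U d y" if "y \<in> W" "y \<in> U" for y
    using U(4)[OF that] germ_value_germ[OF U(1) that(2) _ U(3)] that W by auto
  have "x \<in> U \<inter> S" using x W U by auto
  from locally_constE[OF ev_lc[OF U(1,3)] this] obtain V where V: "openin (subtopology T S) V" "x \<in> V"
    "\<And>y. y \<in> U \<inter> S \<Longrightarrow> y \<in> V \<Longrightarrow> ev U d y = ev U d x" by blast
  have "openin (subtopology T S) (V \<inter> (U \<inter> S))"
    using V(1) openin_subtopology_Int_trace[OF U(1)] by (rule openin_Int)
  moreover have "\<forall>y\<in>W \<inter> (V \<inter> (U \<inter> S)). germ_value y (s y) = germ_value x (s x)"
  proof
    fix y assume y: "y \<in> W \<inter> (V \<inter> (U \<inter> S))"
    then show "germ_value y (s y) = germ_value x (s x)"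
      using v[of y] v[OF x U(2)] V(3)[of y] by simp
  qed
  ultimately show "\<exists>V. openin (subtopology T S) V \<and> x \<in> V \<and> (\<forall>y\<in>W \<inter> V. germ_value y (s y) = germ_value x (s x))"
    using V(2) \<open>x \<in> U \<inter> S\<close> by (intro exI[of _ "V \<inter> (U \<inter> S)"]) simp
qed

lemma germ_sheaf_sec_stalk:
  assumes s: "s \<in> carrier (sec (germ_sheaf T F S) W)" and x: "x \<in> W"
  shows "s x \<in> carrier (stalk T F x)"
proof -
  from germ_sheaf_secE[OF s x] obtain U d where U: "openin T U" "x \<in> U" "d \<in> carrier (sec F U)"
    "\<And>y. y \<in> W \<Longrightarrow> y \<in> U \<Longrightarrow> s y = germ T F y U d" by blast
  then show ?thesis using germ_in_stalk[OF U(1,2,3)] x by simp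
qed

lemma germ_sheaf_mult_closed:
  assumes s: "s \<in> carrier (sec (germ_sheaf T F S) W)" and t: "t \<in> carrier (sec (germ_sheaf T F S) W)"
  shows "(\<lambda>x\<in>W. s x \<otimes>\<^bsub>stalk T F x\<^esub> t x) \<in> carrier (sec (germ_sheaf T F S) W)"
proof (rule germ_sheaf_secI)
  fix x assume x: "x \<in> W"
  from germ_sheaf_secE[OF s x] obtain U a where U: "openin T U" "x \<in> U" "a \<in> carrier (sec F U)"
    "\<And>y. y \<in> W \<Longrightarrow> y \<in> U \<Longrightarrow> s y = germ T F y U a" by blast
  from germ_sheaf_secE[OF t x] obtain V b where V: "openin T V" "x \<in> V" "b \<in> carrier (sec F V)"
    "\<And>y. y \<in> W \<Longrightarrow> y \<in> V \<Longrightarrow> t y = germ T F y V b" by blast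
  let ?Q = "U \<inter> V"
  have Q: "openin T ?Q" using U V by (simp add: openin_Int)
  note ra = rst_closed[OF F U(1) Q inf_le1 U(3)] and rb = rst_closed[OF F V(1) Q inf_le2 V(3)]
  have "\<forall>y\<in>W \<inter> ?Q. (\<lambda>x\<in>W. s x \<otimes>\<^bsub>stalk T F x\<^esub> t x) y
      = germ T F y ?Q (rst F U ?Q a \<otimes>\<^bsub>sec F ?Q\<^esub> rst F V ?Q b)"
  proof
    fix y assume y: "y \<in> W \<inter> ?Q"
    then have "s y = germ T F y ?Q (rst F U ?Q a)" "t y = germ T F y ?Q (rst F V ?Q b)"
      using U(4)[of y] V(4)[of y] germ_rst[OF F U(1) Q _ inf_le1 U(3), of y]
        germ_rst[OF F V(1) Q _ inf_le2 V(3), of y] by simp_all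
    then show "(\<lambda>x\<in>W. s x \<otimes>\<^bsub>stalk T F x\<^esub> t x) y
        = germ T F y ?Q (rst F U ?Q a \<otimes>\<^bsub>sec F ?Q\<^esub> rst F V ?Q b)"
      using y stalk_mult[OF F Q _ ra rb, of y] by simp
  qed
  moreover have "rst F U ?Q a \<otimes>\<^bsub>sec F ?Q\<^esub> rst F V ?Q b \<in> carrier (sec F ?Q)"
    using monoid.m_closed[OF group.is_monoid[OF presheaf_group[OF F Q]] ra rb] .
  ultimately show "\<exists>U d. openin T U \<and> x \<in> U \<and> d \<in> carrier (sec F U) \<and>
      (\<forall>y\<in>W \<inter> U. (\<lambda>x\<in>W. s x \<otimes>\<^bsub>stalk T F x\<^esub> t x) y = germ T F y U d)"
    using Q U(2) V(2) by (intro exI[of _ ?Q] exI conjI IntI)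
qed simp

lemma germ_sheaf_rst_closed:
  assumes s: "s \<in> carrier (sec (germ_sheaf T F S) W)" and V: "V \<subseteq> W"
  shows "restrict s V \<in> carrier (sec (germ_sheaf T F S) V)"
proof (rule germ_sheaf_secI)
  fix x assume x: "x \<in> V"
  then have "x \<in> W" using V by auto
  from germ_sheaf_secE[OF s this] obtain U d where U: "openin T U" "x \<in> U" "d \<in> carrier (sec F U)"
    "\<And>y. y \<in> W \<Longrightarrow> y \<in> U \<Longrightarrow> s y = germ T F y U d" by blast
  have "\<forall>y\<in>V \<inter> U. restrict s V y = germ T F y U d" using U(4) V by auto
  then show "\<exists>U d. openin T U \<and> x \<in> U \<and> d \<in> carrier (sec F U) \<and> (\<forall>y\<in>V \<inter> U. restrict s V y = germ T F y U d)"
    using U(1-3) by (intro exI conjI)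
qed simp

text \<open>A germ at \<open>y\<close> is moved to the germ at \<open>x\<close> with the same value
  in \<open>G\<close>, which trivializes the sheaf over all of \<open>S\<close> in one stroke. Local
  constancy of values makes the result a section of the constant sheaf, and the sections
  \<open>c g\<close> give the inverse.\<close>

lemma germ_sheaf_iso_const:
  assumes x: "x \<in> S"
  defines "\<phi> \<equiv> on_opens (subtopology T S) (germ_sheaf T F S)
    (\<lambda>W s. \<lambda>y\<in>W. const_germ x (germ_value y (s y)))"
  shows "psh_iso (subtopology T S) (germ_sheaf T F S) (const_sheaf (subtopology T S) (stalk T F x)) \<phi>"
proof -
  let ?T = "subtopology T S" and ?GS = "germ_sheaf T F S" and ?C = "const_sheaf (subtopology T S) (stalk T F x)"
  have C: "carrier (sec ?C U) = {s \<in> U \<rightarrow>\<^sub>E carrier (stalk T F x). locally_const ?T U s}"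
    "s \<otimes>\<^bsub>sec ?C U\<^esub> t = (\<lambda>y\<in>U. s y \<otimes>\<^bsub>stalk T F x\<^esub> t y)" "rst ?C U V s = restrict s V" for U V s t
    by (auto simp: const_sheaf_def locally_const_def)
  have sub: "W \<subseteq> S" if "openin ?T W" for W using openin_subset[OF that] by simp
  have \<phi>: "\<phi> W s = (\<lambda>y\<in>W. const_germ x (germ_value y (s y)))"
    if "openin ?T W" "s \<in> carrier (sec ?GS W)" for W s
    using that by (simp add: \<phi>_def)
  have closed: "\<phi> W s \<in> carrier (sec ?C W)" if W: "openin ?T W" and s: "s \<in> carrier (sec ?GS W)" for W s
  proof -
    have "locally_const ?T W (\<lambda>y\<in>W. const_germ x (germ_value y (s y)))"
      using locally_const_comp[OF locally_const_germ_value[OF sub[OF W] s], of "const_germ x"]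
      by (simp cong: locally_const_cong)
    moreover have "const_germ x (germ_value y (s y)) \<in> carrier (stalk T F x)" if "y \<in> W" for y
      using that sub[OF W] germ_sheaf_sec_stalk[OF s that] by (intro const_germ_closed[OF x] germ_value_closed) auto
    ultimately show ?thesis by (auto simp: \<phi>[OF W s] C)
  qed
  have mult: "\<phi> W (s \<otimes>\<^bsub>sec ?GS W\<^esub> t) = \<phi> W s \<otimes>\<^bsub>sec ?C W\<^esub> \<phi> W t"
    if W: "openin ?T W" and s: "s \<in> carrier (sec ?GS W)" and t: "t \<in> carrier (sec ?GS W)" for W s t
  proof -
    have "const_germ x (germ_value y (s y \<otimes>\<^bsub>stalk T F y\<^esub> t y)) =
        const_germ x (germ_value y (s y)) \<otimes>\<^bsub>stalk T F x\<^esub> const_germ x (germ_value y (t y))" if y: "y \<in> W" for y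
    proof -
      have yS: "y \<in> S" using y sub[OF W] by auto
      note a = germ_sheaf_sec_stalk[OF s y] and b = germ_sheaf_sec_stalk[OF t y]
      show ?thesis
        by (simp only: germ_value_mult[OF yS a b] const_germ_mult[OF x germ_value_closed[OF yS a] germ_value_closed[OF yS b]])
    qed
    then show ?thesis
      using \<phi>[OF W germ_sheaf_mult_closed[OF s t]]
      by (simp add: germ_sheaf_sec(2) C(2) \<phi>[OF W s] \<phi>[OF W t] cong: restrict_cong)
  qed
  have rst: "\<phi> V (rst ?GS U V s) = rst ?C U V (\<phi> U s)"
    if U: "openin ?T U" and V: "openin ?T V" "V \<subseteq> U" and s: "s \<in> carrier (sec ?GS U)" for U V s
    using \<phi>[OF V(1) germ_sheaf_rst_closed[OF s V(2)]] V(2)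
    by (auto simp: germ_sheaf_sec(3) C(3) \<phi>[OF U s] fun_eq_iff)
  have mor: "psh_mor ?T ?GS ?C \<phi>"
    unfolding psh_mor_def
  proof (intro conjI allI impI ballI)
    show "\<phi> = on_opens ?T ?GS \<phi>" by (simp add: \<phi>_def)
  qed (use closed mult rst in \<open>auto intro!: homI\<close>)
  have "bij_betw (\<phi> W) (carrier (sec ?GS W)) (carrier (sec ?C W))" if W: "openin ?T W" for W
  proof (rule bij_betw_imageI)
    show "inj_on (\<phi> W) (carrier (sec ?GS W))"
    proof (rule inj_onI)
      fix s t assume s: "s \<in> carrier (sec ?GS W)" and t: "t \<in> carrier (sec ?GS W)" and eq: "\<phi> W s = \<phi> W t"
      have "s y = t y" if y: "y \<in> W" for y
      proof -
        have yS: "y \<in> S" using y sub[OF W] by auto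
        note a = germ_sheaf_sec_stalk[OF s y] and b = germ_sheaf_sec_stalk[OF t y]
        have "const_germ x (germ_value y (s y)) = const_germ x (germ_value y (t y))"
          using fun_cong[OF eq, of y] y by (simp add: \<phi>[OF W s] \<phi>[OF W t])
        then have "germ_value y (s y) = germ_value y (t y)"
          using inj_onD[OF inj_const_germ[OF x] _ germ_value_closed[OF yS a] germ_value_closed[OF yS b]] by blast
        then show ?thesis using const_germ_value[OF yS a] const_germ_value[OF yS b] by metis
      qed
      moreover have "s \<in> extensional W" "t \<in> extensional W" using s t by (auto simp: germ_sheaf_sec(1))
      ultimately show "s = t" by (intro extensionalityI)
    qed
    show "\<phi> W ` carrier (sec ?GS W) = carrier (sec ?C W)"
    proof (intro equalityI subsetI)
      fix t assume "t \<in> \<phi> W ` carrier (sec ?GS W)"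
      then show "t \<in> carrier (sec ?C W)" using closed[OF W] by auto
    next
      fix t assume "t \<in> carrier (sec ?C W)"
      then have t: "t \<in> W \<rightarrow>\<^sub>E carrier (stalk T F x)" "locally_const ?T W t" by (auto simp: C)
      let ?s = "\<lambda>y\<in>W. const_germ y (germ_value x (t y))"
      have gv: "germ_value x (t y) \<in> carrier G" if "y \<in> W" for y
        using t(1) that by (intro germ_value_closed[OF x]) auto
      have s: "?s \<in> carrier (sec ?GS W)"
      proof (rule germ_sheaf_secI)
        fix y assume y: "y \<in> W"
        from locally_constE[OF t(2) y] obtain V where V: "openin ?T V" "y \<in> V"
          "\<And>z. z \<in> W \<Longrightarrow> z \<in> V \<Longrightarrow> t z = t y" by blast
        obtain V' where V': "openin T V'" "V = V' \<inter> S" using V(1) by (auto simp: openin_subtopology)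
        \<comment> \<open>Near \<open>y\<close> the candidate \<open>?s\<close> consists of the
          germs of one global section, which is what \<open>germ_sheaf\<close> asks for.\<close>
        let ?c = "c (germ_value x (t y))"
        note cc = c_closed[OF gv[OF y]] and V't = openin_subset[OF V'(1)]
        have "\<forall>z\<in>W \<inter> V'. ?s z = germ T F z V' (rst F (topspace T) V' ?c)"
        proof
          fix z assume z: "z \<in> W \<inter> V'"
          then have "t z = t y" using V(3)[of z] V'(2) sub[OF W] by auto
          then show "?s z = germ T F z V' (rst F (topspace T) V' ?c)"
            using z germ_rst[OF F openin_topspace V'(1) _ V't cc, of z] by (simp add: const_germ_def)
        qed
        then show "\<exists>U d. openin T U \<and> y \<in> U \<and> d \<in> carrier (sec F U) \<and> (\<forall>z\<in>W \<inter> U. ?s z = germ T F z U d)"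
          using V' V(2) rst_closed[OF F openin_topspace V'(1) V't cc] by (intro exI conjI) auto
      qed simp
      have "\<phi> W ?s = t"
      proof (rule extensionalityI[of _ W])
        fix y assume y: "y \<in> W"
        then have yS: "y \<in> S" using sub[OF W] by auto
        have "t y \<in> carrier (stalk T F x)" using t(1) y by auto
        then show "\<phi> W ?s y = t y"
          using y by (simp add: \<phi>[OF W s] germ_value_const_germ[OF yS gv[OF y]] const_germ_value[OF x])
      qed (use t(1) in \<open>auto simp: \<phi>[OF W s] PiE_def\<close>)
      then show "t \<in> \<phi> W ` carrier (sec ?GS W)" using s by (rule image_eqI[OF sym])
    qed
  qed
  then show ?thesis using mor by (simp add: psh_iso_def)
qed

text \<open>A finite stalk is generated by all of its elements, and the set \<open>S\<close> itself
  serves as trivializing neighbourhood of each of its points.\<close>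

lemma locally_constant_fg:
  assumes fin: "finite (carrier G)"
  shows "locally_constant_fg T F S"
  unfolding locally_constant_fg_def
proof (intro ballI conjI)
  fix x assume x: "x \<in> S"
  interpret st: group "stalk T F x" using group_stalk[OF x] .
  have "generate (stalk T F x) (carrier (stalk T F x)) = carrier (stalk T F x)"
    using st.generate_incl[of "carrier (stalk T F x)"] by (auto intro: generate.incl)
  moreover have "finite (carrier (stalk T F x))" using fin by (simp add: stalk_const_germ[OF x])
  ultimately show "\<exists>A. finite A \<and> A \<subseteq> carrier (stalk T F x) \<and> generate (stalk T F x) A = carrier (stalk T F x)"
    by blast
  show "\<exists>V \<phi>. openin (subtopology T S) V \<and> x \<in> V \<and>
      psh_iso (subtopology T V) (germ_sheaf T F V) (const_sheaf (subtopology T V) (stalk T F x)) \<phi>"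
    using x S germ_sheaf_iso_const[OF x] openin_topspace[of "subtopology T S"]
    by (intro exI[of _ S] exI conjI) (auto simp: Int_absorb1)
qed

end

text \<open>Sheaves with vanishing stalks along \<open>A\<close> fall under the evaluation locale
  with the one-element group \<open>integer_mod_group 1\<close>: any two sections become neutral,
  hence equal, on a smaller neighbourhood.\<close>

lemma locally_constant_fg_trivial:
  assumes F: "presheaf T F" and A: "A \<subseteq> topspace T"
    and triv: "\<And>U s y. openin T U \<Longrightarrow> s \<in> carrier (sec F U) \<Longrightarrow> y \<in> U \<Longrightarrow> y \<in> A \<Longrightarrow>
      \<exists>W. openin T W \<and> y \<in> W \<and> W \<subseteq> U \<and> rst F U W s = \<one>\<^bsub>sec F W\<^esub>"
  shows "locally_constant_fg T F A"
proof -
  have one: "carrier (integer_mod_group 1) = {0}" by (auto simp: carrier_integer_mod_group)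
  interpret presheaf_evaluation T F A "integer_mod_group 1" "\<lambda>_ _ _. 0" "\<lambda>_. \<one>\<^bsub>sec F (topspace T)\<^esub>"
  proof (rule presheaf_evaluation.intro)
    show "presheaf T F" "A \<subseteq> topspace T" by fact+
    show "group (integer_mod_group 1)" by simp
  next
    show "0 \<in> carrier (integer_mod_group 1)" by simp
    show "0 = 0 \<otimes>\<^bsub>integer_mod_group 1\<^esub> 0" by simp
    show "\<one>\<^bsub>sec F (topspace T)\<^esub> \<in> carrier (sec F (topspace T))"
      by (rule monoid.one_closed[OF group.is_monoid[OF presheaf_group[OF F openin_topspace]]])
    show "0 = g" if "g \<in> carrier (integer_mod_group 1)" for g using that one by simp
  next
    fix U s assume U: "openin T U"
    show "locally_const (subtopology T A) (U \<inter> A) (\<lambda>_. 0)"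
      using openin_subset[OF U] by (intro locally_const_const) auto
    fix t y assume s: "s \<in> carrier (sec F U)" and t: "t \<in> carrier (sec F U)" and y: "y \<in> U" "y \<in> A"
    obtain W where W: "openin T W" "y \<in> W" "W \<subseteq> U" "rst F U W s = \<one>\<^bsub>sec F W\<^esub>"
      using triv[OF U s y] by auto
    obtain V where V: "openin T V" "y \<in> V" "V \<subseteq> U" "rst F U V t = \<one>\<^bsub>sec F V\<^esub>"
      using triv[OF U t y] by auto
    let ?Q = "W \<inter> V"
    have Q: "openin T ?Q" using W V by (simp add: openin_Int)
    have "rst F U ?Q s = rst F U ?Q t"
      using rst_rst[OF F U W(1) Q W(3) inf_le1 s] rst_rst[OF F U V(1) Q V(3) inf_le2 t]
        rst_one[OF F W(1) Q inf_le1] rst_one[OF F V(1) Q inf_le2] W(4) V(4) by simp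
    then show "\<exists>W. openin T W \<and> y \<in> W \<and> W \<subseteq> U \<and> rst F U W s = rst F U W t"
      using Q W V by (intro exI[of _ ?Q]) auto
  qed simp
  show ?thesis by (rule locally_constant_fg) (simp only: one finite.intros)
qed

text \<open>A complex with one nonzero term has that term as its cohomology, and the closed set with
  its complement is a sufficient stratification. Stating the lemma for a closed \<open>S\<close> and
  a degree \<open>k\<close> covers both the constant sheaf on the whole variety and the shifted
  direct image from the stratum.\<close>

lemma bounded_constructible_one_degree:
  assumes Y: "variety Y" and S: "closedin (zar Y) S" and K: "complex_of_sheaves (an Y) K" and n: "n > 0"
    and other: "\<And>m U. m \<noteq> k \<Longrightarrow> openin (an Y) U \<Longrightarrow> carrier (sec (trm K m) U) = {\<one>\<^bsub>sec (trm K m) U\<^esub>}"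
    and sec: "\<And>U. openin (an Y) U \<Longrightarrow> sec (trm K k) U = sec (const_Zmod (subtopology (an Y) S) n) (U \<inter> S)"
    and rst: "\<And>U V s. openin (an Y) U \<Longrightarrow> openin (an Y) V \<Longrightarrow> V \<subseteq> U \<Longrightarrow>
      rst (trm K k) U V s = rst (const_Zmod (subtopology (an Y) S) n) (U \<inter> S) (V \<inter> S) s"
  shows "bounded_constructible Y K"
proof -
  let ?T = "an Y" and ?C = "const_Zmod (subtopology (an Y) S) n"
  note P = presheaf_cohomology[OF K] and PK = cplx_presheaf[OF K]
  have S': "closedin ?T S" using closedin_zar_an[OF Y S] .
  have St: "S \<subseteq> topspace ?T" using closedin_subset[OF S'] .
  have coh_one: "\<one>\<^bsub>sec (cohomology_psh K m) U\<^esub> = cohom_class K m U \<one>\<^bsub>sec (trm K m) U\<^esub>"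
    if U: "openin ?T U" for m U
  proof -
    interpret group "sec (trm K m) U" using presheaf_group[OF PK U] .
    show ?thesis
      using coset_mult_one[OF subgroup.subset[OF subgroup_coboundaries[OF K U]]]
      by (simp add: sec_cohomology cohom_class_def)
  qed
  have triv: "s = \<one>\<^bsub>sec (cohomology_psh K m) U\<^esub>"
    if "openin ?T U" "s \<in> carrier (sec (cohomology_psh K m) U)" "carrier (sec (trm K m) U) = {\<one>\<^bsub>sec (trm K m) U\<^esub>}"
    for m U s
    using that cocycles_carrier[of _ K m U] by (auto simp: carrier_cohomology coh_one)
  have cobk: "coboundaries_of K k U = {\<one>\<^bsub>sec (trm K k) U\<^esub>}" if U: "openin ?T U" for U
    using other[OF _ U, of "k - 1"] psh_mor_one[OF cplx_dif_pred[OF K] PK PK U, of k]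
    by (simp add: coboundaries_of_def)
  have cock: "cocycles K k U = carrier (sec (trm K k) U)" if U: "openin ?T U" for U
    using other[OF _ U, of "k + 1"] psh_mor_closed[OF cplx_dif[OF K] U] by (auto simp: cocycles_def)
  \<comment> \<open>With only the neutral coboundary, every coset is a singleton; this is why the
    evaluation below reads sections through \<open>the_elem\<close>.\<close>
  have classk: "cohom_class K k U s = {s}" if U: "openin ?T U" "s \<in> carrier (sec (trm K k) U)" for U s
    using group.is_monoid[OF presheaf_group[OF PK U(1)], THEN monoid.l_one, OF U(2)] cobk[OF U(1)]
    by (simp add: cohom_class_def r_coset_def)
  have elk: "\<exists>f. a = {Fn f} \<and> a = cohom_class K k U (Fn f) \<and> Fn f \<in> carrier (sec (trm K k) U) \<and>
      f \<in> U \<inter> S \<rightarrow>\<^sub>E carrier (integer_mod_group n) \<and> locally_const (subtopology ?T S) (U \<inter> S) f"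
    if U: "openin ?T U" and a: "a \<in> carrier (sec (cohomology_psh K k) U)" for U a
  proof -
    obtain s where s: "s \<in> carrier (sec (trm K k) U)" "a = cohom_class K k U s"
      using a by (auto simp: carrier_cohomology cock[OF U])
    obtain f where "s = Fn f" "f \<in> U \<inter> S \<rightarrow>\<^sub>E carrier (integer_mod_group n)"
      "locally_const (subtopology ?T S) (U \<inter> S) f"
      using s(1) unfolding sec[OF U] by (auto simp: carrier_coded_const(2))
    then show ?thesis using s classk[OF U s(1)] by auto
  qed
  have rstk: "rst (cohomology_psh K k) U V {Fn f} = {Fn (restrict f (V \<inter> S))}"
    if U: "openin ?T U" and V: "openin ?T V" "V \<subseteq> U" and f: "Fn f \<in> carrier (sec (trm K k) U)" for U V f
    using rst_cohom_class[OF K U V f] classk[OF U f] classk[OF V(1) rst_closed[OF PK U V f]] rst[OF U V]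
    by simp
  have fgS: "locally_constant_fg ?T (cohomology_psh K k) S"
  proof -
    interpret presheaf_evaluation ?T "cohomology_psh K k" S "integer_mod_group n" "\<lambda>U a. fn (the_elem a)"
      "\<lambda>g. {Fn (\<lambda>x\<in>topspace ?T \<inter> S. g)}"
    proof (rule presheaf_evaluation.intro)
      show "presheaf ?T (cohomology_psh K k)" by (rule P)
      show "S \<subseteq> topspace ?T" by (rule St)
      show "group (integer_mod_group n)" by simp
    next
      fix U a assume U: "openin ?T U" and a: "a \<in> carrier (sec (cohomology_psh K k) U)"
      obtain f where f: "a = {Fn f}" "a = cohom_class K k U (Fn f)" "Fn f \<in> carrier (sec (trm K k) U)"
        "f \<in> U \<inter> S \<rightarrow>\<^sub>E carrier (integer_mod_group n)" "locally_const (subtopology ?T S) (U \<inter> S) f"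
        using elk[OF U a] by blast
      show "locally_const (subtopology ?T S) (U \<inter> S) (fn (the_elem a))" using f(1,5) by simp
      fix y assume y: "y \<in> S"
      show "fn (the_elem a) y \<in> carrier (integer_mod_group n)" if "y \<in> U" using f(1,4) y that by auto
      show "fn (the_elem (rst (cohomology_psh K k) U V a)) y = fn (the_elem a) y"
        if "openin ?T V" "V \<subseteq> U" "y \<in> V" for V
        using rstk[OF U that(1,2) f(3)] f(1) that(3) y by simp
    next
      fix U a b y assume U: "openin ?T U" and a: "a \<in> carrier (sec (cohomology_psh K k) U)"
        and b: "b \<in> carrier (sec (cohomology_psh K k) U)" and y: "y \<in> U" "y \<in> S"
      obtain f where f: "a = {Fn f}" "a = cohom_class K k U (Fn f)" "Fn f \<in> carrier (sec (trm K k) U)"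
        "f \<in> U \<inter> S \<rightarrow>\<^sub>E carrier (integer_mod_group n)" "locally_const (subtopology ?T S) (U \<inter> S) f"
        using elk[OF U a] by blast
      obtain g where g: "b = {Fn g}" "b = cohom_class K k U (Fn g)" "Fn g \<in> carrier (sec (trm K k) U)"
        "g \<in> U \<inter> S \<rightarrow>\<^sub>E carrier (integer_mod_group n)" "locally_const (subtopology ?T S) (U \<inter> S) g"
        using elk[OF U b] by blast
      have fg: "Fn f \<otimes>\<^bsub>sec (trm K k) U\<^esub> Fn g = Fn (\<lambda>x\<in>U \<inter> S. (f x + g x) mod int n)"
        by (simp add: sec[OF U])
      have "Fn f \<otimes>\<^bsub>sec (trm K k) U\<^esub> Fn g \<in> carrier (sec (trm K k) U)"
        using monoid.m_closed[OF group.is_monoid[OF presheaf_group[OF PK U]] f(3) g(3)] .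
      then have "a \<otimes>\<^bsub>sec (cohomology_psh K k) U\<^esub> b = {Fn (\<lambda>x\<in>U \<inter> S. (f x + g x) mod int n)}"
        using mult_cohom_class[OF K U, of "Fn f" k "Fn g"] f(2,3) g(2,3) classk[OF U]
        by (simp add: cock[OF U] fg)
      then show "fn (the_elem (a \<otimes>\<^bsub>sec (cohomology_psh K k) U\<^esub> b)) y
          = fn (the_elem a) y \<otimes>\<^bsub>integer_mod_group n\<^esub> fn (the_elem b) y"
        using y f(1) g(1) by simp
      assume eq: "fn (the_elem a) y = fn (the_elem b) y"
      have yU: "y \<in> U \<inter> S" using y by simp
      from locally_constE[OF f(5) yU] obtain V1 where V1: "openin (subtopology ?T S) V1" "y \<in> V1"
        "\<And>z. z \<in> U \<inter> S \<Longrightarrow> z \<in> V1 \<Longrightarrow> f z = f y" by blast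
      from locally_constE[OF g(5) yU] obtain V2 where V2: "openin (subtopology ?T S) V2" "y \<in> V2"
        "\<And>z. z \<in> U \<inter> S \<Longrightarrow> z \<in> V2 \<Longrightarrow> g z = g y" by blast
      \<comment> \<open>\<open>V1\<close> and \<open>V2\<close> are open in \<open>S\<close> only;
        \<open>W\<close> is an open set of the ambient space whose trace is their
        intersection.\<close>
      obtain W where W: "openin ?T W" "V1 \<inter> V2 = W \<inter> S"
        using openin_Int[OF V1(1) V2(1)] by (auto simp: openin_subtopology)
      have WU: "openin ?T (W \<inter> U)" using W U by (simp add: openin_Int)
      have "restrict f (W \<inter> U \<inter> S) = restrict g (W \<inter> U \<inter> S)"
      proof (rule restrict_ext)
        fix z assume z: "z \<in> W \<inter> U \<inter> S"
        then have "z \<in> U \<inter> S" "z \<in> V1" "z \<in> V2" using W(2) by auto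
        then show "f z = g z" using V1(3) V2(3) eq f(1) g(1) by simp
      qed
      then have "rst (cohomology_psh K k) U (W \<inter> U) a = rst (cohomology_psh K k) U (W \<inter> U) b"
        using rstk[OF U WU inf_le2 f(3)] rstk[OF U WU inf_le2 g(3)] f(1) g(1) by simp
      moreover have "y \<in> W \<inter> U" using V1(2) V2(2) W(2) y by auto
      ultimately show "\<exists>W. openin ?T W \<and> y \<in> W \<and> W \<subseteq> U \<and>
          rst (cohomology_psh K k) U W a = rst (cohomology_psh K k) U W b"
        using WU by (intro exI[of _ "W \<inter> U"]) simp
    next
      fix g assume g: "g \<in> carrier (integer_mod_group n)"
      let ?f = "\<lambda>x\<in>topspace ?T \<inter> S. g"
      have "locally_const (subtopology ?T S) (topspace ?T \<inter> S) (\<lambda>_. g)"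
        by (rule locally_const_const) simp
      then have "locally_const (subtopology ?T S) (topspace ?T \<inter> S) ?f"
        by (subst locally_const_cong[of _ ?f "\<lambda>_. g"]) auto
      then have f: "Fn ?f \<in> carrier (sec (trm K k) (topspace ?T))"
        using g by (simp add: sec[OF openin_topspace] carrier_coded_const)
      then show "{Fn ?f} \<in> carrier (sec (cohomology_psh K k) (topspace ?T))"
        using classk[OF openin_topspace f] by (simp only: carrier_cohomology cock[OF openin_topspace]) (metis image_eqI)
      show "fn (the_elem {Fn ?f}) y = g" if "y \<in> S" for y using that St by auto
    qed
    show ?thesis using n by (intro locally_constant_fg) (simp add: carrier_integer_mod_group)
  qed
  have fg: "locally_constant_fg ?T (cohomology_psh K m) A"
    if A: "A \<in> {S, topspace (zar Y) - S}" for m A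
  proof (cases "m = k \<and> A = S")
    case True
    then show ?thesis using fgS by simp
  next
    case False
    show ?thesis
    proof (rule locally_constant_fg_trivial[OF P])
      show "A \<subseteq> topspace ?T" using A St topspace_an[OF Y] by auto
      fix U s y assume U: "openin ?T U" and s: "s \<in> carrier (sec (cohomology_psh K m) U)" and y: "y \<in> U" "y \<in> A"
      show "\<exists>W. openin ?T W \<and> y \<in> W \<and> W \<subseteq> U \<and> rst (cohomology_psh K m) U W s = \<one>\<^bsub>sec (cohomology_psh K m) W\<^esub>"
      proof (cases "m = k")
        case True
        then have yS: "y \<notin> S" using A y False by auto
        \<comment> \<open>In degree \<open>k\<close>, a point off \<open>S\<close> has this
          neighbourhood with empty trace, over which the term of the complex is trivial.\<close>
        let ?W = "U - S"
        have W: "openin ?T ?W" "?W \<subseteq> U" "?W \<inter> S = {}" using U S' by (auto simp: openin_diff)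
        have "carrier (sec (trm K m) ?W) = {\<one>\<^bsub>sec (trm K m) ?W\<^esub>}"
          using True sec[OF W(1)] W(3) by (auto simp: carrier_coded_const(2) locally_const_def fun_eq_iff)
        then have "rst (cohomology_psh K m) U ?W s = \<one>\<^bsub>sec (cohomology_psh K m) ?W\<^esub>"
          by (intro triv[OF W(1) rst_closed[OF P U W(1,2) s]])
        then show ?thesis using W y yS by (intro exI[of _ ?W]) simp
      next
        case False
        then show ?thesis
          using triv[OF U s other[OF _ U]] rst_id[OF P U s] U y by (intro exI[of _ U]) simp
      qed
    qed
  qed
  show ?thesis
    unfolding bounded_constructible_def
  proof (intro conjI allI exI impI ballI)
    \<comment> \<open>The bound on the degrees is \<open>\<bar>k\<bar>\<close>: beyond it a degree
      cannot be equal to \<open>k\<close>.\<close>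
    fix m :: int and x assume m: "\<bar>m\<bar> > \<bar>k\<bar>" and x: "x \<in> topspace ?T"
    then have mk: "m \<noteq> k" by auto
    have "germ ?T (cohomology_psh K m) x U s = \<one>\<^bsub>stalk ?T (cohomology_psh K m) x\<^esub>"
      if "openin ?T U" "x \<in> U" "s \<in> carrier (sec (cohomology_psh K m) U)" for U s
      using triv[OF that(1,3) other[OF mk that(1)]] one_stalk[OF that(1,2) P] by simp
    moreover have "\<one>\<^bsub>stalk ?T (cohomology_psh K m) x\<^esub> \<in> carrier (stalk ?T (cohomology_psh K m) x)"
      using one_stalk[OF openin_topspace x P]
        germ_in_stalk[OF openin_topspace x monoid.one_closed[OF group.is_monoid[OF presheaf_group[OF P openin_topspace]]]]
      by simp
    ultimately show "carrier (stalk ?T (cohomology_psh K m) x) = {\<one>\<^bsub>stalk ?T (cohomology_psh K m) x\<^esub>}"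
      by (auto simp: carrier_stalk)
  next
    show "finite {S, topspace (zar Y) - S}" by simp
    show "\<Union>{S, topspace (zar Y) - S} = topspace (zar Y)" using closedin_subset[OF S] by auto
    show "disjoint {S, topspace (zar Y) - S}" by (auto simp: disjoint_def)
    fix m A assume A: "A \<in> {S, topspace (zar Y) - S}"
    show "locally_constant_fg ?T (cohomology_psh K m) A" using fg[OF A] .
    have "A = topspace (zar Y) \<inter> S \<or> A = (topspace (zar Y) - S) \<inter> topspace (zar Y)"
      using A closedin_subset[OF S] by auto
    moreover have "openin (zar Y) (topspace (zar Y) - S)" using S by (simp add: openin_diff)
    ultimately show "locally_closed (zar Y) A"
      unfolding locally_closed_def using S by (metis openin_topspace closedin_topspace)
  qed
qed

text \<open>The instance in which the closed set is the whole variety, so that the second stratum is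
  empty.\<close>

lemma bounded_constructible_const_Zmod:
  assumes X: "variety X" and n: "n > 0"
  shows "bounded_constructible X (sheaf_cplx (an X) (const_Zmod (an X) n))"
proof (rule bounded_constructible_one_degree[OF X closedin_topspace _ n, where k = 0])
  show "complex_of_sheaves (an X) (sheaf_cplx (an X) (const_Zmod (an X) n))"
    by (simp add: complex_sheaf_cplx sheaf_coded_const)
qed (auto simp: topspace_an[OF X, symmetric] Int_absorb2 openin_subset)

lemma image_shift2_trm [simp]:
  "trm (image_shift2_ob Y S K) m = sheaf_image S (trm K (m + 2))"
  by (simp add: image_shift2_ob_def algebra_simps)

lemma complex_image_shift2:
  "complex_of_sheaves (subtopology (an Y) S) K \<Longrightarrow> complex_of_sheaves (an Y) (image_shift2_ob Y S K)"
  unfolding image_shift2_ob_def by (intro complex_cshift complex_cimage)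

text \<open>Two shifts to the left move the sheaf from degree 0 to degree -2.\<close>

lemma bounded_constructible_image_shift2:
  assumes Y: "variety Y" and S: "closedin (zar Y) S" and n: "n > 0"
  shows "bounded_constructible Y
    (image_shift2_ob Y S (sheaf_cplx (subtopology (an Y) S) (const_Zmod (subtopology (an Y) S) n)))"
  by (rule bounded_constructible_one_degree[OF Y S _ n, where k = "-2"])
    (auto intro!: complex_image_shift2 complex_sheaf_cplx sheaf_coded_const)

section \<open>The image of the inclusion\<close>

lemma carrier_twice_sheaf:
  "t \<in> carrier (sec (twice_sheaf T F) U) \<longleftrightarrow> t \<in> carrier (sec F U) \<and>
    (\<forall>x\<in>U. \<exists>V s. openin T V \<and> x \<in> V \<and> V \<subseteq> U \<and> s \<in> carrier (sec F V) \<and>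
      rst F U V t = s \<otimes>\<^bsub>sec F V\<^esub> s)"
  by (simp add: twice_sheaf_def)

lemma twice_sheaf_simps [simp]:
  "s \<otimes>\<^bsub>sec (twice_sheaf T F) U\<^esub> t = s \<otimes>\<^bsub>sec F U\<^esub> t"
  "\<one>\<^bsub>sec (twice_sheaf T F) U\<^esub> = \<one>\<^bsub>sec F U\<^esub>"
  "rst (twice_sheaf T F) = rst F"
  by (simp_all add: twice_sheaf_def)

lemma sec_twice_sheaf:
  "sec (twice_sheaf T F) U = (sec F U)\<lparr>carrier := carrier (sec (twice_sheaf T F) U)\<rparr>"
  by (simp add: twice_sheaf_def)

lemma twice_sheaf_localE:
  assumes "t \<in> carrier (sec (twice_sheaf T F) U)" "x \<in> U"
  obtains V s where "openin T V" "x \<in> V" "V \<subseteq> U" "s \<in> carrier (sec F V)"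
    "rst F U V t = s \<otimes>\<^bsub>sec F V\<^esub> s"
  using assms unfolding carrier_twice_sheaf by (elim conjE ballE exE) auto

text \<open>Commutativity is essential: in multiplicative notation the product of the squares of
  \<open>s\<close> and \<open>t\<close> is the square of their product. Local roots of the two
  factors are first restricted to a common neighbourhood.\<close>

lemma subgroup_twice_sheaf:
  assumes F: "presheaf T F" and U: "openin T U"
  shows "subgroup (carrier (sec (twice_sheaf T F) U)) (sec F U)"
proof -
  interpret GU: comm_group "sec F U" using presheaf_comm_group[OF F U] .
  show ?thesis
  proof (rule GU.subgroupI)
    show "carrier (sec (twice_sheaf T F) U) \<subseteq> carrier (sec F U)" by (auto simp: carrier_twice_sheaf)
    have "rst F U U \<one>\<^bsub>sec F U\<^esub> = \<one>\<^bsub>sec F U\<^esub> \<otimes>\<^bsub>sec F U\<^esub> \<one>\<^bsub>sec F U\<^esub>"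
      by (simp add: rst_id[OF F U])
    then have "\<one>\<^bsub>sec F U\<^esub> \<in> carrier (sec (twice_sheaf T F) U)"
      unfolding carrier_twice_sheaf using U by (intro conjI ballI GU.one_closed exI[of _ U] exI) auto
    then show "carrier (sec (twice_sheaf T F) U) \<noteq> {}" by blast
  next
    fix a assume a: "a \<in> carrier (sec (twice_sheaf T F) U)"
    then have aF: "a \<in> carrier (sec F U)" by (simp add: carrier_twice_sheaf)
    show "inv\<^bsub>sec F U\<^esub> a \<in> carrier (sec (twice_sheaf T F) U)"
      unfolding carrier_twice_sheaf
    proof (intro conjI ballI)
      show "inv\<^bsub>sec F U\<^esub> a \<in> carrier (sec F U)" using aF by simp
      fix x assume "x \<in> U"
      from twice_sheaf_localE[OF a this] obtain V s where V: "openin T V" "x \<in> V" "V \<subseteq> U"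
        "s \<in> carrier (sec F V)" "rst F U V a = s \<otimes>\<^bsub>sec F V\<^esub> s" .
      interpret GV: comm_group "sec F V" using presheaf_comm_group[OF F V(1)] .
      have "rst F U V (inv\<^bsub>sec F U\<^esub> a) = inv\<^bsub>sec F V\<^esub> s \<otimes>\<^bsub>sec F V\<^esub> inv\<^bsub>sec F V\<^esub> s"
        using group_hom.hom_inv[OF group_hom_rst[OF F U V(1,3)] aF] V(4,5) by (simp add: GV.inv_mult)
      then show "\<exists>V s. openin T V \<and> x \<in> V \<and> V \<subseteq> U \<and> s \<in> carrier (sec F V) \<and>
          rst F U V (inv\<^bsub>sec F U\<^esub> a) = s \<otimes>\<^bsub>sec F V\<^esub> s"
        using V GV.inv_closed[OF V(4)] by blast
    qed
    fix b assume b: "b \<in> carrier (sec (twice_sheaf T F) U)"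
    then have bF: "b \<in> carrier (sec F U)" by (simp add: carrier_twice_sheaf)
    show "a \<otimes>\<^bsub>sec F U\<^esub> b \<in> carrier (sec (twice_sheaf T F) U)"
      unfolding carrier_twice_sheaf
    proof (intro conjI ballI)
      show "a \<otimes>\<^bsub>sec F U\<^esub> b \<in> carrier (sec F U)" using aF bF by simp
      fix x assume x: "x \<in> U"
      from twice_sheaf_localE[OF a x] obtain V s where V: "openin T V" "x \<in> V" "V \<subseteq> U"
        "s \<in> carrier (sec F V)" "rst F U V a = s \<otimes>\<^bsub>sec F V\<^esub> s" .
      from twice_sheaf_localE[OF b x] obtain W t where W: "openin T W" "x \<in> W" "W \<subseteq> U"
        "t \<in> carrier (sec F W)" "rst F U W b = t \<otimes>\<^bsub>sec F W\<^esub> t" .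
      let ?Q = "V \<inter> W"
      have Q: "openin T ?Q" "?Q \<subseteq> U" using V W by (auto simp: openin_Int)
      interpret GQ: comm_group "sec F ?Q" using presheaf_comm_group[OF F Q(1)] .
      let ?s = "rst F V ?Q s" and ?t = "rst F W ?Q t"
      note st = rst_closed[OF F V(1) Q(1) inf_le1 V(4)] rst_closed[OF F W(1) Q(1) inf_le2 W(4)]
      have "rst F U ?Q a = ?s \<otimes>\<^bsub>sec F ?Q\<^esub> ?s"
        using rst_rst[OF F U V(1) Q(1) V(3) inf_le1 aF] rst_mult[OF F V(1) Q(1) inf_le1 V(4) V(4)] V(5) by simp
      moreover have "rst F U ?Q b = ?t \<otimes>\<^bsub>sec F ?Q\<^esub> ?t"
        using rst_rst[OF F U W(1) Q(1) W(3) inf_le2 bF] rst_mult[OF F W(1) Q(1) inf_le2 W(4) W(4)] W(5) by simp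
      ultimately have "rst F U ?Q (a \<otimes>\<^bsub>sec F U\<^esub> b)
          = (?s \<otimes>\<^bsub>sec F ?Q\<^esub> ?t) \<otimes>\<^bsub>sec F ?Q\<^esub> (?s \<otimes>\<^bsub>sec F ?Q\<^esub> ?t)"
        using rst_mult[OF F U Q aF bF] st by (simp add: GQ.m_ac)
      then show "\<exists>V s. openin T V \<and> x \<in> V \<and> V \<subseteq> U \<and> s \<in> carrier (sec F V) \<and>
          rst F U V (a \<otimes>\<^bsub>sec F U\<^esub> b) = s \<otimes>\<^bsub>sec F V\<^esub> s"
        using Q V(2) W(2) GQ.m_closed[OF st] by blast
    qed
  qed
qed

lemma rst_twice_sheaf:
  assumes F: "presheaf T F" and U: "openin T U" and V: "openin T V" "V \<subseteq> U"
    and t: "t \<in> carrier (sec (twice_sheaf T F) U)"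
  shows "rst F U V t \<in> carrier (sec (twice_sheaf T F) V)"
  unfolding carrier_twice_sheaf
proof (intro conjI ballI)
  have tF: "t \<in> carrier (sec F U)" using t by (simp add: carrier_twice_sheaf)
  show "rst F U V t \<in> carrier (sec F V)" using rst_closed[OF F U V tF] .
  fix x assume x: "x \<in> V"
  then have "x \<in> U" using V by auto
  from twice_sheaf_localE[OF t this] obtain W s where W: "openin T W" "x \<in> W" "W \<subseteq> U"
    "s \<in> carrier (sec F W)" "rst F U W t = s \<otimes>\<^bsub>sec F W\<^esub> s" .
  have Q: "openin T (V \<inter> W)" using V W by (simp add: openin_Int)
  have "rst F V (V \<inter> W) (rst F U V t) = rst F W (V \<inter> W) s \<otimes>\<^bsub>sec F (V \<inter> W)\<^esub> rst F W (V \<inter> W) s"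
    using rst_rst[OF F U V(1) Q V(2) inf_le1 tF] rst_rst[OF F U W(1) Q W(3) inf_le2 tF] W(5)
      rst_mult[OF F W(1) Q inf_le2 W(4,4)] by simp
  moreover have "rst F W (V \<inter> W) s \<in> carrier (sec F (V \<inter> W))" using rst_closed[OF F W(1) Q inf_le2 W(4)] .
  ultimately show "\<exists>Va s. openin T Va \<and> x \<in> Va \<and> Va \<subseteq> V \<and> s \<in> carrier (sec F Va) \<and>
      rst F V Va (rst F U V t) = s \<otimes>\<^bsub>sec F Va\<^esub> s"
    using Q x W(2) by (intro exI[of _ "V \<inter> W"] exI[of _ "rst F W (V \<inter> W) s"]) simp
qed

text \<open>Being a double is required only locally, so the section obtained by gluing in
  \<open>F\<close> inherits it from the members of the family.\<close>

lemma sheaf_twice: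
  assumes F: "sheaf T F"
  shows "sheaf T (twice_sheaf T F)"
  unfolding sheaf_def
proof (intro conjI allI impI)
  note P = sheaf_presheaf[OF F]
  have sub: "s \<in> carrier (sec F U)" if "s \<in> carrier (sec (twice_sheaf T F) U)" for s U
    using that by (simp add: carrier_twice_sheaf)
  show "presheaf T (twice_sheaf T F)"
    unfolding presheaf_def
  proof (intro conjI allI impI ballI)
    fix U assume U: "openin T U"
    show "comm_group (sec (twice_sheaf T F) U)"
      by (subst sec_twice_sheaf)
        (rule comm_group_subgroup[OF presheaf_comm_group[OF P U] subgroup_twice_sheaf[OF P U]])
    show "rst (twice_sheaf T F) U U s = s" if "s \<in> carrier (sec (twice_sheaf T F) U)" for s
      using rst_id[OF P U sub[OF that]] by simp
    fix V assume V: "openin T V" "V \<subseteq> U"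
    show "rst (twice_sheaf T F) U V \<in> hom (sec (twice_sheaf T F) U) (sec (twice_sheaf T F) V)"
      by (rule homI) (simp_all add: rst_twice_sheaf[OF P U V] rst_mult[OF P U V] sub)
    fix W s assume "openin T W" "W \<subseteq> V" "s \<in> carrier (sec (twice_sheaf T F) U)"
    then show "rst (twice_sheaf T F) V W (rst (twice_sheaf T F) U V s) = rst (twice_sheaf T F) U W s"
      using rst_rst[OF P U V(1) _ V(2)] sub by simp
  qed
  fix \<U> s assume s: "\<forall>U\<in>\<U>. openin T U \<and> s U \<in> carrier (sec (twice_sheaf T F) U)"
    and comp: "\<forall>U\<in>\<U>. \<forall>V\<in>\<U>. rst (twice_sheaf T F) U (U \<inter> V) (s U) = rst (twice_sheaf T F) V (U \<inter> V) (s V)"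
  have ex1: "\<exists>!t. t \<in> carrier (sec F (\<Union>\<U>)) \<and> (\<forall>U\<in>\<U>. rst F (\<Union>\<U>) U t = s U)"
  proof (rule sheaf_unique_gluing[OF F])
    show "openin T U \<and> s U \<in> carrier (sec F U)" if "U \<in> \<U>" for U using s sub that by blast
    show "rst F U (U \<inter> V) (s U) = rst F V (U \<inter> V) (s V)" if "U \<in> \<U>" "V \<in> \<U>" for U V
      using comp that unfolding twice_sheaf_simps by blast
  qed
  then obtain t where t: "t \<in> carrier (sec F (\<Union>\<U>))" "\<forall>U\<in>\<U>. rst F (\<Union>\<U>) U t = s U" by blast
  have oU: "openin T (\<Union>\<U>)" using s by (intro openin_Union) blast
  have "t \<in> carrier (sec (twice_sheaf T F) (\<Union>\<U>))"
    unfolding carrier_twice_sheaf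
  proof (intro conjI ballI)
    fix x assume "x \<in> \<Union>\<U>"
    then obtain U where U: "U \<in> \<U>" "x \<in> U" by auto
    have oU': "openin T U" and sU: "s U \<in> carrier (sec (twice_sheaf T F) U)" using s U by auto
    from twice_sheaf_localE[OF sU U(2)] obtain V r where V: "openin T V" "x \<in> V" "V \<subseteq> U"
      "r \<in> carrier (sec F V)" "rst F U V (s U) = r \<otimes>\<^bsub>sec F V\<^esub> r" .
    have "rst F (\<Union>\<U>) V t = rst F U V (rst F (\<Union>\<U>) U t)"
      using rst_rst[OF P oU oU' V(1) Union_upper[OF U(1)] V(3) t(1)] by simp
    then have "rst F (\<Union>\<U>) V t = r \<otimes>\<^bsub>sec F V\<^esub> r" using t(2) U(1) V(5) by simp
    moreover have "V \<subseteq> \<Union>\<U>" using V(3) U(1) by auto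
    ultimately show "\<exists>V s. openin T V \<and> x \<in> V \<and> V \<subseteq> \<Union>\<U> \<and> s \<in> carrier (sec F V) \<and>
        rst F (\<Union>\<U>) V t = s \<otimes>\<^bsub>sec F V\<^esub> s"
      using V by (intro exI conjI)
  qed (rule t(1))
  then have "t \<in> carrier (sec (twice_sheaf T F) (\<Union>\<U>)) \<and> (\<forall>U\<in>\<U>. rst (twice_sheaf T F) (\<Union>\<U>) U t = s U)"
    using t(2) by simp
  moreover have "t' = t" if "t' \<in> carrier (sec (twice_sheaf T F) (\<Union>\<U>)) \<and>
      (\<forall>U\<in>\<U>. rst (twice_sheaf T F) (\<Union>\<U>) U t' = s U)" for t'
    using that sub[of t'] t ex1 unfolding twice_sheaf_simps by blast
  ultimately show "\<exists>!t. t \<in> carrier (sec (twice_sheaf T F) (\<Union>\<U>)) \<and>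
      (\<forall>U\<in>\<U>. rst (twice_sheaf T F) (\<Union>\<U>) U t = s U)"
    by (rule ex1I)
qed

section \<open>The inclusion of \<int>/2 in \<int>/4 and its image\<close>

lemma incl24_hom: "(\<lambda>k. 2 * k) \<in> hom (integer_mod_group 2) (integer_mod_group 4)"
proof (rule homI)
  fix x y :: int
  have "2 * ((x + y) mod 2) = (2 * x + 2 * y) mod 4"
    using mult_mod_right[of 2 "x + y" 2] by (simp add: distrib_left)
  then show "2 * (x \<otimes>\<^bsub>integer_mod_group 2\<^esub> y) = (2 * x) \<otimes>\<^bsub>integer_mod_group 4\<^esub> (2 * y)"
    by simp
qed (auto simp: carrier_integer_mod_group)

lemma incl24_mor: "psh_mor T (const_Zmod T 2) (const_Zmod T 4) (incl24 T)"
  unfolding incl24_def by (rule constant_map_mor[OF incl24_hom]) simp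

text \<open>Doubling in \<int>/4 depends only on the residue mod 2, and \<open>incl24\<close> is
  doubling of the representatives 0 and 1; the isomorphism \<epsilon> carries doubles to doubles.
  The equality holds over each open set, before any sheafification.\<close>

lemma image_incl24:
  assumes \<epsilon>: "psh_iso T (const_Zmod T 4) E \<epsilon>" and V: "openin T V"
  shows "psh_comp T (const_Zmod T 2) \<epsilon> (incl24 T) V ` carrier (sec (const_Zmod T 2) V)
    = {s \<otimes>\<^bsub>sec E V\<^esub> s | s. s \<in> carrier (sec E V)}"
proof -
  have \<epsilon>m: "psh_mor T (const_Zmod T 4) E \<epsilon>"
    and \<epsilon>b: "\<epsilon> V ` carrier (sec (const_Zmod T 4) V) = carrier (sec E V)"
    using \<epsilon> V by (auto simp: psh_iso_def bij_betw_def)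
  have ap: "psh_comp T (const_Zmod T 2) \<epsilon> (incl24 T) V (Fn f) = \<epsilon> V (Fn (\<lambda>x\<in>V. 2 * f x))"
    if "Fn f \<in> carrier (sec (const_Zmod T 2) V)" for f
    using that V by (simp add: incl24_def)
  show ?thesis
  proof (intro equalityI subsetI)
    fix t assume "t \<in> psh_comp T (const_Zmod T 2) \<epsilon> (incl24 T) V ` carrier (sec (const_Zmod T 2) V)"
    then obtain f where f: "t = \<epsilon> V (Fn (\<lambda>x\<in>V. 2 * f x))" "f \<in> V \<rightarrow>\<^sub>E {0..<2}" "locally_const T V f"
      using ap by (auto simp: carrier_coded_const(2) carrier_integer_mod_group)
    \<comment> \<open>The same function with values 0 and 1 is read in \<int>/4; its double there is
      its image under the inclusion.\<close>
    have f4: "Fn f \<in> carrier (sec (const_Zmod T 4) V)"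
      using f by (force simp: carrier_coded_const carrier_integer_mod_group)
    have "(f x + f x) mod 4 = 2 * f x" if "x \<in> V" for x
    proof -
      have "0 \<le> f x" "f x < 2" using f(2) that by auto
      then show ?thesis by simp
    qed
    then have "Fn f \<otimes>\<^bsub>sec (const_Zmod T 4) V\<^esub> Fn f = Fn (\<lambda>x\<in>V. 2 * f x)"
      by (simp add: fun_eq_iff)
    then have "t = \<epsilon> V (Fn f) \<otimes>\<^bsub>sec E V\<^esub> \<epsilon> V (Fn f)"
      using psh_mor_mult[OF \<epsilon>m V f4 f4] f(1) by simp
    then show "t \<in> {s \<otimes>\<^bsub>sec E V\<^esub> s | s. s \<in> carrier (sec E V)}"
      using psh_mor_closed[OF \<epsilon>m V f4] by blast
  next
    fix t assume "t \<in> {s \<otimes>\<^bsub>sec E V\<^esub> s | s. s \<in> carrier (sec E V)}"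
    then obtain s where s: "t = s \<otimes>\<^bsub>sec E V\<^esub> s" "s \<in> carrier (sec E V)" by auto
    then obtain r where r: "s = \<epsilon> V r" "r \<in> carrier (sec (const_Zmod T 4) V)" using \<epsilon>b by auto
    then obtain g where g: "r = Fn g" "locally_const T V g" by (auto simp: carrier_coded_const(2))
    let ?f = "\<lambda>x\<in>V. g x mod 2"
    have "locally_const T V ?f"
      using locally_const_comp[OF g(2), of "\<lambda>k. k mod 2"]
      by (subst locally_const_cong[of _ ?f "\<lambda>x. g x mod 2"]) auto
    then have f: "Fn ?f \<in> carrier (sec (const_Zmod T 2) V)"
      by (auto simp: carrier_coded_const carrier_integer_mod_group)
    \<comment> \<open>This identity shows that the reduction mod 2 of \<open>g\<close> is a preimage
      of its double.\<close>
    have "(a + a) mod 4 = 2 * (a mod 2)" for a :: int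
      using mult_mod_right[of 2 a 2] by simp
    then have "r \<otimes>\<^bsub>sec (const_Zmod T 4) V\<^esub> r = Fn (\<lambda>x\<in>V. 2 * ?f x)"
      by (simp add: g(1) fun_eq_iff)
    then have "t = \<epsilon> V (Fn (\<lambda>x\<in>V. 2 * ?f x))"
      using psh_mor_mult[OF \<epsilon>m V r(2) r(2)] s(1) r(1) by simp
    then show "t \<in> psh_comp T (const_Zmod T 2) \<epsilon> (incl24 T) V ` carrier (sec (const_Zmod T 2) V)"
      using ap[OF f] f by (intro image_eqI[of _ _ "Fn ?f"]) auto
  qed
qed

text \<open>Each shift replaces the differential by its inverse, which leaves the trivial
  differential trivial. The index \<open>n + 3\<close> combines two shifts with the degree of the
  differential.\<close>

lemma dif_image_shift2:
  assumes F: "sheaf (subtopology (an Y) S) F" and U: "openin (an Y) U"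
    and s: "s \<in> carrier (sec (trm (image_shift2_ob Y S (sheaf_cplx (subtopology (an Y) S) F)) n) U)"
  shows "dif (image_shift2_ob Y S (sheaf_cplx (subtopology (an Y) S) F)) n U s
    = \<one>\<^bsub>sec (trm (sheaf_cplx (subtopology (an Y) S) F) (n + 3)) (U \<inter> S)\<^esub>"
proof -
  let ?T = "an Y" and ?I = "sheaf_cplx (subtopology (an Y) S) F"
  let ?J = "fst (cimage ?T S) ?I"
  note I = complex_sheaf_cplx[OF F] and US = openin_subtopology_Int_trace[OF U, of S]
  interpret G: group "sec (trm ?I (n + 3)) (U \<inter> S)" using presheaf_group[OF cplx_presheaf[OF I] US] .
  have s': "s \<in> carrier (sec (trm ?I (n + 2)) (U \<inter> S))" using s by (simp del: sheaf_cplx_simps)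
  have a: "n + 1 + 1 = n + 2" "n + 2 + 1 = n + 3" "n + 1 + 2 = n + 3" by auto
  have "dif (fst (cshift ?T) ?J) (n + 1) U s
      = inv\<^bsub>sec (trm ?J (n + 3)) U\<^esub> (dif ?J (n + 2) U s)"
    using dif_cshift[OF U, of s ?J "n + 1"] s' by (simp only: a cimage_simps sheaf_image_simps)
  also have "dif ?J (n + 2) U s = \<one>\<^bsub>sec (trm ?I (n + 3)) (U \<inter> S)\<^esub>"
    using dif_sheaf_cplx[OF US s'] U by (simp only: a cimage_simps mor_image_apply)
  finally have 1: "dif (fst (cshift ?T) ?J) (n + 1) U s = \<one>\<^bsub>sec (trm ?I (n + 3)) (U \<inter> S)\<^esub>"
    by (simp only: cimage_simps sheaf_image_simps G.inv_one)
  have "dif (fst (cshift ?T) (fst (cshift ?T) ?J)) n U s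
      = inv\<^bsub>sec (trm (fst (cshift ?T) ?J) (n + 2)) U\<^esub> (dif (fst (cshift ?T) ?J) (n + 1) U s)"
    using s' by (intro dif_cshift[OF U]) (simp only: cshift_simps a cimage_simps sheaf_image_simps)
  then show ?thesis
    unfolding image_shift2_ob_def 1 by (simp only: cshift_simps a cimage_simps sheaf_image_simps G.inv_one)
qed

text \<open>Only degree -2 carries content. There the image condition ranges over open sets of the
  threefold, while \<open>twice_sheaf\<close> ranges over open sets of the stratum. Traces translate
  one into the other.\<close>

lemma is_image_complex_incl24:
  assumes S: "closedin (an Y) S" and E: "sheaf (subtopology (an Y) S) E"
    and \<epsilon>: "psh_iso (subtopology (an Y) S) (const_Zmod (subtopology (an Y) S) 4) E \<epsilon>"
  defines "T' \<equiv> subtopology (an Y) S"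
  shows "is_image_complex (an Y)
    (image_shift2_arr Y S (sheaf_cmap T' (const_Zmod T' 2) E (psh_comp T' (const_Zmod T' 2) \<epsilon> (incl24 T'))))
    (image_shift2_ob Y S (sheaf_cplx T' (twice_sheaf T' E)))"
proof -
  let ?T = "an Y"
  define \<psi> where "\<psi> = psh_comp T' (const_Zmod T' 2) \<epsilon> (incl24 T')"
  let ?f = "\<lambda>n::int. if n = 0 then \<psi> else psh_id T' zero_sheaf"
  define M where "M = image_shift2_ob Y S (sheaf_cplx T' (twice_sheaf T' E))"
  define L where "L = image_shift2_ob Y S (sheaf_cplx T' E)"
  define K where "K = image_shift2_ob Y S (sheaf_cplx T' (const_Zmod T' 2))"
  note P = sheaf_presheaf[OF E[folded T'_def]] and E2 = sheaf_twice[OF E[folded T'_def]]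
  have arr: "image_shift2_arr Y S (sheaf_cmap T' (const_Zmod T' 2) E \<psi>) = (K, \<lambda>n. mor_image ?T S (?f (n + 1 + 1)), L)"
    by (simp add: image_shift2_arr_def sheaf_cmap_def K_def L_def image_shift2_ob_def)
  have image: "\<psi> V ` carrier (sec (const_Zmod T' 2) V) = {s \<otimes>\<^bsub>sec E V\<^esub> s | s. s \<in> carrier (sec E V)}"
    if "openin T' V" for V
    unfolding \<psi>_def using image_incl24[OF \<epsilon>[folded T'_def] that] .
  have trmM: "trm M n = sheaf_image S (if n + 2 = 0 then twice_sheaf T' E else zero_sheaf)"
    and trmL: "trm L n = sheaf_image S (if n + 2 = 0 then E else zero_sheaf)"
    and trmK: "trm K n = sheaf_image S (if n + 2 = 0 then const_Zmod T' 2 else zero_sheaf)" for n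
    by (simp_all add: M_def L_def K_def)
  have sec: "sec (trm M n) U = (sec (trm L n) U)\<lparr>carrier := {t \<in> carrier (sec (trm L n) U).
      \<forall>x\<in>U. \<exists>V. openin ?T V \<and> x \<in> V \<and> V \<subseteq> U \<and>
        rst (trm L n) U V t \<in> mor_image ?T S (?f (n + 1 + 1)) V ` carrier (sec (trm K n) V)}\<rparr>"
    if U: "openin ?T U" for n U
  proof (cases "n = -2")
    case n: True
    have US: "openin T' (U \<inter> S)" unfolding T'_def by (rule openin_subtopology_Int_trace[OF U])
    have "t \<in> carrier (sec (twice_sheaf T' E) (U \<inter> S)) \<longleftrightarrow> t \<in> carrier (sec E (U \<inter> S)) \<and>
      (\<forall>x\<in>U. \<exists>V. openin ?T V \<and> x \<in> V \<and> V \<subseteq> U \<and>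
        rst E (U \<inter> S) (V \<inter> S) t \<in> mor_image ?T S \<psi> V ` carrier (sec (const_Zmod T' 2) (V \<inter> S)))"
      (is "_ \<longleftrightarrow> _ \<and> ?loc t") for t
    proof (cases "t \<in> carrier (sec E (U \<inter> S))")
      case t: True
      have "?loc t" if d: "t \<in> carrier (sec (twice_sheaf T' E) (U \<inter> S))"
      proof
        fix x assume x: "x \<in> U"
        show "\<exists>V. openin ?T V \<and> x \<in> V \<and> V \<subseteq> U \<and>
          rst E (U \<inter> S) (V \<inter> S) t \<in> mor_image ?T S \<psi> V ` carrier (sec (const_Zmod T' 2) (V \<inter> S))"
        proof (cases "x \<in> S")
          case True
          then have "x \<in> U \<inter> S" using x by simp
          from twice_sheaf_localE[OF d this] obtain V s where V: "openin T' V" "x \<in> V" "V \<subseteq> U \<inter> S"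
            "s \<in> carrier (sec E V)" "rst E (U \<inter> S) V t = s \<otimes>\<^bsub>sec E V\<^esub> s" .
          obtain V0 where V0: "openin ?T V0" "V = V0 \<inter> S" using V(1) by (auto simp: T'_def openin_subtopology)
          have W: "openin ?T (V0 \<inter> U)" "V0 \<inter> U \<inter> S = V" using V0 U V(3) by (auto simp: openin_Int)
          have "rst E (U \<inter> S) V t \<in> \<psi> V ` carrier (sec (const_Zmod T' 2) V)"
            unfolding image[OF V(1)] using V(4,5) by blast
          then show ?thesis
            using W V(2) V0(2) x by (intro exI[of _ "V0 \<inter> U"]) (simp add: mor_image_apply)
        next
          case False
          \<comment> \<open>A point off the stratum imposes no condition: near it the trace is
            empty, and the only section there is the double of the neutral one.\<close>
          have W: "openin ?T (U - S)" "(U - S) \<inter> S = {}" using U S by (auto simp: openin_diff)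
          have o: "openin T' {}" by simp
          interpret G: group "sec E {}" using presheaf_group[OF P o] .
          have "rst E (U \<inter> S) {} t \<in> carrier (sec E {})" using rst_closed[OF P US o _ t] by simp
          then have "rst E (U \<inter> S) {} t = \<one>\<^bsub>sec E {}\<^esub> \<otimes>\<^bsub>sec E {}\<^esub> \<one>\<^bsub>sec E {}\<^esub>"
            using sheaf_empty[OF E[folded T'_def]] by simp
          then have "rst E (U \<inter> S) {} t \<in> \<psi> {} ` carrier (sec (const_Zmod T' 2) {})"
            unfolding image[OF o] using G.one_closed by blast
          then show ?thesis
            using W x False by (intro exI[of _ "U - S"]) (simp add: mor_image_apply)
        qed
      qed
      moreover have "t \<in> carrier (sec (twice_sheaf T' E) (U \<inter> S))" if l: "?loc t"
        unfolding carrier_twice_sheaf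
      proof (intro conjI ballI t)
        fix x assume x: "x \<in> U \<inter> S"
        from bspec[OF l IntD1[OF x]] obtain V where V: "openin ?T V" "x \<in> V" "V \<subseteq> U"
          "rst E (U \<inter> S) (V \<inter> S) t \<in> mor_image ?T S \<psi> V ` carrier (sec (const_Zmod T' 2) (V \<inter> S))"
          by (elim exE conjE)
        have VS: "openin T' (V \<inter> S)" unfolding T'_def by (rule openin_subtopology_Int_trace[OF V(1)])
        have "rst E (U \<inter> S) (V \<inter> S) t \<in> {s \<otimes>\<^bsub>sec E (V \<inter> S)\<^esub> s | s. s \<in> carrier (sec E (V \<inter> S))}"
          using V(4) unfolding mor_image_apply[OF V(1)] image[OF VS] .
        then show "\<exists>W s. openin T' W \<and> x \<in> W \<and> W \<subseteq> U \<inter> S \<and> s \<in> carrier (sec E W) \<and>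
            rst E (U \<inter> S) W t = s \<otimes>\<^bsub>sec E W\<^esub> s"
          using VS V(2,3) x by (intro exI[of _ "V \<inter> S"]) auto
      qed
      ultimately show ?thesis using t by blast
    next
      case False
      then show ?thesis by (simp add: carrier_twice_sheaf)
    qed
    then have eq: "carrier (sec (twice_sheaf T' E) (U \<inter> S)) = {t \<in> carrier (sec E (U \<inter> S)). ?loc t}" by blast
    show ?thesis
      unfolding trmM trmL trmK n by (simp, subst sec_twice_sheaf, simp add: eq)
  next
    case False
    then have f: "?f (n + 1 + 1) = psh_id T' zero_sheaf" by simp
    have "mor_image ?T S (psh_id T' zero_sheaf) U (Fn (\<lambda>_. 0)) = Fn (\<lambda>_. 0)"
      using U by (simp add: T'_def openin_subtopology_Int_trace)
    then have "{t \<in> {Fn (\<lambda>_. 0)}. \<forall>x\<in>U. \<exists>V. openin ?T V \<and> x \<in> V \<and> V \<subseteq> U \<and>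
        t \<in> mor_image ?T S (psh_id T' zero_sheaf) V ` {Fn (\<lambda>_. 0)}} = {Fn (\<lambda>_. 0)}"
      using U by (auto intro!: exI[of _ U])
    then show ?thesis
      using False unfolding trmM trmL trmK f by (simp add: zero_sheaf_def singleton_group_def)
  qed
  have dif: "dif M n U s = dif L n U s" if U: "openin ?T U" and s: "s \<in> carrier (sec (trm M n) U)" for n U s
  proof -
    have "s \<in> carrier (sec (trm L n) U)"
      using s unfolding trmM trmL by (auto simp: carrier_twice_sheaf split: if_splits)
    then show ?thesis
      using dif_image_shift2[OF E2[unfolded T'_def] U s[unfolded M_def T'_def]]
        dif_image_shift2[OF E U, of s n] by (simp add: M_def L_def T'_def)
  qed
  have rst: "rst (trm M n) U V s = rst (trm L n) U V s" for n U V s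
    unfolding trmM trmL by simp
  have M: "complex_of_sheaves ?T M"
    unfolding M_def T'_def using E2 by (intro complex_image_shift2 complex_sheaf_cplx) (simp add: T'_def)
  show ?thesis
    unfolding is_image_complex_def \<psi>_def[symmetric] M_def[symmetric]
    unfolding arr Let_def fst_conv snd_conv
    by (intro conjI allI impI ballI M sec dif rst)
qed

section \<open>Betti realization\<close>

lemma Dbc_simps [simp]:
  "cmp (Dbc X) = cmp (Der (an X))" "idt (Dbc X) = idt (Der (an X))"
  "K \<in> ob (Dbc X) \<longleftrightarrow> complex_of_sheaves (an X) K \<and> bounded_constructible X K"
  by (auto simp: Dbc_def Der_def)

lemma Hom_Dbc: "f \<in> Hom (Dbc X) K L \<Longrightarrow> f \<in> Hom (Der (an X)) K L"
  by (simp add: Dbc_def)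

lemma iso_arr_Dbc: "iso_arr (Dbc X) K L f \<longleftrightarrow>
    iso_arr (Der (an X)) K L f \<and> bounded_constructible X K \<and> bounded_constructible X L"
  by (simp add: Dbc_def iso_arr_full_sub)

lemma motivic_formalism_DM:
  assumes "motivic_formalism M" "variety X"
  shows "triangulated_category (DM M X)" "unit_ob M X \<in> ob (DM M X)"
    "is_functor (DM M X) (Dbc X) (Real_B M X)"
    "iso_arr (Dbc X) (fst (Real_B M X) (unit_ob M X)) (sheaf_cplx (an X) (const_Z (an X))) (real_unit M X)"
  using assms by (auto simp: motivic_formalism_def)

lemma motivic_formalism_pushforward:
  assumes "motivic_formalism M" "variety X" "variety Y" "proper_morphism X Y f"
  shows "is_functor (DM M X) (DM M Y) (pushforward M X Y f)"
  using assms by (auto simp: motivic_formalism_def)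

lemma triangulated_category_category: "triangulated_category C \<Longrightarrow> category C"
  and triangulated_category_shift: "triangulated_category C \<Longrightarrow> is_functor C C (shiftf C)"
  by (simp_all add: triangulated_category_def additive_category_def)

text \<open>The cone hypothesis is applied to multiplication by \<open>n\<close> on the constant
  sheaf, with \<open>real_unit\<close> as identification of both source and target. It yields an
  isomorphism from the realized cone to the mapping cone that respects the map from the unit;
  \<open>cone_mod\<close> then carries the mapping cone to \<int>/n.\<close>

lemma ex_canonical_ident:
  assumes M: "motivic_formalism M" and X: "variety X" and n: "n > 0"
    and cones: "commutes_with_cones M X \<sigma>" and ints: "commutes_with_integers M X"
    and C: "unit_mod M X n C q \<delta>"
  shows "\<exists>\<theta>. canonical_ident M X n C q \<theta>"
proof -
  let ?T = "an X" and ?R = "Real_B M X" and ?u = "unit_ob M X" and ?r = "real_unit M X"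
  let ?Z = "sheaf_cplx ?T (const_Z ?T)" and ?L = "sheaf_cplx ?T (const_Zmod ?T n)"
  let ?c = "cmult ?T (int n) ?Z"
  note mf = motivic_formalism_DM[OF M X] and D = category_Der[of ?T]
  have Z: "complex_of_sheaves ?T ?Z"
    by (simp add: complex_sheaf_cplx sheaf_coded_const comm_group_integer_group)
  have u: "idt (DM M X) ?u \<in> Hom (DM M X) ?u ?u"
    using category_id[OF triangulated_category_category[OF mf(1)] mf(2)] .
  have c: "?c \<in> Hom (Ch ?T) ?Z ?Z" using cmult_Hom[OF Z] .
  have Ru: "complex_of_sheaves ?T (fst ?R ?u)" using functor_ob[OF mf(3,2)] by simp
  have r: "?r \<in> Hom (Der ?T) (fst ?R ?u) ?Z" using mf(4) by (simp add: iso_arr_Dbc iso_arr_Hom)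
  have \<mu>: "der_arr ?T (cmult ?T (int n) (fst ?R ?u)) \<in> Hom (Der ?T) (fst ?R ?u) (fst ?R ?u)"
    using der_arr_Hom[OF cmult_Hom[OF Ru]] .
  \<comment> \<open>Compatibility with integers, used for the identity arrow, gives multiplication
    by \<open>n\<close> on the realized unit. Naturality in the derived category moves it across
    \<open>real_unit\<close> to the constant sheaf.\<close>
  have "snd ?R (int_mult (DM M X) (int n) (idt (DM M X) ?u))
      = cmp (Der ?T) (der_arr ?T (cmult ?T (int n) (fst ?R ?u))) (idt (Der ?T) (fst ?R ?u))"
    using ints u functor_id[OF mf(3,2)] by (simp add: commutes_with_integers_def Hom_def)
  also have "\<dots> = der_arr ?T (cmult ?T (int n) (fst ?R ?u))"
    by (rule category_id_right[OF D \<mu>])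
  finally have "cmp (Dbc X) ?r (snd ?R (int_mult (DM M X) (int n) (idt (DM M X) ?u)))
      = cmp (Dbc X) (der_arr ?T ?c) ?r"
    using cmult_natural_Der[OF r, of "int n"] by simp
  then obtain e where e: "iso_arr (Dbc X) (fst ?R C) (ccone ?T ?c) e"
    and eq: "cmp (Dbc X) e (snd ?R q) = cmp (Dbc X) (der_arr ?T (ccone_in ?T ?c)) ?r"
    using cones C c mf(4) unfolding commutes_with_cones_def unit_mod_def by meson
  \<comment> \<open>The target of an isomorphism in \<open>Dbc\<close> is an object, hence a complex
    of sheaves.\<close>
  have cc: "complex_of_sheaves ?T (ccone ?T ?c)" using e by (simp add: iso_arr_def)
  note \<pi> = cone_mod_props[OF n cc]
  let ?\<theta> = "cmp (Der ?T) (der_arr ?T (cone_mod ?T n)) e"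
  have eD: "iso_arr (Der ?T) (fst ?R C) (ccone ?T ?c) e" "bounded_constructible X (fst ?R C)"
    using e by (auto simp: iso_arr_Dbc)
  have \<theta>: "iso_arr (Dbc X) (fst ?R C) ?L ?\<theta>"
    using iso_arr_cmp[OF D eD(1) der_arr_iso[OF \<pi>(1,2)]] eD(2) bounded_constructible_const_Zmod[OF X n]
    by (simp add: iso_arr_Dbc)
  have q: "snd ?R q \<in> Hom (Der ?T) (fst ?R ?u) (fst ?R C)"
    using C by (intro Hom_Dbc functor_Hom[OF mf(3)])
      (simp add: unit_mod_def dist_triangle_def candidate_triangle_def)
  obtain \<phi> where c': "?c = (?Z, \<phi>, ?Z)" "chain_map ?T ?Z \<phi> ?Z" using c by (auto simp: Hom_Ch)
  have ci: "ccone_in ?T ?c \<in> Hom (Ch ?T) ?Z (ccone ?T ?c)"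
    using ccone_in_Hom[OF c'(2) cc[unfolded c'(1)]] by (simp only: c'(1))
  have "cmp (Der ?T) ?\<theta> (snd ?R q) = cmp (Der ?T) (der_arr ?T (cone_mod ?T n)) (cmp (Der ?T) e (snd ?R q))"
    using category_assoc[OF D q iso_arr_Hom[OF eD(1)] der_arr_Hom[OF \<pi>(1)]] by simp
  also have "cmp (Der ?T) e (snd ?R q) = cmp (Der ?T) (der_arr ?T (ccone_in ?T ?c)) ?r"
    using eq by simp
  also have "cmp (Der ?T) (der_arr ?T (cone_mod ?T n)) (cmp (Der ?T) (der_arr ?T (ccone_in ?T ?c)) ?r)
      = cmp (Der ?T) (der_arr ?T (cmp (Ch ?T) (cone_mod ?T n) (ccone_in ?T ?c))) ?r"
    using category_assoc[OF D r der_arr_Hom[OF ci] der_arr_Hom[OF \<pi>(1)]] der_arr_cmp[OF ci \<pi>(1)] by simp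
  finally show ?thesis
    using \<theta> unfolding canonical_ident_def \<pi>(3) by (intro exI[of _ ?\<theta>]) simp
qed

text \<open>Pastes a naturality square with the image under \<open>F\<close> of a given square. It
  is used with \<open>F\<close> the derived shift and the derived direct image, where
  \<open>s\<close> and \<open>s'\<close> are the comparison isomorphisms of the realization.\<close>

lemma transport_natural:
  assumes C: "category C" and C': "category C'" and F: "is_functor C' C F"
    and s: "s \<in> Hom C P (fst F K)" and s': "s' \<in> Hom C P' (fst F K')"
    and \<rho>: "\<rho> \<in> Hom C' K K'" and r: "r \<in> Hom C P P'"
    and nat: "cmp C s' r = cmp C (snd F \<rho>) s"
    and x: "x \<in> Hom C' K B" and x': "x' \<in> Hom C' K' B'" and \<gamma>: "\<gamma> \<in> Hom C' B B'"
    and eq: "cmp C' x' \<rho> = cmp C' \<gamma> x"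
  shows "cmp C (cmp C (snd F x') s') r = cmp C (snd F \<gamma>) (cmp C (snd F x) s)"
proof -
  note H = functor_Hom[OF F]
  have "cmp C (cmp C (snd F x') s') r = cmp C (snd F x') (cmp C (snd F \<rho>) s)"
    using category_assoc[OF C r s' H[OF x']] nat by simp
  also have "\<dots> = cmp C (snd F (cmp C' x' \<rho>)) s"
    using category_assoc[OF C s H[OF \<rho>] H[OF x']] functor_cmp[OF F \<rho> x'] by simp
  also have "\<dots> = cmp C (snd F \<gamma>) (cmp C (snd F x) s)"
    using category_assoc[OF C s H[OF x] H[OF \<gamma>]] functor_cmp[OF F x \<gamma>] eq by simp
  finally show ?thesis .
qed

text \<open>Shaped for iteration: an identification of a realization, together with a commuting
  square over a chain map, yields the same data after a shift. Working in \<open>Der\<close> means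
  that intermediate complexes need not be shown constructible.\<close>

lemma realization_shift:
  assumes M: "motivic_formalism M" and Y: "variety Y" and \<sigma>: "commutes_with_shifts M Y \<sigma>"
    and A: "A \<in> ob (DM M Y)" and x: "iso_arr (Der (an Y)) (fst (Real_B M Y) A) B x"
  defines "y \<equiv> cmp (Der (an Y)) (dshift (an Y) x) (\<sigma> A)"
  shows "iso_arr (Der (an Y)) (fst (Real_B M Y) (shift_ob (DM M Y) A)) (fst (cshift (an Y)) B) y"
    and "f \<in> Hom (DM M Y) A A' \<Longrightarrow> iso_arr (Der (an Y)) (fst (Real_B M Y) A') B' x' \<Longrightarrow>
      g \<in> Hom (Ch (an Y)) B B' \<Longrightarrow>
      cmp (Der (an Y)) x' (snd (Real_B M Y) f) = cmp (Der (an Y)) (der_arr (an Y) g) x \<Longrightarrow>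
      cmp (Der (an Y)) (cmp (Der (an Y)) (dshift (an Y) x') (\<sigma> A')) (snd (Real_B M Y) (shift_arr (DM M Y) f))
        = cmp (Der (an Y)) (der_arr (an Y) (snd (cshift (an Y)) g)) y"
proof -
  let ?T = "an Y" and ?R = "Real_B M Y" and ?D = "DM M Y"
  note mf = motivic_formalism_DM[OF M Y] and D = category_Der[of ?T]
  note sh = triangulated_category_shift[OF mf(1)]
  have \<sigma>iso: "iso_arr (Der ?T) (fst ?R (shift_ob ?D A)) (fst (cshift ?T) (fst ?R A)) (\<sigma> A)"
    if "A \<in> ob ?D" for A
    using \<sigma> that by (simp add: commutes_with_shifts_def iso_arr_Dbc)
  show "iso_arr (Der ?T) (fst ?R (shift_ob ?D A)) (fst (cshift ?T) B) y"
    unfolding y_def using iso_arr_cmp[OF D \<sigma>iso[OF A]] iso_arr_functor[OF functor_dshift x] by simp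
  assume f: "f \<in> Hom ?D A A'" and x': "iso_arr (Der ?T) (fst ?R A') B' x'" and g: "g \<in> Hom (Ch ?T) B B'"
    and eq: "cmp (Der ?T) x' (snd ?R f) = cmp (Der ?T) (der_arr ?T g) x"
  have A': "A' \<in> ob ?D" using category_Hom_ob[OF triangulated_category_category[OF mf(1)] f] by simp
  have "cmp (Der ?T) (\<sigma> A') (snd ?R (shift_arr ?D f)) = cmp (Der ?T) (dshift ?T (snd ?R f)) (\<sigma> A)"
    using \<sigma> f by (auto simp: commutes_with_shifts_def Hom_def)
  then have "cmp (Der ?T) (cmp (Der ?T) (dshift ?T x') (\<sigma> A')) (snd ?R (shift_arr ?D f))
      = cmp (Der ?T) (dshift ?T (der_arr ?T g)) y"
    unfolding y_def
    using transport_natural[OF D D functor_dshift, of "\<sigma> A" "fst ?R (shift_ob ?D A)" "fst ?R A"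
        "\<sigma> A'" "fst ?R (shift_ob ?D A')" "fst ?R A'" "snd ?R f" "snd ?R (shift_arr ?D f)" x B x' B' "der_arr ?T g"]
      iso_arr_Hom[OF \<sigma>iso[OF A]] iso_arr_Hom[OF \<sigma>iso[OF A']] Hom_Dbc[OF functor_Hom[OF mf(3) f]]
      Hom_Dbc[OF functor_Hom[OF mf(3) functor_Hom[OF sh f]]] iso_arr_Hom[OF x] iso_arr_Hom[OF x']
      der_arr_Hom[OF g] eq by simp
  then show "cmp (Der ?T) (cmp (Der ?T) (dshift ?T x') (\<sigma> A')) (snd ?R (shift_arr ?D f))
      = cmp (Der ?T) (der_arr ?T (snd (cshift ?T) g)) y"
    using dshift_der_arr[OF g] by simp
qed

text \<open>The counterpart for direct images, taking data on the stratum to data on the threefold.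
  The square is again represented by a chain map, so the two shifts can be applied to the
  result.\<close>

lemma realization_pushforward:
  assumes M: "motivic_formalism M" and Y: "variety Y" and S: "closedin (zar Y) S"
    and X: "variety (subvariety Y S)" and \<beta>: "commutes_with_pushforward M Y S \<beta>"
    and A: "A \<in> ob (DM M (subvariety Y S))"
    and x: "iso_arr (Der (an (subvariety Y S))) (fst (Real_B M (subvariety Y S)) A) B x"
  defines "P \<equiv> pushforward M (subvariety Y S) Y id"
    and "y \<equiv> cmp (Der (an Y)) (dimage (an Y) S x) (\<beta> A)"
  shows "iso_arr (Der (an Y)) (fst (Real_B M Y) (fst P A)) (fst (cimage (an Y) S) B) y"
    and "f \<in> Hom (DM M (subvariety Y S)) A A' \<Longrightarrow>
      iso_arr (Der (an (subvariety Y S))) (fst (Real_B M (subvariety Y S)) A') B' x' \<Longrightarrow>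
      g \<in> Hom (Ch (an (subvariety Y S))) B B' \<Longrightarrow>
      cmp (Der (an (subvariety Y S))) x' (snd (Real_B M (subvariety Y S)) f)
        = cmp (Der (an (subvariety Y S))) (der_arr (an (subvariety Y S)) g) x \<Longrightarrow>
      cmp (Der (an Y)) (cmp (Der (an Y)) (dimage (an Y) S x') (\<beta> A')) (snd (Real_B M Y) (snd P f))
        = cmp (Der (an Y)) (der_arr (an Y) (snd (cimage (an Y) S) g)) y"
proof -
  let ?X = "subvariety Y S"
  let ?T = "an Y" and ?T' = "an ?X" and ?R = "Real_B M Y" and ?R' = "Real_B M ?X" and ?D = "DM M ?X"
  note mf = motivic_formalism_DM[OF M Y] and mf' = motivic_formalism_DM[OF M X]
  \<comment> \<open>The analytic topology of the subvariety is the trace topology, so the derived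
    category of the stratum is the source of \<open>dimage\<close>.\<close>
  note D = category_Der[of ?T] and D' = category_Der[of ?T'] and T' = an_subvariety[OF Y, of S]
  have Sc: "closedin ?T S" using closedin_zar_an[OF Y S] .
  have P: "is_functor ?D (DM M Y) P"
    unfolding P_def by (rule motivic_formalism_pushforward[OF M X Y proper_morphism_inclusion[OF Y S]])
  have im: "is_functor (Der ?T') (Der ?T) (fst (cimage ?T S), dimage ?T S)"
    unfolding T' by (rule functor_dimage[OF Sc])
  have \<beta>iso: "iso_arr (Der ?T) (fst ?R (fst P A)) (fst (cimage ?T S) (fst ?R' A)) (\<beta> A)"
    if "A \<in> ob ?D" for A
    using \<beta> that by (simp add: commutes_with_pushforward_def Let_def iso_arr_Dbc P_def)
  show "iso_arr (Der ?T) (fst ?R (fst P A)) (fst (cimage ?T S) B) y"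
    unfolding y_def using iso_arr_cmp[OF D \<beta>iso[OF A]] iso_arr_functor[OF im x] by simp
  assume f: "f \<in> Hom ?D A A'" and x': "iso_arr (Der ?T') (fst ?R' A') B' x'" and g: "g \<in> Hom (Ch ?T') B B'"
    and eq: "cmp (Der ?T') x' (snd ?R' f) = cmp (Der ?T') (der_arr ?T' g) x"
  have A': "A' \<in> ob ?D" using category_Hom_ob[OF triangulated_category_category[OF mf'(1)] f] by simp
  have "cmp (Der ?T) (\<beta> A') (snd ?R (snd P f)) = cmp (Der ?T) (dimage ?T S (snd ?R' f)) (\<beta> A)"
    using \<beta> f by (auto simp: commutes_with_pushforward_def Let_def Hom_def P_def)
  then have "cmp (Der ?T) (cmp (Der ?T) (dimage ?T S x') (\<beta> A')) (snd ?R (snd P f))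
      = cmp (Der ?T) (dimage ?T S (der_arr ?T' g)) y"
    unfolding y_def
    using transport_natural[OF D D' im, of "\<beta> A" "fst ?R (fst P A)" "fst ?R' A"
        "\<beta> A'" "fst ?R (fst P A')" "fst ?R' A'" "snd ?R' f" "snd ?R (snd P f)" x B x' B' "der_arr ?T' g"]
      iso_arr_Hom[OF \<beta>iso[OF A]] iso_arr_Hom[OF \<beta>iso[OF A']] Hom_Dbc[OF functor_Hom[OF mf'(3) f]]
      Hom_Dbc[OF functor_Hom[OF mf(3) functor_Hom[OF P f]]] iso_arr_Hom[OF x] iso_arr_Hom[OF x']
      der_arr_Hom[OF g] eq by simp
  moreover have "dimage ?T S (der_arr ?T' g) = der_arr ?T (snd (cimage ?T S) g)"
    using dimage_der_arr[OF Sc] g unfolding T' by blast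
  ultimately show "cmp (Der ?T) (cmp (Der ?T) (dimage ?T S x') (\<beta> A')) (snd ?R (snd P f))
      = cmp (Der ?T) (der_arr ?T (snd (cimage ?T S) g)) y"
    by simp
qed

text \<open>Complexes admit only sheaves with sections in \<open>'p sec\<close>, whereas the
  sections of \<open>link_torsion\<close> are functions with values in germs. So \<open>E\<close> is
  a copy of that local system, identified with it by \<kappa>, and \<epsilon> identifies \<int>/4
  with the copy.\<close>

theorem proposition9p10:
  fixes Y X :: "'p variety" and S :: "'p set"
    and M :: "('p, 'o, 'm) motivic"
    and \<sigma> :: "'p variety \<Rightarrow> 'o \<Rightarrow> 'p darr" and \<beta> :: "'o \<Rightarrow> 'p darr"
    and C2 C4 :: 'o and q2 \<delta>2 q4 \<delta>4 u :: 'm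
    and E :: "'p sh"
    and \<kappa> :: "('p, 'p sec, 'p \<Rightarrow> ('p set \<times> ('p chain \<Rightarrow> int) set) set) pmor"
    and \<epsilon> :: "'p smor"
  assumes threefold: "threefold Y"
    and stratum: "codim_two_stratum Y S"
    and X: "X = subvariety Y S"
    and transverse: "transverse_coble Y S"
    and formalism: "motivic_formalism M"
    and shifts: "commutes_with_shifts M Y (\<sigma> Y)" "commutes_with_shifts M X (\<sigma> X)"
    and cones: "commutes_with_cones M Y (\<sigma> Y)" "commutes_with_cones M X (\<sigma> X)"
    and integers: "commutes_with_integers M Y" "commutes_with_integers M X"
    and pushforward: "commutes_with_pushforward M Y S \<beta>"
    and cone2: "unit_mod M X 2 C2 q2 \<delta>2"
    and cone4: "unit_mod M X 4 C4 q4 \<delta>4"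
    and repr: "represents_incl24 M X C2 q2 C4 q4 u"
    and E: "sheaf (an X) E" "psh_iso (an X) E (link_torsion Y S) \<kappa>"
    and trivialization: "psh_iso (an X) (const_Zmod (an X) 4) E \<epsilon>"
  shows "isomorphic_in (Dbc Y)
           (fst (Real_B M Y) (push_shift2_ob M Y S C2))
           (image_shift2_ob Y S (sheaf_cplx (an X) (const_Zmod (an X) 2))) \<and>
         (\<exists>\<alpha>2 \<alpha>4.
           iso_arr (Dbc Y) (fst (Real_B M Y) (push_shift2_ob M Y S C2))
             (image_shift2_ob Y S (sheaf_cplx (an X) (const_Zmod (an X) 2))) \<alpha>2 \<and>
           iso_arr (Dbc Y) (fst (Real_B M Y) (push_shift2_ob M Y S C4))
             (image_shift2_ob Y S (sheaf_cplx (an X) (const_Zmod (an X) 4))) \<alpha>4 \<and>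
           cmp (Dbc Y) \<alpha>4 (snd (Real_B M Y) (push_shift2_arr M Y S u)) =
           cmp (Dbc Y)
             (der_arr (an Y) (image_shift2_arr Y S
                (sheaf_cmap (an X) (const_Zmod (an X) 2) (const_Zmod (an X) 4) (incl24 (an X)))))
             \<alpha>2) \<and>
         is_image_complex (an Y)
           (image_shift2_arr Y S
              (sheaf_cmap (an X) (const_Zmod (an X) 2) E
                 (psh_comp (an X) (const_Zmod (an X) 2) \<epsilon> (incl24 (an X)))))
           (image_shift2_ob Y S (sheaf_cplx (an X) (twice_sheaf (an X) E)))"
proof -
  have vY: "variety Y" and S: "closedin (zar Y) S" and vX: "variety X"
    using threefold stratum by (auto simp: threefold_def codim_two_stratum_def X)
  note T' = an_subvariety[OF vY, of S, folded X]
  note mfY = motivic_formalism_DM[OF formalism vY] and mfX = motivic_formalism_DM[OF formalism vX]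
  let ?T = "an Y" and ?T' = "an X" and ?P = "pushforward M X Y id" and ?sh = "shift_ob (DM M Y)"
  have P: "is_functor (DM M X) (DM M Y) ?P"
    using motivic_formalism_pushforward[OF formalism vX vY] proper_morphism_inclusion[OF vY S] X by blast
  note sh = triangulated_category_shift[OF mfY(1)]
  have u: "u \<in> Hom (DM M X) C2 C4" using repr by (simp add: represents_incl24_def)
  have Pu: "snd ?P u \<in> Hom (DM M Y) (fst ?P C2) (fst ?P C4)" using functor_Hom[OF P u] .
  have obs: "C2 \<in> ob (DM M X)" "C4 \<in> ob (DM M X)"
    using category_Hom_ob[OF triangulated_category_category[OF mfX(1)] u] by auto
  have PC: "fst ?P C2 \<in> ob (DM M Y)" "fst ?P C4 \<in> ob (DM M Y)" using functor_ob[OF P] obs by auto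
  obtain \<theta>2 \<theta>4 where \<theta>: "canonical_ident M X 2 C2 q2 \<theta>2" "canonical_ident M X 4 C4 q4 \<theta>4"
    using ex_canonical_ident[OF formalism vX _ cones(2) integers(2) cone2]
      ex_canonical_ident[OF formalism vX _ cones(2) integers(2) cone4] by auto
  have \<theta>iso: "iso_arr (Der ?T') (fst (Real_B M X) C2) (sheaf_cplx ?T' (const_Zmod ?T' 2)) \<theta>2"
    "iso_arr (Der ?T') (fst (Real_B M X) C4) (sheaf_cplx ?T' (const_Zmod ?T' 4)) \<theta>4"
    using \<theta> by (auto simp: canonical_ident_def iso_arr_Dbc)
  let ?i = "sheaf_cmap ?T' (const_Zmod ?T' 2) (const_Zmod ?T' 4) (incl24 ?T')"
  have i: "?i \<in> Hom (Ch ?T') (sheaf_cplx ?T' (const_Zmod ?T' 2)) (sheaf_cplx ?T' (const_Zmod ?T' 4))"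
    by (intro sheaf_cmap_Hom sheaf_coded_const incl24_mor) simp_all
  \<comment> \<open>The representing property of \<open>u\<close> is evaluated at the
    identifications just constructed; this is the square that is transported to the
    threefold.\<close>
  have eq: "cmp (Der ?T') \<theta>4 (snd (Real_B M X) u) = cmp (Der ?T') (der_arr ?T' ?i) \<theta>2"
    using conjunct2[OF repr[unfolded represents_incl24_def], rule_format, OF \<theta>] by simp
  note push = realization_pushforward[OF formalism vY S vX[unfolded X] pushforward, folded X]
  note shift = realization_shift[OF formalism vY shifts(1)]
  note a2 = push(1)[OF obs(1) \<theta>iso(1)] and a4 = push(1)[OF obs(2) \<theta>iso(2)]
  note b2 = shift(1)[OF PC(1) a2] and b4 = shift(1)[OF PC(2) a4]
  note c2 = shift(1)[OF functor_ob[OF sh PC(1)] b2] and c4 = shift(1)[OF functor_ob[OF sh PC(2)] b4]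
  have i1: "snd (cimage ?T S) ?i \<in> Hom (Ch ?T) (fst (cimage ?T S) (sheaf_cplx ?T' (const_Zmod ?T' 2)))
      (fst (cimage ?T S) (sheaf_cplx ?T' (const_Zmod ?T' 4)))"
    using functor_Hom[OF functor_cimage] i unfolding T' .
  note i2 = functor_Hom[OF functor_cshift i1]
  note e1 = push(2)[OF obs(1) \<theta>iso(1) u \<theta>iso(2) i eq]
  note e2 = shift(2)[OF PC(1) a2 Pu a4 i1 e1]
  note e3 = shift(2)[OF functor_ob[OF sh PC(1)] b2 functor_Hom[OF sh Pu] b4 i2 e2]
  \<comment> \<open>The sources are constructible because the realization takes values in
    \<open>Dbc\<close>.\<close>
  have bc: "bounded_constructible Y (fst (Real_B M Y) (?sh (?sh (fst ?P C))))"
    if "fst ?P C \<in> ob (DM M Y)" for C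
    using functor_ob[OF mfY(3) functor_ob[OF sh functor_ob[OF sh that]]] by simp
  have bc': "bounded_constructible Y (image_shift2_ob Y S (sheaf_cplx ?T' (const_Zmod ?T' n)))"
    if "n > 0" for n
    unfolding T' by (rule bounded_constructible_image_shift2[OF vY S that])
  \<comment> \<open>Read from the inside: \<theta> is pushed forward after the comparison \<beta>,
    and the result is shifted twice, each time after the comparison \<sigma> on the
    threefold.\<close>
  let ?\<alpha> = "\<lambda>C \<theta>. cmp (Der ?T) (dshift ?T (cmp (Der ?T) (dshift ?T (cmp (Der ?T) (dimage ?T S \<theta>) (\<beta> C)))
      (\<sigma> Y (fst ?P C)))) (\<sigma> Y (?sh (fst ?P C)))"
  have \<alpha>: "\<exists>\<alpha>2 \<alpha>4.
      iso_arr (Dbc Y) (fst (Real_B M Y) (push_shift2_ob M Y S C2))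
        (image_shift2_ob Y S (sheaf_cplx ?T' (const_Zmod ?T' 2))) \<alpha>2 \<and>
      iso_arr (Dbc Y) (fst (Real_B M Y) (push_shift2_ob M Y S C4))
        (image_shift2_ob Y S (sheaf_cplx ?T' (const_Zmod ?T' 4))) \<alpha>4 \<and>
      cmp (Dbc Y) \<alpha>4 (snd (Real_B M Y) (push_shift2_arr M Y S u)) =
      cmp (Dbc Y) (der_arr ?T (image_shift2_arr Y S ?i)) \<alpha>2"
    unfolding iso_arr_Dbc Dbc_simps push_shift2_ob_def push_shift2_arr_def image_shift2_arr_def
      image_shift2_ob_def X[symmetric]
    using bc'[of 2] bc'[of 4] unfolding image_shift2_ob_def
    by (intro exI[of _ "?\<alpha> C2 \<theta>2"] exI[of _ "?\<alpha> C4 \<theta>4"] conjI c2 c4 e3 bc[OF PC(1)] bc[OF PC(2)]) simp_all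
  moreover have "is_image_complex ?T
      (image_shift2_arr Y S (sheaf_cmap ?T' (const_Zmod ?T' 2) E (psh_comp ?T' (const_Zmod ?T' 2) \<epsilon> (incl24 ?T'))))
      (image_shift2_ob Y S (sheaf_cplx ?T' (twice_sheaf ?T' E)))"
    using is_image_complex_incl24[OF closedin_zar_an[OF vY S]] E(1) trivialization unfolding T' by blast
  ultimately show ?thesis
    unfolding isomorphic_in_def by blast
qed

end
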